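(* Fix $T\in]0,+\infty[$. The functional $$I([(V,W)])=\int_0^{V^{\#}(T)}\lambda(y_{(v,w)},v,w)\,dt,\qquad [(V,W)]\in\mathcal W_T,$$ is lower semicontinuous with respect to the metric $d_T^+$ of the space of generalized controls $\mathcal F_{k,T}^0$.
   Context: "Absolutely continuous" on a non-compact interval means absolutely continuous on each compact subinterval. $\mathcal T$ is the set of increasing absolutely continuous bijections of $[0,+\infty[$ with absolutely continuous inverse. Absolutely continuous $g_1,g_2:[0,+\infty[\to\mathbb R^m$ are equivalent if $\inf_{\alpha\in\mathcal T}\|g_1-g_2\circ\alpha\|_{L_\infty[0,+\infty[}=0$; $[g]$ is the equivalence class. $\ell_g(t)=\int_0^t|\dot g|\,ds$. For nondecreasing $\alpha$, $\alpha^{\#}(t)=\sup\{s\ge0:\alpha(s)\le t\}$. $\mathcal Y_{k,T}^0$ is the set of absolutely continuous $(V,W):[0,+\infty[\to\mathbb R^{1+k}$ with $V(0)=0$, $W(0)=0$, $\dot V\ge0$ a.e., $\ell_{(V,W)}(\infty)=+\infty$, $V(\infty)>T$. The space of Fréchet generalized controls is $\mathcal F_{k,T}^0=\{[(V,W)]:(V,W)\in\mathcal Y_{k,T}^0\}$. The truncation $(V_T,W_T)$ equals $(V,W)$ on $[0,V^{\#}(T)[$ and the constant $(T,W(V^{\#}(T)))$ afterwards. $d_T([(V_1,W_1)],[(V_2,W_2)])$ is the infimum, over representatives of the two classes, of the $L_\infty[0,+\infty[$-distance of their truncations, and $$d_T^+([(V_1,W_1)],[(V_2,W_2)])=d_T([(V_1,W_1)],[(V_2,W_2)])+\left|\ell_{(V_1,W_1)}(V_1^{\#}(T))-\ell_{(V_2,W_2)}(V_2^{\#}(T))\right|.$$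 Curves with the same truncated curve are identified. The vector fields $f,g_1,\dots,g_k$ on $\mathbb R^n$ are locally Lipschitz, $G=(g_1,\dots,g_k)$, $x^0\in\mathbb R^n$ is fixed. For $(V,W)\in\mathcal Y_{k,T}^0$, $(v,w)=(\dot V,\dot W)$ and $y_{(v,w)}$ is the maximal solution of $\dot y=f(y)v+G(y)w$, $y(0)=x^0$. $\mathcal W_T$ is the set of $[(V,W)]\in\mathcal F_{k,T}^0$ for which $y_{(v,w)}$ is defined on $[0,V^{\#}(T)]$. $L:\mathbb R^{n+k}\to\mathbb R$, $(x,u)\mapsto L(x,u)$, is continuous and convex in $u$. On $\mathbb R^n\times[0,+\infty[\times\mathbb R^k$ define $\lambda(y,v,w)=L(y,\frac wv)v$ for $v>0$ and $\lambda(y,0,w)=\lim_{\eta\to0^+}L(y,\frac w\eta)\eta\in\,]-\infty,+\infty]$. The value $I([(V,W)])\in\,]-\infty,+\infty]$ does not depend on the representative $(V,W)$. *)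

theory Defs
  imports "HOL-Analysis.Analysis" "HOL-Probability.Essential_Supremum"
begin

section \<open>Absolutely continuous curves on the half-line\<close>

text \<open>
  Curves on \<open>[0,\<infinity>[\<close> are functions on all of \<open>real\<close>; every notion below only looks at their values
  on \<open>{0..}\<close>.
\<close>

text \<open>
  The usual epsilon-delta definition on every compact subinterval \<open>{a..b}\<close> of the interval \<open>J\<close> (for
  compact \<open>J\<close> this is absolute continuity on \<open>J\<close>). A \<open>d\<close> with \<open>d division_of \<Union>d\<close> is a finite family
  of nonempty, non-overlapping compact intervals, each of them being \<open>{Inf k..Sup k}\<close>.
\<close>

definition abs_cont_on :: "real set \<Rightarrow> (real \<Rightarrow> 'a::real_normed_vector) \<Rightarrow> bool" where
  "abs_cont_on J f \<longleftrightarrow>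
     (\<forall>a b. {a..b} \<subseteq> J \<longrightarrow>
       (\<forall>\<epsilon>>0. \<exists>\<delta>>0. \<forall>d. d division_of \<Union>d \<and> \<Union>d \<subseteq> {a..b} \<and> (\<Sum>k\<in>d. Sup k - Inf k) < \<delta> \<longrightarrow>
          (\<Sum>k\<in>d. norm (f (Sup k) - f (Inf k))) < \<epsilon>))"

definition curve_deriv :: "(real \<Rightarrow> 'a::real_normed_vector) \<Rightarrow> real \<Rightarrow> 'a" where
  "curve_deriv g t = vector_derivative g (at t within {0..})"

definition curve_length :: "(real \<Rightarrow> 'a::euclidean_space) \<Rightarrow> real \<Rightarrow> real" where
  "curve_length g t = (LINT s:{0..t}|lebesgue. norm (curve_deriv g s))"

definition Linf_norm :: "(real \<Rightarrow> 'a::euclidean_space) \<Rightarrow> ereal" where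
  "Linf_norm h = esssup (lebesgue_on {0..}) (\<lambda>t. ereal (norm (h t)))"

definition time_changes :: "(real \<Rightarrow> real) set" where
  "time_changes = {\<alpha>. bij_betw \<alpha> {0..} {0..} \<and> strict_mono_on {0..} \<alpha> \<and>
      abs_cont_on {0..} \<alpha> \<and> abs_cont_on {0..} (inv_into {0..} \<alpha>)}"

definition frechet_rel :: "((real \<Rightarrow> 'a::euclidean_space) \<times> (real \<Rightarrow> 'a)) set" where
  "frechet_rel = {(g1, g2). abs_cont_on {0..} g1 \<and> abs_cont_on {0..} g2 \<and>
      (INF \<alpha>\<in>time_changes. Linf_norm (\<lambda>t. g1 t - g2 (\<alpha> t))) = 0}"

text \<open>Equivalence classes are sets of curves; quantities that are independent of the representative
  are evaluated at a chosen one.\<close>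

definition representative :: "'a set \<Rightarrow> 'a" where
  "representative p = (SOME g. g \<in> p)"

definition sharp :: "(real \<Rightarrow> real) \<Rightarrow> real \<Rightarrow> real" where
  "sharp \<alpha> t = Sup {s. 0 \<le> s \<and> \<alpha> s \<le> t}"


section \<open>Generalized controls\<close>

text \<open>A pair \<open>(V,W)\<close> is a single curve \<open>g\<close> with values in \<open>real \<times> (real^'k)\<close>, whose norm is the
  Euclidean one.\<close>

definition gen_curves :: "real \<Rightarrow> (real \<Rightarrow> real \<times> (real^'k)) set" where
  "gen_curves T = {g. abs_cont_on {0..} g \<and> g 0 = 0 \<and>
      (AE t in lebesgue_on {0..}. 0 \<le> fst (curve_deriv g t)) \<and>
      filterlim (curve_length g) at_top at_top \<and>
      ereal T < Lim at_top (\<lambda>t. ereal (fst (g t)))}"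

definition gen_controls :: "real \<Rightarrow> (real \<Rightarrow> real \<times> (real^'k)) set set" where
  "gen_controls T = gen_curves T // frechet_rel"

definition end_time :: "real \<Rightarrow> (real \<Rightarrow> real \<times> (real^'k)) \<Rightarrow> real" where
  "end_time T g = sharp (\<lambda>t. fst (g t)) T"

definition truncation :: "real \<Rightarrow> (real \<Rightarrow> real \<times> (real^'k)) \<Rightarrow> real \<Rightarrow> real \<times> (real^'k)" where
  "truncation T g t = (if t < end_time T g then g t else (T, snd (g (end_time T g))))"

definition dist_T ::
  "real \<Rightarrow> (real \<Rightarrow> real \<times> (real^'k)) set \<Rightarrow> (real \<Rightarrow> real \<times> (real^'k)) set \<Rightarrow> ereal" where
  "dist_T T p q = (INF (g1, g2)\<in>p \<times> q. Linf_norm (\<lambda>t. truncation T g1 t - truncation T g2 t))"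

definition truncated_length :: "real \<Rightarrow> (real \<Rightarrow> real \<times> (real^'k)) \<Rightarrow> real" where
  "truncated_length T g = curve_length g (end_time T g)"

definition dist_T_plus ::
  "real \<Rightarrow> (real \<Rightarrow> real \<times> (real^'k)) set \<Rightarrow> (real \<Rightarrow> real \<times> (real^'k)) set \<Rightarrow> ereal" where
  "dist_T_plus T p q = dist_T T p q +
     ereal \<bar>truncated_length T (representative p) - truncated_length T (representative q)\<bar>"


section \<open>The control system\<close>

definition is_solution ::
  "(real^'n \<Rightarrow> real^'n) \<Rightarrow> ('k \<Rightarrow> real^'n \<Rightarrow> real^'n) \<Rightarrow> real^'n \<Rightarrow>
   (real \<Rightarrow> real \<times> (real^'k)) \<Rightarrow> real set \<Rightarrow> (real \<Rightarrow> real^'n) \<Rightarrow> bool" where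
  "is_solution f G x0 u J y \<longleftrightarrow>
     is_interval J \<and> 0 \<in> J \<and> J \<subseteq> {0..} \<and> abs_cont_on J y \<and> y 0 = x0 \<and>
     (AE t in lebesgue_on J.
        (y has_vector_derivative
           fst (u t) *\<^sub>R f (y t) + (\<Sum>i\<in>UNIV. snd (u t) $ i *\<^sub>R G i (y t))) (at t within J))"

definition is_maximal_solution ::
  "(real^'n \<Rightarrow> real^'n) \<Rightarrow> ('k \<Rightarrow> real^'n \<Rightarrow> real^'n) \<Rightarrow> real^'n \<Rightarrow>
   (real \<Rightarrow> real \<times> (real^'k)) \<Rightarrow> real set \<Rightarrow> (real \<Rightarrow> real^'n) \<Rightarrow> bool" where
  "is_maximal_solution f G x0 u J y \<longleftrightarrow>
     is_solution f G x0 u J y \<and>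
     (\<forall>J' y'. is_solution f G x0 u J' y' \<and> J \<subseteq> J' \<and> (\<forall>t\<in>J. y' t = y t) \<longrightarrow> J' = J)"

text \<open>The pair of the interval of existence and the solution; the latter is arbitrary off the
  former.\<close>

definition maximal_solution ::
  "(real^'n \<Rightarrow> real^'n) \<Rightarrow> ('k \<Rightarrow> real^'n \<Rightarrow> real^'n) \<Rightarrow> real^'n \<Rightarrow>
   (real \<Rightarrow> real \<times> (real^'k)) \<Rightarrow> real set \<times> (real \<Rightarrow> real^'n)" where
  "maximal_solution f G x0 u =
     (SOME p. is_maximal_solution f G x0 u (fst p) (snd p))"

definition trajectory_domain ::
  "(real^'n \<Rightarrow> real^'n) \<Rightarrow> ('k \<Rightarrow> real^'n \<Rightarrow> real^'n) \<Rightarrow> real^'n \<Rightarrow>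
   (real \<Rightarrow> real \<times> (real^'k)) \<Rightarrow> real set" where
  "trajectory_domain f G x0 u = fst (maximal_solution f G x0 u)"

definition trajectory ::
  "(real^'n \<Rightarrow> real^'n) \<Rightarrow> ('k \<Rightarrow> real^'n \<Rightarrow> real^'n) \<Rightarrow> real^'n \<Rightarrow>
   (real \<Rightarrow> real \<times> (real^'k)) \<Rightarrow> real \<Rightarrow> real^'n" where
  "trajectory f G x0 u = snd (maximal_solution f G x0 u)"

definition admissible_controls ::
  "(real^'n \<Rightarrow> real^'n) \<Rightarrow> ('k \<Rightarrow> real^'n \<Rightarrow> real^'n) \<Rightarrow> real^'n \<Rightarrow> real \<Rightarrow>
   (real \<Rightarrow> real \<times> (real^'k)) set set" where
  "admissible_controls f G x0 T =
     {p \<in> gen_controls T.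
        {0..end_time T (representative p)}
          \<subseteq> trajectory_domain f G x0 (curve_deriv (representative p))}"


section \<open>The functional\<close>

definition ext_lagrangian ::
  "(real^'n \<Rightarrow> real^'k \<Rightarrow> real) \<Rightarrow> real^'n \<Rightarrow> real \<Rightarrow> real^'k \<Rightarrow> ereal" where
  "ext_lagrangian L y v w =
     (if v > 0 then ereal (L y (w /\<^sub>R v) * v)
      else Lim (at_right 0) (\<lambda>\<eta>. ereal (L y (w /\<^sub>R \<eta>) * \<eta>)))"

definition ereal_integral :: "'a measure \<Rightarrow> ('a \<Rightarrow> ereal) \<Rightarrow> ereal" where
  "ereal_integral M h =
     enn2ereal (\<integral>\<^sup>+x. e2ennreal (h x) \<partial>M) - enn2ereal (\<integral>\<^sup>+x. e2ennreal (- h x) \<partial>M)"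

definition curve_cost ::
  "(real^'n \<Rightarrow> real^'n) \<Rightarrow> ('k \<Rightarrow> real^'n \<Rightarrow> real^'n) \<Rightarrow> real^'n \<Rightarrow>
   (real^'n \<Rightarrow> real^'k \<Rightarrow> real) \<Rightarrow> real \<Rightarrow> (real \<Rightarrow> real \<times> (real^'k)) \<Rightarrow> ereal" where
  "curve_cost f G x0 L T g =
     ereal_integral (lebesgue_on {0..end_time T g})
       (\<lambda>t. ext_lagrangian L (trajectory f G x0 (curve_deriv g) t)
              (fst (curve_deriv g t)) (snd (curve_deriv g t)))"

definition cost ::
  "(real^'n \<Rightarrow> real^'n) \<Rightarrow> ('k \<Rightarrow> real^'n \<Rightarrow> real^'n) \<Rightarrow> real^'n \<Rightarrow>
   (real^'n \<Rightarrow> real^'k \<Rightarrow> real) \<Rightarrow> real \<Rightarrow> (real \<Rightarrow> real \<times> (real^'k)) set \<Rightarrow> ereal" where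
  "cost f G x0 L T p = curve_cost f G x0 L T (representative p)"

text \<open>
  \<open>D\<close> is allowed to vanish on distinct points. The property then forces \<open>F\<close> to agree on points at
  distance 0 from each other, so it is lower semicontinuity of \<open>F\<close> on the metric space obtained by
  identifying such points (here: generalized controls with the same truncated curve).
\<close>

definition lower_semicontinuous_wrt ::
  "('a \<Rightarrow> 'a \<Rightarrow> ereal) \<Rightarrow> 'a set \<Rightarrow> ('a \<Rightarrow> ereal) \<Rightarrow> bool" where
  "lower_semicontinuous_wrt D S F \<longleftrightarrow>
     (\<forall>p\<in>S. \<forall>c<F p. \<exists>\<delta>>0. \<forall>q\<in>S. D p q < ereal \<delta> \<longrightarrow> c < F q)"

end

theory Submission
  imports Defs
begin

text \<open>
  For a convex Lagrangian the extended integrand \<open>\<lambda>(y, v, w)\<close> is the supremum of the linear functions \<open>a v + b \<bullet> w\<close> over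
  the affine minorants \<open>a + b \<bullet> u\<close> of \<open>L y\<close>, and a bounded minorant at \<open>y\<close> stays one near \<open>y\<close> up to an error
  \<open>\<epsilon> |(v, w)|\<close>. Hence a constant below the cost of \<open>(V, W)\<close> is already exceeded by a finite sum
  \<open>\<Sum>i. a i * \<Delta>V i + b i \<bullet> \<Delta>W i\<close> over a grid, with minorants \<open>(a i, b i)\<close> taken along the trajectory. Such a sum is
  continuous under uniform convergence, and up to \<open>\<epsilon>\<close> times the length it bounds from below the cost of every curve whose
  trajectory is uniformly close; the length term of the metric makes this error harmless and, through Gronwall's
  lemma, the trajectories close. No convergence of derivatives is involved, and reparametrizations enter only as
  homeomorphisms.
\<close>

section \<open>Absolutely continuous functions\<close>

text \<open>The cost is evaluated at a member of the class chosen by \<open>representative\<close>,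
  while \<open>dist_T\<close> may be approached by other members, tied to the chosen one only by
  reparametrizations that bring the curves arbitrarily close. Everything is therefore phrased for
  two curves that are uniformly close after an increasing homeomorphism; passing from the distance
  to the chosen members costs a factor 2. Since close curves may end at different times, each one is
  stopped at its end time and lives on the whole half-line. Derivatives and trajectories are
  introduced by choice operators. A statement about \<open>curve_deriv\<close> presupposes that
  absolutely continuous curves are differentiable almost everywhere, and one about
  \<open>trajectory\<close> that maximal solutions exist. The error budget is the gap between two
  constants below the cost: a quarter goes to \<epsilon> times the length, a quarter to the
  displacement of the grid sum. The lengths of nearby curves are at most that of the given curve
  plus 1, so \<epsilon> is fixed before the grid and \<delta> after it.\<close>

lemma sum_length_le_measure:
  fixes D :: "real set set"
  assumes D: "D division_of \<Union>D" and sub: "\<Union>D \<subseteq> S" and S: "S \<in> lmeasurable"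
  shows "(\<Sum>k\<in>D. Sup k - Inf k) \<le> measure lebesgue S"
proof -
  have "(\<Sum>k\<in>D. Sup k - Inf k) = (\<Sum>k\<in>D. measure lebesgue k)"
  proof (rule sum.cong)
    fix k assume "k \<in> D"
    then obtain u v where k: "k = cbox u v" "k \<noteq> {}" using D division_ofD(3,4) by metis
    then show "Sup k - Inf k = measure lebesgue k" by (simp add: box_real)
  qed simp
  also have "\<dots> = measure lebesgue (\<Union>D)" using content_division D by blast
  also have "\<dots> \<le> measure lebesgue S"
    by (rule measure_mono_fmeasurable) (use assms lmeasurable_division[OF D] fmeasurableD in auto)
  finally show ?thesis .
qed

lemma abs_cont_onD:
  assumes "abs_cont_on J F" "{a..b} \<subseteq> J" "0 < \<epsilon>"
  shows "\<exists>\<delta>>0. \<forall>D. D division_of \<Union>D \<and> \<Union>D \<subseteq> {a..b} \<and> (\<Sum>k\<in>D. Sup k - Inf k) < \<delta> \<longrightarrow>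
      (\<Sum>k\<in>D. norm (F (Sup k) - F (Inf k))) < \<epsilon>"
  using assms unfolding abs_cont_on_def by simp

lemma abs_cont_on_subset: "abs_cont_on J F \<Longrightarrow> I \<subseteq> J \<Longrightarrow> abs_cont_on I F"
  unfolding abs_cont_on_def by (meson order_trans)

text \<open>The fundamental theorem in gauge form. Off \<open>N\<close> differentiability makes the
  error of a cell a small multiple of its length; cells tagged in \<open>N\<close> lie in an open
  set of small measure, where absolute continuity makes the total increment small.\<close>

theorem abs_cont_on_has_integral:
  fixes F :: "real \<Rightarrow> 'a::euclidean_space"
  assumes ab: "a \<le> b" and ac: "abs_cont_on {a..b} F" and N: "negligible N"
    and der: "\<And>t. t \<in> {a..b} - N \<Longrightarrow> (F has_vector_derivative F' t) (at t within {a..b})"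
  shows "(F' has_integral (F b - F a)) {a..b}"
proof -
  \<comment> \<open>With the value 0 on \<open>N\<close>, a cell tagged there adds nothing to the
    Riemann sum, and its error is just the increment of \<open>F\<close>.\<close>
  define f where "f = (\<lambda>t. if t \<in> N then 0 else F' t)"
  have "(f has_integral (F b - F a)) {a..b}"
    unfolding has_integral_real
  proof (intro allI impI)
    fix e :: real assume e: "0 < e"
    obtain \<delta> where \<delta>: "0 < \<delta>"
      "\<And>D. \<lbrakk>D division_of \<Union>D; \<Union>D \<subseteq> {a..b}; (\<Sum>k\<in>D. Sup k - Inf k) < \<delta>\<rbrakk>
        \<Longrightarrow> (\<Sum>k\<in>D. norm (F (Sup k) - F (Inf k))) < e/2"
      using abs_cont_onD[OF ac order_refl half_gt_zero[OF e]] by auto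
    obtain U where U: "open U" "N \<subseteq> U" "U \<in> lmeasurable" "measure lebesgue U < \<delta>"
    proof -
      have N0: "N \<in> null_sets lebesgue" using N negligible_iff_null_sets by blast
      then obtain U where U: "open U" "N \<subseteq> U" "U - N \<in> lmeasurable" "emeasure lebesgue (U - N) < ennreal \<delta>"
        using sets_lebesgue_outer_open[of N \<delta>] \<delta>(1) by (metis null_setsD2)
      have "emeasure lebesgue U = emeasure lebesgue (U - N)"
        using U(1) N0 by (simp add: emeasure_Diff_null_set)
      then have em: "emeasure lebesgue U < ennreal \<delta>" using U(4) by simp
      have "U \<in> lmeasurable"
        using U(1) em by (intro fmeasurableI) (auto intro: order.strict_trans simp: ennreal_less_top)
      moreover from this have "measure lebesgue U < \<delta>"
        using em by (simp add: emeasure_eq_measure2 ennreal_less_iff)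
      ultimately have "U \<in> lmeasurable" "measure lebesgue U < \<delta>" by auto
      then show ?thesis using that U by blast
    qed
    \<comment> \<open>The summand 1 keeps the denominator positive for a = b; what matters is c (b -
      a) < e/2.\<close>
    define c where "c = e / (4 * (b - a + 1))"
    have c: "0 < c" using e ab by (simp add: c_def)
    have "c * (b - a + 1) = e/4" using ab unfolding c_def by (simp add: divide_simps)
    then have c2: "c * (b - a) < e/2" using e c by (simp add: distrib_left)
    have "\<exists>d>0. (t \<in> N \<longrightarrow> ball t d \<subseteq> U) \<and> (t \<in> {a..b} - N \<longrightarrow>
        (\<forall>s\<in>{a..b}. norm (s - t) < d \<longrightarrow> norm (F s - F t - (s - t) *\<^sub>R F' t) \<le> c * norm (s - t)))" for t
    proof (cases "t \<in> N")
      case True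
      then show ?thesis using U openE by blast
    next
      case False
      show ?thesis
      proof (cases "t \<in> {a..b}")
        case True
        then have "t \<in> {a..b} - N" using False by blast
        from der[OF this] c False show ?thesis
          unfolding has_vector_derivative_def has_derivative_within_alt by auto
      qed (use False in \<open>auto intro!: exI[of _ 1]\<close>)
    qed
    then obtain d where d0: "\<And>t. 0 < d t \<and> (t \<in> N \<longrightarrow> ball t (d t) \<subseteq> U) \<and> (t \<in> {a..b} - N \<longrightarrow>
        (\<forall>s\<in>{a..b}. norm (s - t) < d t \<longrightarrow> norm (F s - F t - (s - t) *\<^sub>R F' t) \<le> c * norm (s - t)))"
      by metis
    then have d: "\<And>t. 0 < d t" "\<And>t. t \<in> N \<Longrightarrow> ball t (d t) \<subseteq> U"
      "\<And>t s. \<lbrakk>t \<in> {a..b} - N; s \<in> {a..b}; norm (s - t) < d t\<rbrakk>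
         \<Longrightarrow> norm (F s - F t - (s - t) *\<^sub>R F' t) \<le> c * norm (s - t)" by blast+
    show "\<exists>\<gamma>. gauge \<gamma> \<and> (\<forall>\<D>. \<D> tagged_division_of {a..b} \<and> \<gamma> fine \<D> \<longrightarrow>
        norm ((\<Sum>(x,k)\<in>\<D>. measure lborel k *\<^sub>R f x) - (F b - F a)) < e)"
    proof (intro exI[of _ "\<lambda>x. ball x (d x)"] conjI allI impI; (elim conjE)?)
      show "gauge (\<lambda>x. ball x (d x))" using d(1) gauge_ball_dependent by blast
      fix p assume p: "p tagged_division_of {a..b}" and fine: "(\<lambda>x. ball x (d x)) fine p"
      have fin: "finite p" using p by blast
      define q where "q = {i \<in> p. fst i \<in> N}"
      have qp: "q \<subseteq> p" by (auto simp: q_def)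
      have cell: "\<exists>u v. K = {u..v} \<and> u \<le> v \<and> u \<le> x \<and> x \<le> v \<and> a \<le> u \<and> v \<le> b \<and> {u..v} \<subseteq> ball x (d x)"
        if "(x,K) \<in> p" for x K
      proof -
        have "x \<in> K" "K \<subseteq> {a..b}" "\<exists>u v. K = cbox u v" "K \<subseteq> ball x (d x)"
          using tagged_division_ofD(2,3,4)[OF p that] fine that unfolding fine_def by auto
        then show ?thesis by (auto simp: box_real)
      qed
      define E where "E = (\<lambda>(x,K). measure lborel K *\<^sub>R f x - (F (Sup K) - F (Inf K)))"
      have tele: "b - a = (\<Sum>(x,K)\<in>p. Sup K - Inf K)" "F b - F a = (\<Sum>(x,K)\<in>p. F(Sup K) - F(Inf K))"
        using additive_tagged_division_1[where f= "\<lambda>x. x"] additive_tagged_division_1[where f= F] ab p by auto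
      have "(\<Sum>(x,k)\<in>p. measure lborel k *\<^sub>R f x) - (F b - F a) = sum E p"
        unfolding tele(2) E_def by (simp add: sum_subtractf case_prod_unfold)
      also have "\<dots> = sum E q + sum E (p - q)"
        using fin qp by (metis add.commute sum.subset_diff)
      finally have eq: "(\<Sum>(x,k)\<in>p. measure lborel k *\<^sub>R f x) - (F b - F a) = sum E q + sum E (p - q)" .
      have "norm (sum E (p - q)) \<le> (\<Sum>i\<in>p-q. c * (Sup (snd i) - Inf (snd i)))"
      proof (rule sum_norm_le)
        fix i assume i: "i \<in> p - q"
        obtain x K where xK: "i = (x,K)" by fastforce
        then obtain u v where uv: "K = {u..v}" "u \<le> v" "u \<le> x" "x \<le> v" "a \<le> u" "v \<le> b" "{u..v} \<subseteq> ball x (d x)"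
          using cell i by blast
        have x: "x \<in> {a..b} - N" using i xK uv by (auto simp: q_def)
        have near: "norm (u - x) < d x" "norm (v - x) < d x"
          using uv(2,7) atLeastAtMost_iff[of u u v] atLeastAtMost_iff[of v u v]
          unfolding subset_iff mem_ball dist_norm by (metis norm_minus_commute order_refl)+
        \<comment> \<open>Both end points are compared with the tag, so the error is a difference of
          two remainders of the derivative at \<open>x\<close>.\<close>
        have "E i = (F u - F x - (u - x) *\<^sub>R F' x) - (F v - F x - (v - x) *\<^sub>R F' x)"
          using x uv by (simp add: E_def xK f_def algebra_simps)
        also have "norm \<dots> \<le> c * norm (u - x) + c * norm (v - x)"
          using uv by (intro order_trans[OF norm_triangle_ineq4 add_mono[OF d(3)[OF x _ near(1)] d(3)[OF x _ near(2)]]]) auto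
        also have "\<dots> = c * (v - u)" using uv by (simp add: algebra_simps)
        finally show "norm (E i) \<le> c * (Sup (snd i) - Inf (snd i))" using xK uv by simp
      qed
      also have "\<dots> \<le> (\<Sum>i\<in>p. c * (Sup (snd i) - Inf (snd i)))"
        using fin c cell by (intro sum_mono2) fastforce+
      also have "\<dots> = c * (b - a)" unfolding tele(1) by (simp add: sum_distrib_left case_prod_unfold)
      finally have part1: "norm (sum E (p - q)) \<le> c * (b - a)" .
      have qt: "q tagged_division_of \<Union>(snd ` q)"
        using tagged_partial_division_of_Union_self tagged_partial_division_subset qp p
        by (meson tagged_division_of_def)
      have dq: "(snd ` q) division_of \<Union>(snd ` q)"
        using division_of_tagged_division[OF qt] .
      have qU: "\<Union>(snd ` q) \<subseteq> U"
      proof safe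
        fix y x K assume "(x,K) \<in> q" "y \<in> snd (x,K)"
        then show "y \<in> U" using cell[of x K] d(2)[of x] by (auto simp: q_def)
      qed
      have qab: "\<Union>(snd ` q) \<subseteq> {a..b}" using qp p by fastforce
      have "norm (sum E q) \<le> (\<Sum>i\<in>q. norm (F (Sup (snd i)) - F (Inf (snd i))))"
        by (rule sum_norm_le) (auto simp: E_def q_def f_def norm_minus_commute)
      \<comment> \<open>Distinct tags can share a cell only if it is degenerate, where the increment
        vanishes. The case \<open>K = {}\<close> is split off because nothing useful is known of
        \<open>Sup {}\<close> and \<open>Inf {}\<close>.\<close>
      also have "\<dots> = (\<Sum>(x,K)\<in>q. if K = {} then 0 else norm (F (Sup K) - F (Inf K)))"
        using cell qp by (intro sum.cong) fastforce+
      also have "\<dots> = (\<Sum>K\<in>snd ` q. if K = {} then 0 else norm (F (Sup K) - F (Inf K)))"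
        by (rule sum.over_tagged_division_lemma[OF qt]) (auto simp: box_eq_empty box_real not_le)
      also have "\<dots> = (\<Sum>K\<in>snd ` q. norm (F (Sup K) - F (Inf K)))"
        using cell qp by (intro sum.cong) fastforce+
      also have "\<dots> < e/2"
        by (rule \<delta>(2)[OF dq qab]) (use sum_length_le_measure[OF dq qU U(3)] U(4) in linarith)
      finally have "norm (sum E q) < e/2" .
      then show "norm ((\<Sum>(x,k)\<in>p. measure lborel k *\<^sub>R f x) - (F b - F a)) < e"
        unfolding eq using part1 c2 norm_triangle_ineq[of "sum E q" "sum E (p - q)"] by linarith
    qed
  qed
  then show ?thesis
    by (rule has_integral_spike[OF N, rotated]) (auto simp: f_def)
qed


lemma abs_cont_on_continuous_on:
  fixes F :: "real \<Rightarrow> 'a::real_normed_vector"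
  assumes ac: "abs_cont_on J F" and J: "is_interval J"
  shows "continuous_on J F"
proof -
  have "continuous_on {a..b} F" if ab: "{a..b} \<subseteq> J" for a b
    unfolding continuous_on_iff
  proof (intro ballI allI impI)
    fix x and e :: real assume x: "x \<in> {a..b}" and e: "0 < e"
    obtain \<delta> where \<delta>: "\<delta> > 0" "\<And>D. D division_of \<Union>D \<Longrightarrow> \<Union>D \<subseteq> {a..b} \<Longrightarrow> (\<Sum>k\<in>D. Sup k - Inf k) < \<delta> \<Longrightarrow>
        (\<Sum>k\<in>D. norm (F (Sup k) - F (Inf k))) < e"
      using abs_cont_onD[OF ac ab e] by auto
    have *: "norm (F v - F u) < e" if "a \<le> u" "u \<le> v" "v \<le> b" "v - u < \<delta>" for u v
      using \<delta>(2)[of "{{u..v}}"] division_of_self[of u v] that by (simp add: box_real)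
    have "dist (F y) (F x) < e" if "y \<in> {a..b}" "dist y x < \<delta>" for y
      using *[of x y] *[of y x] that x by (cases "x \<le> y") (auto simp: dist_norm norm_minus_commute)
    then show "\<exists>d>0. \<forall>x'\<in>{a..b}. dist x' x < d \<longrightarrow> dist (F x') (F x) < e"
      using \<delta>(1) by blast
  qed
  show ?thesis
    unfolding continuous_on_eq_continuous_within
  proof
    fix x assume x: "x \<in> J"
    \<comment> \<open>\<open>a\<close> lies strictly left of \<open>x\<close> whenever
      \<open>J\<close> has points there, and \<open>b\<close> likewise on the right, so {a..b} is a
      neighbourhood of \<open>x\<close> relative to \<open>J\<close>.\<close>
    obtain a where a: "a \<in> J" "a \<le> x" "\<And>y. y \<in> J \<Longrightarrow> y < x \<Longrightarrow> a < x"
      using x by (metis order_refl less_imp_le)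
    obtain b where b: "b \<in> J" "x \<le> b" "\<And>y. y \<in> J \<Longrightarrow> x < y \<Longrightarrow> x < b"
      using x by (metis order_refl less_imp_le)
    have sub: "{a..b} \<subseteq> J" using a(1) b(1) J[unfolded is_interval_1] by (blast dest: atLeastAtMost_iff[THEN iffD1])
    have "continuous (at x within {a..b}) F"
      using \<open>{a..b} \<subseteq> J \<Longrightarrow> continuous_on {a..b} F\<close>[OF sub] a b by (simp add: continuous_on_eq_continuous_within)
    moreover have "at x within {a..b} = at x within J"
    proof (rule at_within_nhd[of x "{if a < x then a else x - 1<..<if x < b then b else x + 1}"])
      show "{a..b} \<inter> {if a < x then a else x - 1<..<if x < b then b else x + 1} - {x} =
         J \<inter> {if a < x then a else x - 1<..<if x < b then b else x + 1} - {x}"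
      proof -
        have "y \<in> {a..b}" if "y \<in> J" "y \<in> {if a < x then a else x - 1<..<if x < b then b else x + 1}" "y \<noteq> x" for y
        proof (cases "y < x")
          case True
          then show ?thesis using a(3)[OF that(1) True] that b(2) by auto
        next
          case False
          then have "x < y" using that by simp
          then show ?thesis using b(3)[OF that(1)] that a(2) by auto
        qed
        then show ?thesis using sub by blast
      qed
    qed auto
    ultimately show "continuous (at x within J) F" by (simp add: continuous_within)
  qed
qed

section \<open>Vitali coverings and differentiability of monotone functions\<close>

lemma sum_telescope_division_le:
  fixes F :: "real \<Rightarrow> real"
  assumes D: "D division_of \<Union>D" and sub: "\<Union>D \<subseteq> {a..b}" and ab: "a \<le> b"
    and F: "mono_on {a..b} F"
  shows "(\<Sum>k\<in>D. F (Sup k) - F (Inf k)) \<le> F b - F a"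
proof -
  \<comment> \<open>\<open>D\<close> may have gaps; completing it to a division of the whole
    interval adds only nonnegative increments, and then the sum telescopes.\<close>
  obtain E where E: "D \<subseteq> E" "E division_of cbox a b"
    using partial_division_extend_interval[of D a b] D sub by (metis box_real(2))
  define t where "t = (\<lambda>k::real set. (Inf k, k))"
  have cell: "k \<noteq> {} \<and> (\<exists>u v. k = {u..v} \<and> u \<le> v \<and> a \<le> u \<and> v \<le> b)" if k: "k \<in> E" for k
  proof -
    have "k \<noteq> {}" "k \<subseteq> {a..b}" "\<exists>u v. k = {u..v}"
      using division_ofD(2,3,4)[OF E(2) k] by (auto simp: box_real)
    then show ?thesis by (auto simp: not_le)
  qed
  have inj: "inj_on t E" by (auto simp: t_def inj_on_def)
  have "t ` E tagged_division_of cbox a b"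
  proof (rule tagged_division_ofI)
    show "finite (t ` E)" using E(2) by blast
    fix x K assume xK: "(x,K) \<in> t ` E"
    then have K: "K \<in> E" "x = Inf K" by (auto simp: t_def)
    then show "x \<in> K" using cell[of K] by auto
    show "K \<subseteq> cbox a b" "\<exists>u v. K = cbox u v" using division_ofD(2,4)[OF E(2) K(1)] by auto
    fix x' K' assume "(x',K') \<in> t ` E" "(x,K) \<noteq> (x',K')"
    then have "K' \<in> E" "K \<noteq> K'" using K by (auto simp: t_def)
    then show "interior K \<inter> interior K' = {}" using division_ofD(5)[OF E(2) K(1)] by blast
  next
    have "{K. \<exists>x. (x, K) \<in> t ` E} = E" by (auto simp: t_def)
    then show "\<Union> {K. \<exists>x. (x, K) \<in> t ` E} = cbox a b" using division_ofD(6)[OF E(2)] by simp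
  qed
  then have "(\<Sum>(x,K)\<in>t ` E. F (Sup K) - F (Inf K)) = F b - F a"
    using additive_tagged_division_1[OF ab, of "t ` E" F] by simp
  then have "(\<Sum>k\<in>E. F (Sup k) - F (Inf k)) = F b - F a"
    using inj by (simp add: sum.reindex) (simp add: t_def)
  moreover have "(\<Sum>k\<in>D. F (Sup k) - F (Inf k)) \<le> (\<Sum>k\<in>E. F (Sup k) - F (Inf k))"
  proof (rule sum_mono2)
    fix k assume "k \<in> E - D"
    then obtain u v where "k = {u..v}" "u \<le> v" "a \<le> u" "v \<le> b" using cell by blast
    then show "0 \<le> F (Sup k) - F (Inf k)" using mono_onD[OF F, of u v] by simp
  qed (use E in auto)
  ultimately show ?thesis by simp
qed

lemma division_of_disjoint_intervals:
  fixes C :: "(real \<times> real) set"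
  assumes C: "finite C" "\<And>u v. (u,v) \<in> C \<Longrightarrow> u < v" "pairwise (\<lambda>i j. disjnt {fst i..snd i} {fst j..snd j}) C"
  shows "(\<lambda>i. {fst i..snd i}) ` C division_of \<Union>((\<lambda>i. {fst i..snd i}) ` C)"
    and "inj_on (\<lambda>i. {fst i..snd i}) C"
proof -
  show "inj_on (\<lambda>i. {fst i..snd i}) C"
    using C(2) by (force simp: inj_on_def)
  show "(\<lambda>i. {fst i..snd i}) ` C division_of \<Union>((\<lambda>i. {fst i..snd i}) ` C)"
    unfolding division_of_def
  proof (intro conjI ballI impI)
    fix K K' assume *: "K \<in> (\<lambda>i. {fst i..snd i}) ` C" "K' \<in> (\<lambda>i. {fst i..snd i}) ` C" "K \<noteq> K'"
    then obtain i j where ij: "i \<in> C" "K = {fst i..snd i}" "j \<in> C" "K' = {fst j..snd j}" by auto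
    then have "i \<noteq> j" using * by auto
    then have "K \<inter> K' = {}" using pairwiseD[OF C(3) ij(1,3)] unfolding disjnt_def ij by simp
    then show "interior K \<inter> interior K' = {}" using interior_subset by blast
  next
    fix K assume "K \<in> (\<lambda>i. {fst i..snd i}) ` C"
    then obtain u v where uv: "(u,v) \<in> C" "K = {u..v}" by auto
    then show "K \<noteq> {}" "\<exists>a b. K = cbox a b"
      using C(2)[OF uv(1)] by (auto intro!: exI[of _ u] exI[of _ v])
  qed (use C(1) in auto)
qed

lemma lmeasurable_outer_open:
  assumes S: "S \<in> lmeasurable" and e: "0 < e"
  obtains U where "open U" "S \<subseteq> U" "U \<in> lmeasurable" "measure lebesgue U < measure lebesgue S + e"
proof -
  obtain U where U: "open U" "S \<subseteq> U" "U - S \<in> lmeasurable" "emeasure lebesgue (U - S) < ennreal e"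
    using sets_lebesgue_outer_open[of S e] S e by auto
  have eq: "U = S \<union> (U - S)" using U(2) by blast
  have m: "measure lebesgue (U - S) < e"
    using U(3,4) e by (simp add: emeasure_eq_measure2 ennreal_less_iff)
  have "U \<in> lmeasurable" using fmeasurable.Un[OF S U(3)] eq by simp
  moreover have "measure lebesgue U \<le> measure lebesgue S + measure lebesgue (U - S)"
    using eq measure_Un_le[of S lebesgue "U - S"] S U(3) fmeasurableD by metis
  ultimately show ?thesis using that U m by fastforce
qed

lemma negligible_countable_real:
  fixes A :: "real set"
  assumes "countable A" shows "negligible A"
proof -
  have "negligible (\<Union>((\<lambda>x. {x}) ` A))"
    using assms by (intro negligible_countable_Union) auto
  then show ?thesis by simp
qed

text \<open>Vitali's theorem for balls, applied to midpoints and half lengths and cut down to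
  finitely many intervals. The last conclusion measures open intervals because a second covering
  inside the first one needs room around every point.\<close>

lemma Vitali_covering_real_intervals:
  fixes S :: "real set"
  assumes S: "S \<in> lmeasurable" and B: "open B" "B \<in> lmeasurable" "S \<subseteq> B" and e: "0 < e"
    and fine: "\<And>x d. x \<in> S \<Longrightarrow> 0 < d \<Longrightarrow> \<exists>u v. u < x \<and> x < v \<and> v - u < d \<and> P u v"
  obtains C where "finite C" "\<And>u v. (u,v) \<in> C \<Longrightarrow> u < v \<and> P u v \<and> {u..v} \<subseteq> B"
    "pairwise (\<lambda>i j. disjnt {fst i..snd i} {fst j..snd j}) C"
    "measure lebesgue S - e < (\<Sum>(u,v)\<in>C. v - u)" "(\<Sum>(u,v)\<in>C. v - u) \<le> measure lebesgue B"
    "measure lebesgue S - e < measure lebesgue (S \<inter> (\<Union>(u,v)\<in>C. {u<..<v}))"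
proof -
  define K where "K = {(u,v). u < v \<and> P u v \<and> {u..v} \<subseteq> B}"
  define ce ra where "ce = (\<lambda>i::real \<times> real. (fst i + snd i) / 2)" and "ra = (\<lambda>i::real \<times> real. (snd i - fst i) / 2)"
  have cb: "cball (ce i) (ra i) = {fst i..snd i}" for i
    unfolding ce_def ra_def cball_eq_atLeastAtMost by (simp add: field_simps)
  obtain C where C: "countable C" "C \<subseteq> K"
     "pairwise (\<lambda>i j. disjnt (cball (ce i) (ra i)) (cball (ce j) (ra j))) C"
     "negligible(S - (\<Union>i \<in> C. cball (ce i) (ra i)))"
  proof (rule Vitali_covering_theorem_cballs[of K ra S ce])
    fix i assume "i \<in> K" then show "0 < ra i" by (auto simp: K_def ra_def)
  next
    fix x d :: real assume x: "x \<in> S" and d: "0 < d"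
    obtain r where r: "r > 0" "ball x r \<subseteq> B" using B x openE by blast
    obtain u v where uv: "u < x" "x < v" "v - u < min d r" "P u v"
      using fine[OF x, of "min d r"] d r by auto
    have "{u..v} \<subseteq> ball x r" using uv by (auto simp: dist_real_def)
    then have "(u,v) \<in> K" using uv r by (auto simp: K_def)
    moreover have "x \<in> cball (ce (u,v)) (ra (u,v))" using uv by (simp add: cb)
    moreover have "ra (u,v) < d" using uv by (simp add: ra_def)
    ultimately show "\<exists>i. i \<in> K \<and> x \<in> cball (ce i) (ra i) \<and> ra i < d" by blast
  qed
  define D where "D = (\<lambda>i. S \<inter> {fst i<..<snd i}) ` C"
  have Dm: "T \<in> lmeasurable" if "T \<in> D" for T
    using that S fmeasurable_Int_fmeasurable[OF S] by (auto simp: D_def)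
  \<comment> \<open>Replacing closed by open intervals loses only the countably many end
    points.\<close>
  have "S - \<Union>D \<subseteq> (S - (\<Union>i \<in> C. cball (ce i) (ra i))) \<union> (fst ` C \<union> snd ` C)"
    by (force simp: D_def cb)
  then have neg: "negligible (S - \<Union>D)"
    using C(1,4) by (meson negligible_subset negligible_Un negligible_countable_real countable_Un countable_image)
  have cD: "countable D" using C(1) by (simp add: D_def)
  have UDS: "\<Union>D \<subseteq> S" by (auto simp: D_def)
  have bd: "measure lebesgue (\<Union>\<E>) \<le> measure lebesgue S" if "\<E> \<subseteq> D" "finite \<E>" for \<E>
    using that UDS Dm by (intro measure_mono_fmeasurable[OF _ fmeasurableD[OF fmeasurable.finite_Union] S]) auto
  have UD: "\<Union>D \<in> lmeasurable" "measure lebesgue (\<Union>D) = measure lebesgue S"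
  proof -
    have "negligible (S - \<Union>D \<union> (\<Union>D - S))" using neg UDS by (metis Diff_eq_empty_iff Un_empty_right)
    then show "\<Union>D \<in> lmeasurable" "measure lebesgue (\<Union>D) = measure lebesgue S"
      using S lmeasurable_negligible_symdiff measure_negligible_symdiff by auto
  qed
  obtain E where E: "E \<subseteq> D" "finite E" "measure lebesgue (\<Union>D) - e < measure lebesgue (\<Union>E)"
    using measure_countable_Union_approachable[OF cD e Dm bd] by blast
  obtain C' where C': "C' \<subseteq> C" "finite C'" "E = (\<lambda>i. S \<inter> {fst i<..<snd i}) ` C'"
    using E(1,2) unfolding D_def by (meson finite_subset_image)
  have pw: "pairwise (\<lambda>i j. disjnt {fst i..snd i} {fst j..snd j}) C'"
    using pairwise_subset[OF C(3) C'(1)] unfolding cb .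
  have props: "u < v \<and> P u v \<and> {u..v} \<subseteq> B" if "(u,v) \<in> C'" for u v
    using that C'(1) C(2) by (auto simp: K_def)
  have UE: "\<Union>E = S \<inter> (\<Union>(u,v)\<in>C'. {u<..<v})" by (auto simp: C'(3))
  note div = division_of_disjoint_intervals[OF C'(2) _ pw]
  have "(\<Sum>(u,v)\<in>C'. v - u) = (\<Sum>k\<in>(\<lambda>i. {fst i..snd i}) ` C'. Sup k - Inf k)"
    using props div(2) by (subst sum.reindex) (auto intro!: sum.cong simp: less_imp_le)
  also have "\<dots> \<le> measure lebesgue B"
    by (rule sum_length_le_measure[OF div(1) _ B(2)]) (use props in fastforce)+
  finally have le: "(\<Sum>(u,v)\<in>C'. v - u) \<le> measure lebesgue B" .
  have "measure lebesgue (\<Union>E) \<le> measure lebesgue (\<Union>i\<in>C'. {fst i..snd i})"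
  proof (rule measure_mono_fmeasurable)
    show "\<Union>E \<subseteq> (\<Union>i\<in>C'. {fst i..snd i})" unfolding UE by fastforce
    show "\<Union>E \<in> sets lebesgue" using E Dm by (intro fmeasurableD[OF fmeasurable.finite_Union]) auto
    show "(\<Union>i\<in>C'. {fst i..snd i}) \<in> lmeasurable" using C'(2) by (intro fmeasurable.finite_UN) auto
  qed
  also have "\<dots> \<le> (\<Sum>i\<in>C'. measure lebesgue {fst i..snd i})"
    by (rule measure_UNION_le[OF C'(2)]) auto
  also have "\<dots> = (\<Sum>(u,v)\<in>C'. v - u)" using props by (auto intro!: sum.cong simp: less_imp_le)
  finally have "measure lebesgue S - e < (\<Sum>(u,v)\<in>C'. v - u)" using E(3) UD(2) by linarith
  then show ?thesis using that[OF C'(2) props pw _ le] E(3) UD(2) UE by simp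
qed

lemma sum_increment_disjoint_intervals_le:
  fixes F :: "real \<Rightarrow> real"
  assumes C: "finite C" "\<And>u v. (u,v) \<in> C \<Longrightarrow> u < v \<and> {u..v} \<subseteq> {a..b}"
    "pairwise (\<lambda>i j. disjnt {fst i..snd i} {fst j..snd j}) C"
    and ab: "a \<le> b" and F: "mono F"
  shows "(\<Sum>(u,v)\<in>C. F v - F u) \<le> F b - F a"
proof -
  note div = division_of_disjoint_intervals[OF C(1) _ C(3)]
  have "(\<Sum>(u,v)\<in>C. F v - F u) = (\<Sum>k\<in>(\<lambda>i. {fst i..snd i}) ` C. F (Sup k) - F (Inf k))"
    using C(2) div(2) by (subst sum.reindex) (auto intro!: sum.cong simp: less_imp_le)
  also have "\<dots> \<le> F b - F a"
    by (rule sum_telescope_division_le[OF div(1) _ ab]) (use C(2) F in \<open>fastforce simp: mono_on_def mono_def\<close>)+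
  finally show ?thesis .
qed

text \<open>Intervals of slope below \<open>p\<close> almost cover \<open>S\<close>, and inside them intervals of slope above \<open>q\<close> almost cover it
  again; by monotonicity the second family cannot have the larger total increment.\<close>

lemma negligible_two_slopes:
  fixes F :: "real \<Rightarrow> real"
  assumes F: "mono F" and S: "S \<in> lmeasurable" and pq: "0 < p" "p < q"
    and lo: "\<And>x d. x \<in> S \<Longrightarrow> 0 < d \<Longrightarrow> \<exists>u v. u < x \<and> x < v \<and> v - u < d \<and> F v - F u < p * (v - u)"
    and hi: "\<And>x d. x \<in> S \<Longrightarrow> 0 < d \<Longrightarrow> \<exists>u v. u < x \<and> x < v \<and> v - u < d \<and> q * (v - u) < F v - F u"
  shows "negligible S"
proof -
  define m where "m = measure lebesgue S"
  \<comment> \<open>This is q (m - 2 e) \<le> p (m + e) rearranged: each of the two coverings loses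
    at most e of the measure of \<open>S\<close>, and the open set around \<open>S\<close> has
    measure below m + e.\<close>
  have "(q - p) * m \<le> (2 * q + p) * e" if e: "0 < e" for e
  proof -
    obtain B where B: "open B" "S \<subseteq> B" "B \<in> lmeasurable" "measure lebesgue B < m + e"
      using lmeasurable_outer_open[OF S e] unfolding m_def by blast
    obtain C where C: "finite C" "\<And>u v. (u,v) \<in> C \<Longrightarrow> u < v \<and> F v - F u < p * (v - u) \<and> {u..v} \<subseteq> B"
      "pairwise (\<lambda>i j. disjnt {fst i..snd i} {fst j..snd j}) C"
      "(\<Sum>(u,v)\<in>C. v - u) \<le> measure lebesgue B"
      "m - e < measure lebesgue (S \<inter> (\<Union>(u,v)\<in>C. {u<..<v}))"
      by (rule Vitali_covering_real_intervals[OF S B(1,3,2) e, of "\<lambda>u v. F v - F u < p * (v - u)"])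
        (use lo in \<open>simp_all add: m_def\<close>)
    define S2 where "S2 = S \<inter> (\<Union>(u,v)\<in>C. {u<..<v})"
    have oC: "open (\<Union>(u,v)\<in>C. {u<..<v})" by auto
    have S2: "S2 \<in> lmeasurable" unfolding S2_def using S oC by (intro fmeasurable_Int_fmeasurable) auto
    obtain C' where C': "finite C'" "\<And>u v. (u,v) \<in> C' \<Longrightarrow> u < v \<and>
          (q * (v - u) < F v - F u \<and> (\<exists>i\<in>C. {u..v} \<subseteq> {fst i..snd i})) \<and> {u..v} \<subseteq> B"
      "pairwise (\<lambda>i j. disjnt {fst i..snd i} {fst j..snd j}) C'"
      "measure lebesgue S2 - e < (\<Sum>(u,v)\<in>C'. v - u)"
    proof (rule Vitali_covering_real_intervals[OF S2 B(1,3) _ e, of "\<lambda>u v. q * (v - u) < F v - F u \<and> (\<exists>i\<in>C. {u..v} \<subseteq> {fst i..snd i})"])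
      show "S2 \<subseteq> B" using B(2) by (auto simp: S2_def)
      fix x d :: real assume x: "x \<in> S2" and d: "0 < d"
      then obtain c1 c2 where c: "(c1,c2) \<in> C" "c1 < x" "x < c2" "x \<in> S" by (auto simp: S2_def)
      \<comment> \<open>Shorter than the distance from \<open>x\<close> to both ends of its interval
        in \<open>C\<close>, so that the new interval stays inside that one.\<close>
      obtain u v where uv: "u < x" "x < v" "v - u < min d (min (x - c1) (c2 - x))" "q * (v - u) < F v - F u"
        using hi[OF c(4), of "min d (min (x - c1) (c2 - x))"] d c by auto
      have "{u..v} \<subseteq> {fst (c1,c2)..snd (c1,c2)}" using uv c by auto
      with uv c(1) show "\<exists>u v. u < x \<and> x < v \<and> v - u < d \<and> q * (v - u) < F v - F u \<and> (\<exists>i\<in>C. {u..v} \<subseteq> {fst i..snd i})"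
        by (intro exI[of _ u] exI[of _ v] conjI bexI[of _ "(c1,c2)"]) auto
    qed blast
    \<comment> \<open>\<open>g\<close> assigns to each steep interval a flat one containing it.
      Grouping by \<open>g\<close>, monotonicity bounds the steep increments inside one flat
      interval by the increment of the latter.\<close>
    have "\<exists>g. \<forall>j\<in>C'. g j \<in> C \<and> {fst j..snd j} \<subseteq> {fst (g j)..snd (g j)}"
      using C'(2) by (intro bchoice) force
    then obtain g where g: "\<And>j. j \<in> C' \<Longrightarrow> g j \<in> C \<and> {fst j..snd j} \<subseteq> {fst (g j)..snd (g j)}" by blast
    have "q * (m - 2 * e) \<le> q * (\<Sum>(u,v)\<in>C'. v - u)"
      using C'(4) C(5) pq unfolding S2_def by (intro mult_left_mono) auto
    also have "\<dots> = (\<Sum>(u,v)\<in>C'. q * (v - u))" by (simp add: sum_distrib_left case_prod_unfold)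
    also have "\<dots> \<le> (\<Sum>(u,v)\<in>C'. F v - F u)"
      using C'(2) by (intro sum_mono) (auto simp: less_imp_le)
    also have "\<dots> = (\<Sum>i\<in>C. \<Sum>(u,v)\<in>{j\<in>C'. g j = i}. F v - F u)"
      using g by (intro sum.group[symmetric] C'(1) C(1)) auto
    also have "\<dots> \<le> (\<Sum>i\<in>C. F (snd i) - F (fst i))"
    proof (rule sum_mono)
      fix i assume i: "i \<in> C"
      show "(\<Sum>(u,v)\<in>{j\<in>C'. g j = i}. F v - F u) \<le> F (snd i) - F (fst i)"
      proof (rule sum_increment_disjoint_intervals_le[OF _ _ _ _ F])
        show "fst i \<le> snd i" using C(2)[of "fst i" "snd i"] i by simp
        show "pairwise (\<lambda>i j. disjnt {fst i..snd i} {fst j..snd j}) {j \<in> C'. g j = i}"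
          using C'(3) by (rule pairwise_subset) auto
        fix u v assume uv: "(u,v) \<in> {j \<in> C'. g j = i}"
        then show "u < v \<and> {u..v} \<subseteq> {fst i..snd i}" using g[of "(u,v)"] C'(2)[of u v] by simp
      qed (use C'(1) in auto)
    qed
    also have "\<dots> \<le> (\<Sum>i\<in>C. p * (snd i - fst i))"
      using C(2) by (intro sum_mono) (force simp: less_imp_le)
    also have "\<dots> = p * (\<Sum>(u,v)\<in>C. v - u)" by (simp add: sum_distrib_left case_prod_unfold)
    also have "\<dots> \<le> p * (m + e)" using C(4) B(4) pq by (intro mult_left_mono) auto
    finally show ?thesis by (simp add: algebra_simps)
  qed
  note * = this
  have "m \<le> 0"
  proof (rule ccontr)
    assume "\<not> m \<le> 0"
    then have pos: "0 < (q - p) * m" using pq by simp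
    define e where "e = (q - p) * m / (2 * (2 * q + p))"
    have "0 < e" unfolding e_def using pos pq by (intro divide_pos_pos) auto
    moreover have "(2 * q + p) * e = (q - p) * m / 2" unfolding e_def using pq by (simp add: divide_simps)
    ultimately show False using *[of e] pos by linarith
  qed
  then have "measure lebesgue S = 0" unfolding m_def by (simp add: measure_le_0_iff)
  then show ?thesis using S negligible_iff_measure0 by blast
qed

text \<open>Disjoint intervals of slope above q that almost cover \<open>S\<close> have a total
  increment of nearly q times its measure, yet at most F b - F a; q is arbitrary.\<close>

lemma negligible_infinite_slope:
  fixes F :: "real \<Rightarrow> real"
  assumes F: "mono F" and S: "S \<in> lmeasurable" "S \<subseteq> {a<..<b}"
    and hi: "\<And>x d q. x \<in> S \<Longrightarrow> 0 < d \<Longrightarrow> 0 < q \<Longrightarrow> \<exists>u v. u < x \<and> x < v \<and> v - u < d \<and> q * (v - u) < F v - F u"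
  shows "negligible S"
proof (cases "a < b")
  case False
  then show ?thesis using S(2) by auto
next
  case ab: True
  define m where "m = measure lebesgue S"
  have "q * (m - e) \<le> F b - F a" if e: "0 < e" and q: "0 < q" for e q
  proof -
    obtain C where C: "finite C" "\<And>u v. (u,v) \<in> C \<Longrightarrow> u < v \<and> q * (v - u) < F v - F u \<and> {u..v} \<subseteq> {a<..<b}"
      "pairwise (\<lambda>i j. disjnt {fst i..snd i} {fst j..snd j}) C" "m - e < (\<Sum>(u,v)\<in>C. v - u)"
      by (rule Vitali_covering_real_intervals[OF S(1) _ _ S(2) e, of "\<lambda>u v. q * (v - u) < F v - F u"])
        (use hi q in \<open>simp_all add: m_def\<close>)
    have "q * (m - e) \<le> q * (\<Sum>(u,v)\<in>C. v - u)" using C(4) q by (intro mult_left_mono) auto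
    also have "\<dots> = (\<Sum>(u,v)\<in>C. q * (v - u))" by (simp add: sum_distrib_left case_prod_unfold)
    also have "\<dots> \<le> (\<Sum>(u,v)\<in>C. F v - F u)" using C(2) by (intro sum_mono) (auto simp: less_imp_le)
    also have "\<dots> \<le> F b - F a"
      using C(2) ab by (intro sum_increment_disjoint_intervals_le C F) fastforce+
    finally show ?thesis .
  qed
  note * = this
  have "m \<le> 0"
  proof (rule ccontr)
    assume "\<not> m \<le> 0"
    then have m: "0 < m" by simp
    have Fab: "0 \<le> F b - F a" using monoD[OF F, of a b] ab by simp
    \<comment> \<open>With this slope half the measure of \<open>S\<close> would already account for
      the increment F b - F a + 1.\<close>
    define q where "q = 2 * (F b - F a + 1) / m"
    have "0 < q" using m Fab by (simp add: q_def)
    then have "q * (m / 2) \<le> F b - F a" using *[of "m/2" q] m by simp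
    moreover have "q * (m / 2) = F b - F a + 1" using m by (simp add: q_def)
    ultimately show False by simp
  qed
  then have "measure lebesgue S = 0" unfolding m_def by (simp add: measure_le_0_iff)
  then show ?thesis using S negligible_iff_measure0 by blast
qed

text \<open>Slopes are taken over intervals with \<open>x\<close> in their interior, a condition
  that is open in \<open>x\<close> and so leads to Borel exceptional sets. The derivative is the
  supremum of the eventual lower bounds of these slopes. Finite slopes give continuity at
  \<open>x\<close>, which allows one end point to tend to \<open>x\<close>.\<close>

lemma mono_differentiable_at_of_slopes:
  fixes F :: "real \<Rightarrow> real"
  assumes F: "mono F"
    and fin: "\<exists>d>0. \<exists>q. \<forall>u v. u < x \<and> x < v \<and> v - u < d \<longrightarrow> F v - F u \<le> q * (v - u)"
    and one: "\<And>p q. 0 < p \<Longrightarrow> p < q \<Longrightarrow> p \<in> \<rat> \<Longrightarrow> q \<in> \<rat> \<Longrightarrow>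
      (\<exists>d>0. \<forall>u v. u < x \<and> x < v \<and> v - u < d \<longrightarrow> p * (v - u) \<le> F v - F u) \<or>
      (\<exists>d>0. \<forall>u v. u < x \<and> x < v \<and> v - u < d \<longrightarrow> F v - F u \<le> q * (v - u))"
  shows "F differentiable (at x)"
proof -
  define A where "A = {p. \<exists>d>0. \<forall>u v. u < x \<and> x < v \<and> v - u < d \<longrightarrow> p * (v - u) \<le> F v - F u}"
  obtain d0 q0 where dq: "0 < d0" "\<And>u v. u < x \<Longrightarrow> x < v \<Longrightarrow> v - u < d0 \<Longrightarrow> F v - F u \<le> q0 * (v - u)"
    using fin by blast
  have A0: "0 \<in> A" using monoD[OF F] by (auto simp: A_def intro!: exI[of _ 1])
  have Aq: "p \<le> q0" if "p \<in> A" for p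
  proof -
    have "\<exists>d>0. \<forall>u v. u < x \<and> x < v \<and> v - u < d \<longrightarrow> p * (v - u) \<le> F v - F u"
      using that unfolding A_def by simp
    then obtain d where d: "0 < d" "\<And>u v. u < x \<Longrightarrow> x < v \<Longrightarrow> v - u < d \<Longrightarrow> p * (v - u) \<le> F v - F u"
      by metis
    define h where "h = min d d0 / 4"
    have h: "0 < h" "2 * h < d" "2 * h < d0" using d(1) dq(1) by (auto simp: h_def)
    have "p * (2 * h) \<le> F (x + h) - F (x - h)" using d(2)[of "x - h" "x + h"] h by simp
    also have "\<dots> \<le> q0 * (2 * h)" using dq(2)[of "x - h" "x + h"] h by simp
    finally have "p * (2 * h) \<le> q0 * (2 * h)" .
    then show ?thesis using h mult_right_le_imp_le[of p "2 * h" q0] by simp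
  qed
  define l where "l = Sup A"
  have bdd: "bdd_above A" using Aq by (auto simp: bdd_above_def)
  have l0: "0 \<le> l" unfolding l_def using A0 bdd by (rule cSup_upper)
  have lo: "\<exists>d>0. \<forall>u v. u < x \<and> x < v \<and> v - u < d \<longrightarrow> (l - e) * (v - u) \<le> F v - F u" if e: "0 < e" for e
  proof -
    obtain p where p: "p \<in> A" "l - e < p"
      using less_cSup_iff[of A "l - e"] A0 bdd e unfolding l_def by auto
    then obtain d where d: "0 < d" "\<And>u v. u < x \<Longrightarrow> x < v \<Longrightarrow> v - u < d \<Longrightarrow> p * (v - u) \<le> F v - F u"
      by (auto simp: A_def)
    have "(l - e) * (v - u) \<le> F v - F u" if "u < x" "x < v" "v - u < d" for u v
      using d(2)[OF that] mult_right_mono[of "l - e" p "v - u"] p that by linarith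
    then show ?thesis using d(1) by blast
  qed
  have hi: "\<exists>d>0. \<forall>u v. u < x \<and> x < v \<and> v - u < d \<longrightarrow> F v - F u \<le> (l + e) * (v - u)" if e: "0 < e" for e
  proof -
    \<comment> \<open>A number p above \<open>l\<close> is no eventual lower bound, so the dichotomy
      turns every larger rational q into an eventual upper bound.\<close>
    obtain p where p: "p \<in> \<rat>" "l < p" "p < l + e" using Rats_dense_in_real[of l "l + e"] e by auto
    obtain q where q: "q \<in> \<rat>" "p < q" "q < l + e" using Rats_dense_in_real[of p "l + e"] p by auto
    have "p \<notin> A" using cSup_upper[OF _ bdd] p unfolding l_def by fastforce
    then obtain d where d: "0 < d" "\<And>u v. u < x \<Longrightarrow> x < v \<Longrightarrow> v - u < d \<Longrightarrow> F v - F u \<le> q * (v - u)"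
      using one[of p q] p q l0 unfolding A_def by auto
    have "F v - F u \<le> (l + e) * (v - u)" if "u < x" "x < v" "v - u < d" for u v
      using d(2)[OF that] mult_right_mono[of q "l + e" "v - u"] q that by linarith
    then show ?thesis using d(1) by blast
  qed
  have cont: "(F \<longlongrightarrow> F x) (at x)"
  proof (rule LIM_I)
    fix r :: real assume r: "0 < r"
    define d where "d = min (d0 / 2) (r / (2 * (\<bar>q0\<bar> + 1)))"
    have d: "0 < d" "2 * d \<le> d0" using dq(1) r by (auto simp: d_def)
    have "(\<bar>q0\<bar> + 1) * (2 * d) \<le> (\<bar>q0\<bar> + 1) * (2 * (r / (2 * (\<bar>q0\<bar> + 1))))"
      unfolding d_def by (intro mult_left_mono) auto
    moreover have "K * (2 * (r / (2 * K))) = r" if "0 < K" for K :: real using that by simp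
    ultimately have dr: "(\<bar>q0\<bar> + 1) * (2 * d) \<le> r" by (metis abs_ge_zero add.commute add_pos_nonneg zero_less_one)
    have "\<bar>F y - F x\<bar> < r" if "\<bar>y - x\<bar> < d" for y
    proof -
      \<comment> \<open>Strictly between the distance of \<open>y\<close> from \<open>x\<close> and
        \<open>d\<close>: the interval of radius \<open>h\<close> around \<open>x\<close> contains
        \<open>y\<close> and is short enough.\<close>
      define h where "h = (\<bar>y - x\<bar> + d) / 2"
      have h: "0 < h" "h < d" "\<bar>y - x\<bar> < h" using that d by (auto simp: h_def)
      have "F (x + h) - F (x - h) \<le> q0 * (2 * h)" using dq(2)[of "x - h" "x + h"] h d by simp
      also have "\<dots> \<le> (\<bar>q0\<bar> + 1) * (2 * h)" using h by (intro mult_right_mono) auto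
      also have "\<dots> < (\<bar>q0\<bar> + 1) * (2 * d)" using h by (intro mult_strict_left_mono) auto
      finally have "F (x + h) - F (x - h) < r" using dr by simp
      moreover have "F (x - h) \<le> F y" "F y \<le> F (x + h)" "F (x - h) \<le> F x" "F x \<le> F (x + h)"
        using h by (auto intro!: monoD[OF F])
      ultimately show ?thesis by linarith
    qed
    then show "\<exists>s>0. \<forall>y. y \<noteq> x \<and> norm (y - x) < s \<longrightarrow> norm (F y - F x) < r"
      using d(1) by auto
  qed
  have "\<exists>d>0. \<forall>y. norm (y - x) < d \<longrightarrow> norm (F y - F x - l * (y - x)) \<le> e * norm (y - x)" if e: "0 < e" for e
  proof -
    obtain d1 where d1: "0 < d1" "\<And>u v. u < x \<Longrightarrow> x < v \<Longrightarrow> v - u < d1 \<Longrightarrow> (l - e) * (v - u) \<le> F v - F u"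
      using lo[OF e] by blast
    obtain d2 where d2: "0 < d2" "\<And>u v. u < x \<Longrightarrow> x < v \<Longrightarrow> v - u < d2 \<Longrightarrow> F v - F u \<le> (l + e) * (v - u)"
      using hi[OF e] by blast
    define d where "d = min d1 d2"
    have d: "0 < d" using d1 d2 by (simp add: d_def)
    have mid: "\<bar>F v - F u - l * (v - u)\<bar> \<le> e * (v - u)" if "u < x" "x < v" "v - u < d" for u v
      using d1(2)[of u v] d2(2)[of u v] that by (auto simp: d_def algebra_simps abs_le_iff)
    have right: "\<bar>F v - F x - l * (v - x)\<bar> \<le> e * (v - x)" if "x < v" "v - x < d" for v
    proof (rule tendsto_le[of "at_left x" "\<lambda>u. e * (v - u)" _ "\<lambda>u. \<bar>F v - F u - l * (v - u)\<bar>"])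
      show "\<forall>\<^sub>F u in at_left x. \<bar>F v - F u - l * (v - u)\<bar> \<le> e * (v - u)"
        unfolding eventually_at_left_field using mid that by (intro exI[of _ "v - d"]) auto
      have "(F \<longlongrightarrow> F x) (at_left x)" using cont by (rule tendsto_mono[rotated]) (simp add: at_le)
      then show "((\<lambda>u. \<bar>F v - F u - l * (v - u)\<bar>) \<longlongrightarrow> \<bar>F v - F x - l * (v - x)\<bar>) (at_left x)"
        by (intro tendsto_intros)
    qed (auto intro!: tendsto_intros)
    have left: "\<bar>F x - F u - l * (x - u)\<bar> \<le> e * (x - u)" if "u < x" "x - u < d" for u
    proof (rule tendsto_le[of "at_right x" "\<lambda>v. e * (v - u)" _ "\<lambda>v. \<bar>F v - F u - l * (v - u)\<bar>"])
      show "\<forall>\<^sub>F v in at_right x. \<bar>F v - F u - l * (v - u)\<bar> \<le> e * (v - u)"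
        unfolding eventually_at_right_field using mid that by (intro exI[of _ "u + d"]) auto
      have "(F \<longlongrightarrow> F x) (at_right x)" using cont by (rule tendsto_mono[rotated]) (simp add: at_le)
      then show "((\<lambda>v. \<bar>F v - F u - l * (v - u)\<bar>) \<longlongrightarrow> \<bar>F x - F u - l * (x - u)\<bar>) (at_right x)"
        by (intro tendsto_intros)
    qed (auto intro!: tendsto_intros)
    have "norm (F y - F x - l * (y - x)) \<le> e * norm (y - x)" if "norm (y - x) < d" for y
    proof (cases y x rule: linorder_cases)
      case less
      have "F y - F x - l * (y - x) = - (F x - F y - l * (x - y))" by (simp add: algebra_simps)
      then have "norm (F y - F x - l * (y - x)) = \<bar>F x - F y - l * (x - y)\<bar>" by (simp only: real_norm_def abs_minus_cancel)
      then show ?thesis using left[of y] less that by simp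
    next
      case greater
      then show ?thesis using right[of y] that by simp
    qed simp
    then show ?thesis using d by blast
  qed
  then have "(F has_derivative (\<lambda>h. l * h)) (at x)"
    unfolding has_derivative_at_alt by (simp add: bounded_linear_mult_right)
  then show ?thesis unfolding differentiable_def by blast
qed

text \<open>Lebesgue's theorem. Where \<open>F\<close> is not differentiable, its slopes over small
  intervals around the point are unbounded, or they fall below some rational p and rise above some
  larger rational q at arbitrarily small scales.\<close>

theorem mono_differentiable_ae:
  fixes F :: "real \<Rightarrow> real"
  assumes F: "mono F"
  shows "negligible {x. \<not> F differentiable (at x)}"
proof -
  define ivl where "ivl = (\<lambda>P d. \<Union>{{u<..<v} |u v. v - u < d \<and> P u v} :: real set)"
  \<comment> \<open>A countable intersection of open sets, hence Borel, whatever \<open>P\<close>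
    is.\<close>
  define dense where "dense = (\<lambda>P. \<Inter>n. ivl P (1 / real (Suc n)))"
  have dense_iff: "x \<in> dense P \<longleftrightarrow> (\<forall>d>0. \<exists>u v. u < x \<and> x < v \<and> v - u < d \<and> P u v)" for x P
  proof
    assume x: "x \<in> dense P"
    show "\<forall>d>0. \<exists>u v. u < x \<and> x < v \<and> v - u < d \<and> P u v"
    proof (intro allI impI)
      fix d :: real assume "0 < d"
      then obtain n where n: "1 / real (Suc n) < d" using nat_approx_posE by (metis inverse_eq_divide)
      have "x \<in> ivl P (1 / real (Suc n))" using x unfolding dense_def by blast
      then obtain u v where "u < x" "x < v" "v - u < 1 / real (Suc n)" "P u v" unfolding ivl_def by auto
      then show "\<exists>u v. u < x \<and> x < v \<and> v - u < d \<and> P u v"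
        using n by (meson less_trans)
    qed
  next
    assume *: "\<forall>d>0. \<exists>u v. u < x \<and> x < v \<and> v - u < d \<and> P u v"
    have "x \<in> ivl P (1 / real (Suc n))" for n
    proof -
      obtain u v where "u < x" "x < v" "v - u < 1 / real (Suc n)" "P u v"
        using *[rule_format, of "1 / real (Suc n)"] by auto
      then show ?thesis unfolding ivl_def by (intro UnionI[of "{u<..<v}"]) auto
    qed
    then show "x \<in> dense P" unfolding dense_def by blast
  qed
  have meas: "dense P \<in> sets lebesgue" for P
  proof -
    have "open (ivl P d)" for d unfolding ivl_def by (intro open_Union) auto
    then have "ivl P d \<in> sets borel" for d by auto
    then have "dense P \<in> sets borel" unfolding dense_def by (intro sets.countable_INT) auto
    then show ?thesis by simp
  qed
  define lo where "lo = (\<lambda>p. dense (\<lambda>u v. F v - F u < p * (v - u)))"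
  define hi where "hi = (\<lambda>q. dense (\<lambda>u v. q * (v - u) < F v - F u))"
  \<comment> \<open>Bounded windows provide the finite measure that the covering arguments
    require.\<close>
  have lm: "S \<inter> {-real n<..<real n} \<in> lmeasurable" if "S \<in> sets lebesgue" for S n
    using fmeasurable_Int_fmeasurable[of "{-real n<..<real n}" lebesgue S] that by (simp add: Int_commute)
  have E: "negligible (lo p \<inter> hi q)" if pq: "0 < p" "p < q" for p q
  proof -
    have "negligible (lo p \<inter> hi q \<inter> {-real n<..<real n})" for n
    proof (rule negligible_two_slopes[OF F lm pq])
      show "lo p \<inter> hi q \<in> sets lebesgue" unfolding lo_def hi_def by (intro sets.Int meas)
    qed (simp_all add: lo_def hi_def dense_iff)
    then have "negligible (\<Union>n. lo p \<inter> hi q \<inter> {-real n<..<real n})" by (rule negligible_Union_nat)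
    moreover have "lo p \<inter> hi q \<subseteq> (\<Union>n. lo p \<inter> hi q \<inter> {-real n<..<real n})"
    proof
      fix x assume "x \<in> lo p \<inter> hi q"
      moreover obtain n where "\<bar>x\<bar> < real n" using reals_Archimedean2 by blast
      ultimately show "x \<in> (\<Union>n. lo p \<inter> hi q \<inter> {-real n<..<real n})" by (intro UN_I[of n]) auto
    qed
    ultimately show ?thesis by (rule negligible_subset)
  qed
  define inf where "inf = (\<Inter>m. hi (real (Suc m)))"
  have I: "negligible inf"
  proof -
    have inf_iff: "\<exists>u v. u < x \<and> x < v \<and> v - u < d \<and> q * (v - u) < F v - F u" if x: "x \<in> inf" and d: "0 < d" for x d q
    proof -
      obtain m where m: "q \<le> real (Suc m)" by (metis nat_le_real_less less_imp_le reals_Archimedean2 of_nat_Suc add.commute less_add_one order_less_trans)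
      have "x \<in> hi (real (Suc m))" using x unfolding inf_def by blast
      then obtain u v where uv: "u < x" "x < v" "v - u < d" "real (Suc m) * (v - u) < F v - F u"
        using d unfolding hi_def dense_iff by blast
      have "q * (v - u) \<le> real (Suc m) * (v - u)" using m uv by (intro mult_right_mono) auto
      then have "q * (v - u) < F v - F u" using uv by linarith
      then show ?thesis using uv by blast
    qed
    have "negligible (inf \<inter> {-real n<..<real n})" for n
    proof (rule negligible_infinite_slope[OF F lm])
      show "inf \<in> sets lebesgue" unfolding inf_def hi_def by (intro sets.countable_INT) (auto intro: meas)
      show "inf \<inter> {-real n<..<real n} \<subseteq> {-real n<..<real n}" by blast
    qed (use inf_iff in blast)
    then have "negligible (\<Union>n. inf \<inter> {-real n<..<real n})" by (rule negligible_Union_nat)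
    moreover have "inf \<subseteq> (\<Union>n. inf \<inter> {-real n<..<real n})"
    proof
      fix x assume "x \<in> inf"
      moreover obtain n where "\<bar>x\<bar> < real n" using reals_Archimedean2 by blast
      ultimately show "x \<in> (\<Union>n. inf \<inter> {-real n<..<real n})" by (intro UN_I[of n]) auto
    qed
    ultimately show ?thesis by (rule negligible_subset)
  qed
  define Q where "Q = {(p,q). p \<in> \<rat> \<and> q \<in> \<rat> \<and> 0 < p \<and> p < (q::real)}"
  have "countable Q"
    by (rule countable_subset[of _ "\<rat> \<times> \<rat>"]) (auto simp: Q_def countable_rat)
  then have "negligible (\<Union>((\<lambda>(p,q). lo p \<inter> hi q) ` Q))"
    using E by (intro negligible_countable_Union) (auto simp: Q_def)
  then have neg: "negligible (inf \<union> \<Union>((\<lambda>(p,q). lo p \<inter> hi q) ` Q))" using I negligible_Un by blast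
  show ?thesis
  proof (rule negligible_subset[OF neg], rule subsetI, rule ccontr)
    fix x assume x: "x \<in> {x. \<not> F differentiable (at x)}" and nx: "x \<notin> inf \<union> \<Union>((\<lambda>(p,q). lo p \<inter> hi q) ` Q)"
    have "F differentiable (at x)"
    proof (rule mono_differentiable_at_of_slopes[OF F])
      obtain m where "x \<notin> hi (real (Suc m))" using nx by (auto simp: inf_def)
      then show "\<exists>d>0. \<exists>q. \<forall>u v. u < x \<and> x < v \<and> v - u < d \<longrightarrow> F v - F u \<le> q * (v - u)"
        unfolding hi_def dense_iff not_less[symmetric] by metis
      fix p q :: real assume pq: "0 < p" "p < q" "p \<in> \<rat>" "q \<in> \<rat>"
      then have "x \<notin> lo p \<or> x \<notin> hi q" using nx by (auto simp: Q_def)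
      then show "(\<exists>d>0. \<forall>u v. u < x \<and> x < v \<and> v - u < d \<longrightarrow> p * (v - u) \<le> F v - F u) \<or>
        (\<exists>d>0. \<forall>u v. u < x \<and> x < v \<and> v - u < d \<longrightarrow> F v - F u \<le> q * (v - u))"
        unfolding lo_def hi_def dense_iff not_less[symmetric] by metis
    qed
    then show False using x by simp
  qed
qed

section \<open>Bounded variation and differentiability of absolutely continuous curves\<close>

definition variation_bounded :: "real \<Rightarrow> real \<Rightarrow> (real \<Rightarrow> 'a::real_normed_vector) \<Rightarrow> real \<Rightarrow> bool" where
  "variation_bounded a b F B \<longleftrightarrow> (\<forall>D. D division_of \<Union>D \<longrightarrow> \<Union>D \<subseteq> {a..b} \<longrightarrow> (\<Sum>k\<in>D. norm (F (Sup k) - F (Inf k))) \<le> B)"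

lemma real_division_cell:
  fixes D :: "real set set"
  assumes "D division_of \<Union>D" "k \<in> D"
  obtains u v where "k = {u..v}" "u \<le> v" "Inf k = u" "Sup k = v"
proof -
  have ne: "k \<noteq> {}" using division_ofD(3)[OF assms] .
  obtain u v where k: "k = {u..v}" using division_ofD(4)[OF assms] by (metis box_real(2))
  then have "u \<le> v" using ne by simp
  then show ?thesis using that[OF k] k by simp
qed

text \<open>Cutting all cells down to {c..d} gives a division again. Two cells can be cut to the
  same piece only if it is a single point, whose increment is 0.\<close>

lemma sum_division_Int_interval:
  fixes F :: "real \<Rightarrow> 'a::real_normed_vector"
  assumes D: "D division_of \<Union>D" and B: "variation_bounded c d F B"
  shows "(\<Sum>k\<in>D. if k \<inter> {c..d} = {} then 0 else norm (F (Sup (k \<inter> {c..d})) - F (Inf (k \<inter> {c..d})))) \<le> B"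
proof -
  define n where "n = (\<lambda>k. norm (F (Sup k) - F (Inf k)))"
  define D1 where "D1 = {k \<in> D. k \<inter> {c..d} \<noteq> {}}"
  define E where "E = (\<lambda>k. k \<inter> {c..d}) ` D1"
  have fin: "finite D" using D by blast
  have ivl: "\<exists>u v. k \<inter> {c..d} = {u..v} \<and> u \<le> v" if k: "k \<in> D1" for k
  proof -
    have kD: "k \<in> D" using k by (simp add: D1_def)
    obtain u v where uv: "k = {u..v}" "u \<le> v" by (rule real_division_cell[OF D kD])
    have "k \<inter> {c..d} = {max u c..min v d}" "k \<inter> {c..d} \<noteq> {}" using uv k by (auto simp: D1_def)
    then show ?thesis by (metis atLeastatMost_empty_iff not_le)
  qed
  have int: "interior (k \<inter> {c..d}) \<inter> interior (k' \<inter> {c..d}) = {}" if "k \<in> D" "k' \<in> D" "k \<noteq> k'" for k k'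
    using division_ofD(5)[OF D that] interior_mono[of "k \<inter> {c..d}" k] interior_mono[of "k' \<inter> {c..d}" k'] by blast
  have div: "E division_of \<Union>E"
    unfolding division_of_def
  proof (intro conjI ballI impI)
    show "finite E" using fin by (simp add: E_def D1_def)
    fix K assume K: "K \<in> E"
    then show "K \<subseteq> \<Union>E" by blast
    obtain k where k: "k \<in> D1" "K = k \<inter> {c..d}" using K by (auto simp: E_def)
    show "K \<noteq> {}" using k by (simp add: D1_def)
    show "\<exists>a b. K = cbox a b" using ivl[OF k(1)] k(2) by (auto simp: box_real)
    fix K' assume K': "K' \<in> E" "K \<noteq> K'"
    then obtain k' where k': "k' \<in> D1" "K' = k' \<inter> {c..d}" by (auto simp: E_def)
    show "interior K \<inter> interior K' = {}"
      using int[of k k'] k k' K' by (auto simp: D1_def)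
  qed simp
  have "(\<Sum>k\<in>D. if k \<inter> {c..d} = {} then 0 else n (k \<inter> {c..d})) = (\<Sum>k\<in>D1. n (k \<inter> {c..d}))"
    unfolding D1_def using fin by (simp add: sum.If_cases Collect_neg_eq[symmetric] Int_def)
  also have "\<dots> = sum n E"
    unfolding E_def
  proof (rule sum.reindex_nontrivial[symmetric, unfolded o_def])
    show "finite D1" using fin by (simp add: D1_def)
    fix k k' assume kk: "k \<in> D1" "k' \<in> D1" "k \<noteq> k'" "k \<inter> {c..d} = k' \<inter> {c..d}"
    obtain u v where uv: "k \<inter> {c..d} = {u..v}" "u \<le> v" using ivl[OF kk(1)] by blast
    have "interior {u..v} = {}" using int[of k k'] kk uv by (simp add: D1_def)
    then have "u = v" using uv(2) by (simp add: interior_atLeastAtMost_real)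
    then show "n (k \<inter> {c..d}) = 0" unfolding uv(1) n_def by simp
  qed
  also have "\<dots> \<le> B"
  proof -
    have "\<Union>E \<subseteq> {c..d}" by (auto simp: E_def)
    then show ?thesis using B div unfolding variation_bounded_def n_def by blast
  qed
  finally show ?thesis unfolding n_def .
qed

text \<open>A cell across \<open>c\<close> is cut there; by the triangle inequality its two parts
  contribute at least as much.\<close>

lemma variation_bounded_join:
  fixes F :: "real \<Rightarrow> 'a::real_normed_vector"
  assumes B1: "variation_bounded a c F B1" and B2: "variation_bounded c b F B2"
  shows "variation_bounded a b F (B1 + B2)"
  unfolding variation_bounded_def
proof (intro allI impI)
  fix D assume D: "D division_of \<Union>D" and sub: "\<Union>D \<subseteq> {a..b}"
  define n where "n = (\<lambda>c d k. if k \<inter> {c..d} = {} then 0 else norm (F (Sup (k \<inter> {c..d})) - F (Inf (k \<inter> {c..d}))))"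
  have "norm (F (Sup k) - F (Inf k)) \<le> n a c k + n c b k" if k: "k \<in> D" for k
  proof -
    obtain u v where uv: "k = {u..v}" "u \<le> v" "Inf k = u" "Sup k = v" by (rule real_division_cell[OF D k])
    have "{u..v} \<subseteq> {a..b}" using sub k uv(1) by blast
    then have ab: "a \<le> u" "v \<le> b" using uv(2) by auto
    have n0: "0 \<le> n c' d' k" for c' d' by (simp add: n_def)
    show ?thesis
    proof (cases "v \<le> c \<or> c \<le> u")
      case True
      then show ?thesis
      proof
        assume "v \<le> c"
        then have "k \<inter> {a..c} = {u..v}" using uv ab by auto
        then have "n a c k = norm (F v - F u)" using uv by (simp add: n_def)
        then show ?thesis using n0[of c b] uv by simp
      next
        assume "c \<le> u"
        then have "k \<inter> {c..b} = {u..v}" using uv ab by auto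
        then have "n c b k = norm (F v - F u)" using uv by (simp add: n_def)
        then show ?thesis using n0[of a c] uv by simp
      qed
    next
      case False
      then have "k \<inter> {a..c} = {u..c}" "k \<inter> {c..b} = {c..v}" using uv ab by auto
      then have "n a c k = norm (F c - F u)" "n c b k = norm (F v - F c)" using False by (auto simp: n_def)
      then show ?thesis using uv norm_triangle_ineq[of "F v - F c" "F c - F u"] by simp
    qed
  qed
  then have "(\<Sum>k\<in>D. norm (F (Sup k) - F (Inf k))) \<le> (\<Sum>k\<in>D. n a c k) + (\<Sum>k\<in>D. n c b k)"
    unfolding sum.distrib[symmetric] by (rule sum_mono)
  also have "\<dots> \<le> B1 + B2"
    unfolding n_def using sum_division_Int_interval[OF D B1] sum_division_Int_interval[OF D B2] by (rule add_mono)
  finally show "(\<Sum>k\<in>D. norm (F (Sup k) - F (Inf k))) \<le> B1 + B2" .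
qed

text \<open>On intervals shorter than the \<delta> that belongs to the error 1 the variation is at
  most 1, and finitely many of them make up {a..b}.\<close>

lemma abs_cont_on_variation_bounded:
  fixes F :: "real \<Rightarrow> 'a::real_normed_vector"
  assumes ac: "abs_cont_on {a..b} F" and ab: "a \<le> b"
  obtains B where "variation_bounded a b F B"
proof -
  obtain \<delta> where \<delta>: "\<delta> > 0" "\<And>D. D division_of \<Union>D \<Longrightarrow> \<Union>D \<subseteq> {a..b} \<Longrightarrow> (\<Sum>k\<in>D. Sup k - Inf k) < \<delta> \<Longrightarrow>
      (\<Sum>k\<in>D. norm (F (Sup k) - F (Inf k))) < 1"
    using abs_cont_onD[OF ac order_refl zero_less_one] by auto
  \<comment> \<open>Half of \<delta>, because absolute continuity asks for a total length strictly
    below \<delta>.\<close>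
  define h where "h = \<delta> / 2"
  have h: "0 < h" "h < \<delta>" using \<delta> by (auto simp: h_def)
  have small: "variation_bounded c d F 1" if cd: "a \<le> c" "c \<le> d" "d \<le> b" "d - c \<le> h" for c d
    unfolding variation_bounded_def
  proof (intro allI impI)
    fix D assume D: "D division_of \<Union>D" "\<Union>D \<subseteq> {c..d}"
    have "(\<Sum>k\<in>D. Sup k - Inf k) \<le> measure lebesgue {c..d}"
      by (rule sum_length_le_measure[OF D]) simp
    then have "(\<Sum>k\<in>D. Sup k - Inf k) < \<delta>" using cd h by simp
    moreover have "{c..d} \<subseteq> {a..b}" using cd by simp
    then have "\<Union>D \<subseteq> {a..b}" using D(2) by blast
    ultimately show "(\<Sum>k\<in>D. norm (F (Sup k) - F (Inf k))) \<le> 1"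
      using \<delta>(2)[OF D(1)] by (intro less_imp_le) blast
  qed
  have "variation_bounded a (min b (a + real (Suc n) * h)) F (real (Suc n))" for n
  proof (induction n)
    case 0
    show ?case using small[of a "min b (a + h)"] h ab by simp
  next
    case (Suc n)
    have "variation_bounded (min b (a + real (Suc n) * h)) (min b (a + real (Suc (Suc n)) * h)) F 1"
      using h ab by (intro small) (auto simp: min_def algebra_simps intro: add_nonneg_nonneg)
    from variation_bounded_join[OF Suc this] show ?case by (simp add: add.commute)
  qed
  moreover obtain n where "(b - a) / h \<le> real (Suc n)" by (meson le_SucI of_nat_le_iff order_trans real_arch_simple)
  then have "min b (a + real (Suc n) * h) = b" using h by (simp add: min_def divide_le_eq)
  ultimately show ?thesis using that by metis
qed

text \<open>Jordan decomposition: with \<open>V\<close> the variation from \<open>a\<close>, both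
  \<open>V\<close> and \<open>V + F\<close> are increasing, and \<open>F\<close> is their
  difference.\<close>

lemma abs_cont_on_real_differentiable_ae:
  fixes F :: "real \<Rightarrow> real"
  assumes ac: "abs_cont_on {a..b} F" and ab: "a \<le> b"
  obtains N where "negligible N" "\<And>t. t \<in> {a<..<b} - N \<Longrightarrow> F differentiable (at t)"
proof -
  obtain B where B: "variation_bounded a b F B" by (rule abs_cont_on_variation_bounded[OF ac ab])
  define vsums where "vsums = (\<lambda>x. {(\<Sum>k\<in>D. norm (F (Sup k) - F (Inf k))) |D. D division_of \<Union>D \<and> \<Union>D \<subseteq> {a..x}})"
  define V where "V = (\<lambda>x. Sup (vsums x))"
  have ne: "vsums x \<noteq> {}" for x unfolding vsums_def by (auto intro!: exI[of _ "{}"])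
  have bd: "bdd_above (vsums x)" if "x \<le> b" for x
  proof (rule bdd_aboveI)
    fix s assume "s \<in> vsums x"
    then obtain D where "D division_of \<Union>D" "\<Union>D \<subseteq> {a..x}" "s = (\<Sum>k\<in>D. norm (F (Sup k) - F (Inf k)))"
      by (auto simp: vsums_def)
    moreover from this have "\<Union>D \<subseteq> {a..b}" using that by fastforce
    ultimately show "s \<le> B" using B unfolding variation_bounded_def by auto
  qed
  \<comment> \<open>A division of {a..x} is extended by the single cell {x..y}.\<close>
  have key: "V x + norm (F y - F x) \<le> V y" if xy: "a \<le> x" "x < y" "y \<le> b" for x y
  proof -
    have "s \<le> V y - norm (F y - F x)" if s: "s \<in> vsums x" for s
    proof -
      obtain D where D: "D division_of \<Union>D" "\<Union>D \<subseteq> {a..x}" "s = (\<Sum>k\<in>D. norm (F (Sup k) - F (Inf k)))"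
        using s by (auto simp: vsums_def)
      have fin: "finite D" using D by blast
      have nin: "{x..y} \<notin> D" using D(2) xy by (meson Sup_upper atLeastAtMost_iff less_le_not_le order_refl subset_iff less_imp_le)
      have dj: "interior k \<inter> interior {x..y} = {}" if "k \<in> D" for k
      proof -
        have "k \<subseteq> {a..x}" using D(2) that by blast
        then have "interior k \<subseteq> {a<..<x}" using interior_mono interior_atLeastAtMost_real by metis
        then show ?thesis using interior_subset[of "{x..y}"] by fastforce
      qed
      have "insert {x..y} D division_of \<Union>(insert {x..y} D)"
        unfolding division_of_def
      proof (intro conjI ballI impI)
        fix K assume K: "K \<in> insert {x..y} D"
        show "K \<noteq> {}" using K xy division_ofD(3)[OF D(1)] by auto
        show "\<exists>a b. K = cbox a b" using K division_ofD(4)[OF D(1)] by (metis box_real(2) insert_iff)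
        fix K' assume "K' \<in> insert {x..y} D" "K \<noteq> K'"
        then show "interior K \<inter> interior K' = {}"
          using K dj division_ofD(5)[OF D(1)] by (metis Int_commute insert_iff)
      qed (use fin in auto)
      moreover have "\<Union>(insert {x..y} D) \<subseteq> {a..y}" using D(2) xy by fastforce
      ultimately have "(\<Sum>k\<in>insert {x..y} D. norm (F (Sup k) - F (Inf k))) \<in> vsums y"
        unfolding vsums_def by blast
      then have "(\<Sum>k\<in>insert {x..y} D. norm (F (Sup k) - F (Inf k))) \<le> V y"
        unfolding V_def using bd[OF xy(3)] by (rule cSup_upper)
      then show ?thesis using nin fin D(3) xy by simp
    qed
    then have "V x \<le> V y - norm (F y - F x)" unfolding V_def by (rule cSup_least[OF ne])
    then show ?thesis by simp
  qed
  \<comment> \<open>Clamping to {a..b} gives functions that are monotone on the whole line, as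
    Lebesgue's theorem above expects.\<close>
  define cl where "cl = (\<lambda>x. max a (min x b))"
  have cl: "a \<le> cl x" "cl x \<le> b" "x \<le> y \<Longrightarrow> cl x \<le> cl y" for x y using ab by (auto simp: cl_def)
  have V1: "mono (\<lambda>x. V (cl x))"
  proof (rule monoI)
    fix x y :: real assume "x \<le> y"
    then have "cl x = cl y \<or> cl x < cl y" using cl(3) by fastforce
    then show "V (cl x) \<le> V (cl y)" using key[of "cl x" "cl y"] cl by (auto intro: order_trans[OF le_add_same_cancel1[THEN iffD2, OF norm_ge_zero]])
  qed
  have V2: "mono (\<lambda>x. V (cl x) + F (cl x))"
  proof (rule monoI)
    fix x y :: real assume "x \<le> y"
    then have "cl x = cl y \<or> cl x < cl y" using cl(3) by fastforce
    then show "V (cl x) + F (cl x) \<le> V (cl y) + F (cl y)" using key[of "cl x" "cl y"] cl by (auto simp: abs_le_iff)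
  qed
  define N where "N = {x. \<not> (\<lambda>x. V (cl x)) differentiable (at x)} \<union> {x. \<not> (\<lambda>x. V (cl x) + F (cl x)) differentiable (at x)}"
  show ?thesis
  proof (rule that[of N])
    show "negligible N" unfolding N_def using mono_differentiable_ae[OF V1] mono_differentiable_ae[OF V2] by (rule negligible_Un)
    fix t assume t: "t \<in> {a<..<b} - N"
    then have "(\<lambda>x. (V (cl x) + F (cl x)) - V (cl x)) differentiable (at t)"
      unfolding N_def by (intro differentiable_diff) auto
    then have "(\<lambda>x. F (cl x)) differentiable (at t)" by simp
    then obtain D where "((\<lambda>x. F (cl x)) has_derivative D) (at t)" by (auto simp: differentiable_def)
    then have "(F has_derivative D) (at t)"
      by (rule has_derivative_transform_within_open[of _ _ _ _ "{a<..<b}"]) (use t in \<open>auto simp: cl_def\<close>)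
    then show "F differentiable (at t)" by (auto simp: differentiable_def)
  qed
qed

lemma abs_cont_on_bounded_linear:
  assumes ac: "abs_cont_on J F" and l: "bounded_linear l"
  shows "abs_cont_on J (\<lambda>t. l (F t))"
  unfolding abs_cont_on_def
proof (intro allI impI)
  fix a b and e :: real assume ab: "{a..b} \<subseteq> J" and e: "0 < e"
  obtain K where K: "0 < K" "\<And>x. norm (l x) \<le> norm x * K" using bounded_linear.pos_bounded[OF l] by blast
  have eK: "0 < e / K" using e K by simp
  obtain \<delta> where \<delta>: "\<delta> > 0" "\<And>D. D division_of \<Union>D \<Longrightarrow> \<Union>D \<subseteq> {a..b} \<Longrightarrow> (\<Sum>k\<in>D. Sup k - Inf k) < \<delta> \<Longrightarrow>
      (\<Sum>k\<in>D. norm (F (Sup k) - F (Inf k))) < e / K"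
    using abs_cont_onD[OF ac ab eK] by auto
  have "(\<Sum>k\<in>D. norm (l (F (Sup k)) - l (F (Inf k)))) < e"
    if D: "D division_of \<Union>D \<and> \<Union>D \<subseteq> {a..b} \<and> (\<Sum>k\<in>D. Sup k - Inf k) < \<delta>" for D
  proof -
    have "(\<Sum>k\<in>D. norm (l (F (Sup k)) - l (F (Inf k)))) \<le> (\<Sum>k\<in>D. norm (F (Sup k) - F (Inf k)) * K)"
      using K(2) by (intro sum_mono) (simp add: linear_diff[OF bounded_linear.linear[OF l], symmetric])
    also have "\<dots> = (\<Sum>k\<in>D. norm (F (Sup k) - F (Inf k))) * K" by (simp add: sum_distrib_right)
    also have "\<dots> < e / K * K" using \<delta>(2) D K(1) by (intro mult_strict_right_mono) auto
    finally show ?thesis using K(1) by simp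
  qed
  then show "\<exists>\<delta>>0. \<forall>d. d division_of \<Union>d \<and> \<Union>d \<subseteq> {a..b} \<and> (\<Sum>k\<in>d. Sup k - Inf k) < \<delta> \<longrightarrow>
      (\<Sum>k\<in>d. norm (l (F (Sup k)) - l (F (Inf k)))) < e" using \<delta>(1) by blast
qed

theorem abs_cont_on_differentiable_ae:
  fixes F :: "real \<Rightarrow> 'a::euclidean_space"
  assumes ac: "abs_cont_on {a..b} F" and ab: "a \<le> b"
  shows "\<exists>N. negligible N \<and> (\<forall>t\<in>{a<..<b} - N. F differentiable (at t))"
proof -
  have "\<exists>N. negligible N \<and> (\<forall>t\<in>{a<..<b} - N. (\<lambda>t. F t \<bullet> i) differentiable (at t))" for i
    using abs_cont_on_real_differentiable_ae[OF abs_cont_on_bounded_linear[OF ac bounded_linear_inner_left[of i]] ab] by metis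
  then obtain N where N: "\<And>i. negligible (N i)" "\<And>i t. t \<in> {a<..<b} - N i \<Longrightarrow> (\<lambda>t. F t \<bullet> i) differentiable (at t)"
    by metis
  show ?thesis
  proof (intro exI[of _ "\<Union>(N ` Basis)"] conjI ballI)
    show "negligible (\<Union>(N ` Basis))" using N(1) by (intro negligible_Union) auto
    fix t assume t: "t \<in> {a<..<b} - \<Union>(N ` Basis)"
    have "(\<lambda>t. \<Sum>i\<in>Basis. (F t \<bullet> i) *\<^sub>R i) differentiable (at t)"
      using t N(2) by (intro differentiable_sum finite_Basis ballI differentiable_scaleR differentiable_const) auto
    then show "F differentiable (at t)" by (simp add: euclidean_representation)
  qed
qed

text \<open>The integral of \<open>F'\<close> over a cell is the increment of \<open>F\<close>, so
  the sums that decide absolute integrability are the variation sums of \<open>F\<close>.\<close>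

theorem abs_cont_on_absolutely_integrable:
  fixes F :: "real \<Rightarrow> 'a::euclidean_space"
  assumes ac: "abs_cont_on {a..b} F" and ab: "a \<le> b" and N: "negligible N"
    and der: "\<And>t. t \<in> {a..b} - N \<Longrightarrow> (F has_vector_derivative F' t) (at t within {a..b})"
  shows "F' absolutely_integrable_on {a..b}"
proof -
  obtain B where B: "variation_bounded a b F B" by (rule abs_cont_on_variation_bounded[OF ac ab])
  have hi: "(F' has_integral (F d - F c)) {c..d}" if "a \<le> c" "c \<le> d" "d \<le> b" for c d
  proof (rule abs_cont_on_has_integral[OF that(2) abs_cont_on_subset[OF ac] N])
    show "{c..d} \<subseteq> {a..b}" using that by auto
    fix t assume "t \<in> {c..d} - N"
    then have "t \<in> {a..b} - N" using that by auto
    from der[OF this] show "(F has_vector_derivative F' t) (at t within {c..d})"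
      by (rule has_vector_derivative_within_subset) (use that in auto)
  qed
  have "F' absolutely_integrable_on cbox a b"
  proof (rule bounded_variation_absolutely_integrable_interval)
    show "F' integrable_on cbox a b" using hi[of a b] ab by (auto simp: box_real integrable_on_def)
    fix d assume d: "d division_of cbox a b"
    then have d': "d division_of \<Union>d" "\<Union>d = {a..b}" by (auto simp: box_real)
    have "(\<Sum>K\<in>d. norm (integral K F')) = (\<Sum>k\<in>d. norm (F (Sup k) - F (Inf k)))"
    proof (rule sum.cong)
      fix K assume K: "K \<in> d"
      obtain u v where uv: "K = {u..v}" "u \<le> v" "Inf K = u" "Sup K = v" by (rule real_division_cell[OF d'(1) K])
      have "K \<subseteq> {a..b}" using K d'(2) by blast
      then have "integral K F' = F v - F u" using hi[of u v] uv by (auto intro!: integral_unique)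
      then show "norm (integral K F') = norm (F (Sup K) - F (Inf K))" using uv by simp
    qed simp
    also have "\<dots> \<le> B" using B d' unfolding variation_bounded_def by simp
    finally show "(\<Sum>K\<in>d. norm (integral K F')) \<le> B" .
  qed
  then show ?thesis by (simp add: box_real)
qed

lemma AE_lebesgue_on_negligible:
  assumes S: "S \<in> sets lebesgue"
  shows "(AE x in lebesgue_on S. P x) \<longleftrightarrow> negligible {x \<in> S. \<not> P x}"
proof -
  have "(AE x in lebesgue_on S. P x) \<longleftrightarrow> (AE x in lebesgue. x \<in> S \<longrightarrow> P x)"
    using S by (simp add: AE_restrict_space_iff)
  also have "\<dots> \<longleftrightarrow> (\<exists>N\<in>null_sets lebesgue. {x \<in> S. \<not> P x} \<subseteq> N)"
    by (auto simp: eventually_ae_filter)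
  also have "\<dots> \<longleftrightarrow> negligible {x \<in> S. \<not> P x}"
    unfolding negligible_iff_null_sets[symmetric] Bex_def mem_Collect_eq
    using negligible_iff_null_sets negligible_subset by blast
  finally show ?thesis .
qed

section \<open>Curves on the half-line\<close>

lemma curve_deriv_ae:
  fixes g :: "real \<Rightarrow> 'a::euclidean_space"
  assumes ac: "abs_cont_on {0..} g"
  shows "\<exists>N. negligible N \<and>
    (\<forall>t. 0 \<le> t \<longrightarrow> t \<notin> N \<longrightarrow> (g has_vector_derivative curve_deriv g t) (at t within {0..}))"
proof -
  have "\<exists>N. negligible N \<and> (\<forall>t\<in>{0<..<real n} - N. g differentiable (at t))" for n
  proof -
    have "abs_cont_on {0..real n} g" by (rule abs_cont_on_subset[OF ac]) auto
    from abs_cont_on_differentiable_ae[OF this of_nat_0_le_iff] show ?thesis .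
  qed
  then obtain N where N: "\<And>n. negligible (N n)" "\<And>n t. t \<in> {0<..<real n} - N n \<Longrightarrow> g differentiable (at t)"
    by metis
  show ?thesis
  proof (intro exI[of _ "insert 0 (\<Union>n. N n)"] conjI allI impI)
    \<comment> \<open>0 joins the exceptional set: at every other point of the half-line the filter
      within {0..} is the two-sided one.\<close>
    show "negligible (insert 0 (\<Union>n. N n))" using N(1) by (simp add: negligible_Union_nat)
    fix t :: real assume t: "0 \<le> t" "t \<notin> insert 0 (\<Union>n. N n)"
    obtain n where "t < real n" using reals_Archimedean2 by blast
    then have d: "g differentiable (at t)" using N(2)[of t n] t by auto
    have "at t within {0..} = at t" using t by (intro at_within_interior) (auto simp: interior_real_atLeast)
    then show "(g has_vector_derivative curve_deriv g t) (at t within {0..})"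
      using d unfolding curve_deriv_def by (simp add: vector_derivative_works)
  qed
qed

lemma curve_deriv_has_integral:
  fixes g :: "real \<Rightarrow> 'a::euclidean_space"
  assumes ac: "abs_cont_on {0..} g" and ab: "0 \<le> a" "a \<le> b"
  shows "(curve_deriv g has_integral (g b - g a)) {a..b}"
    and "curve_deriv g absolutely_integrable_on {a..b}"
proof -
  obtain N where N: "negligible N"
    "\<And>t. 0 \<le> t \<Longrightarrow> t \<notin> N \<Longrightarrow> (g has_vector_derivative curve_deriv g t) (at t within {0..})"
    using curve_deriv_ae[OF ac] by blast
  have ac': "abs_cont_on {a..b} g" using ab by (intro abs_cont_on_subset[OF ac]) auto
  have der: "(g has_vector_derivative curve_deriv g t) (at t within {a..b})" if "t \<in> {a..b} - N" for t
  proof -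
    have "0 \<le> t" "t \<notin> N" using that ab by auto
    from N(2)[OF this] show ?thesis by (rule has_vector_derivative_within_subset) (use ab in auto)
  qed
  show "(curve_deriv g has_integral (g b - g a)) {a..b}"
    by (rule abs_cont_on_has_integral[OF ab(2) ac' N(1) der])
  show "curve_deriv g absolutely_integrable_on {a..b}"
    by (rule abs_cont_on_absolutely_integrable[OF ac' ab(2) N(1) der])
qed

lemma curve_length_eq_integral:
  fixes g :: "real \<Rightarrow> 'a::euclidean_space"
  assumes ac: "abs_cont_on {0..} g" and t: "0 \<le> t"
  shows "curve_length g t = integral {0..t} (\<lambda>s. norm (curve_deriv g s))"
proof -
  have "(\<lambda>s. norm (curve_deriv g s)) absolutely_integrable_on {0..t}"
    using curve_deriv_has_integral(2)[OF ac order_refl t] by (rule absolutely_integrable_norm[unfolded o_def])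
  then show ?thesis unfolding curve_length_def by (rule set_lebesgue_integral_eq_integral(2))
qed

text \<open>The properties of the curves of a generalized control that are used below; they visibly pass to equivalent curves.\<close>

definition control_curve :: "real \<Rightarrow> (real \<Rightarrow> real \<times> (real^'k)) \<Rightarrow> bool" where
  "control_curve T g \<longleftrightarrow> abs_cont_on {0..} g \<and> g 0 = 0 \<and> mono_on {0..} (\<lambda>t. fst (g t)) \<and> (\<exists>t\<ge>0. T < fst (g t))"

lemma control_curve_continuous: "control_curve T g \<Longrightarrow> continuous_on {0..} g"
  unfolding control_curve_def by (intro abs_cont_on_continuous_on) (auto simp: is_interval_ci)

text \<open>Monotonicity comes from integrating the derivative. \<open>Lim\<close> is a choice
  operator, so V(\<infinity>) > T can be exploited only once the supremum of the increasing function
  is shown to be its limit.\<close>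

lemma gen_curves_control_curve:
  assumes g: "g \<in> gen_curves T"
  shows "control_curve T g"
proof -
  have ac: "abs_cont_on {0..} g" and g0: "g 0 = 0" and nn: "AE t in lebesgue_on {0..}. 0 \<le> fst (curve_deriv g t)"
    and lim: "ereal T < Lim at_top (\<lambda>t. ereal (fst (g t)))"
    using g by (auto simp: gen_curves_def)
  define N where "N = {t \<in> {0..}. \<not> 0 \<le> fst (curve_deriv g t)}"
  have N: "negligible N" using nn unfolding N_def by (subst (asm) AE_lebesgue_on_negligible) auto
  have mono: "mono_on {0..} (\<lambda>t. fst (g t))"
  proof (rule mono_onI)
    fix a b :: real assume ab: "a \<in> {0..}" "b \<in> {0..}" "a \<le> b"
    have "((\<lambda>t. fst (curve_deriv g t)) has_integral fst (g b - g a)) {a..b}"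
      using has_integral_linear[OF curve_deriv_has_integral(1)[OF ac, of a b] bounded_linear_fst] ab by (simp add: o_def)
    then have "((\<lambda>t. if t \<in> N then 0 else fst (curve_deriv g t)) has_integral fst (g b - g a)) {a..b}"
      by (rule has_integral_spike[OF N, rotated]) auto
    then have "0 \<le> fst (g b - g a)"
      by (rule has_integral_nonneg) (use ab in \<open>auto simp: N_def\<close>)
    then show "fst (g a) \<le> fst (g b)" by simp
  qed
  have "\<exists>t\<ge>0. T < fst (g t)"
  proof (rule ccontr)
    assume "\<not> (\<exists>t\<ge>0. T < fst (g t))"
    then have le: "fst (g t) \<le> T" if "0 \<le> t" for t using that by force
    define S where "S = (SUP t\<in>{0..}. ereal (fst (g t)))"
    have ST: "S \<le> ereal T" unfolding S_def using le by (auto intro!: SUP_least)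
    have "((\<lambda>t. ereal (fst (g t))) \<longlongrightarrow> S) at_top"
    proof (rule order_tendstoI)
      fix a assume "a < S"
      then obtain t where t: "0 \<le> t" "a < ereal (fst (g t))" unfolding S_def less_SUP_iff by auto
      show "\<forall>\<^sub>F s in at_top. a < ereal (fst (g s))"
        using eventually_ge_at_top[of t]
      proof eventually_elim
        case (elim s)
        then have "fst (g t) \<le> fst (g s)" using t by (intro mono_onD[OF mono]) auto
        then show ?case using t(2) by (meson ereal_less_eq(3) less_le_trans)
      qed
    next
      fix a assume a: "S < a"
      show "\<forall>\<^sub>F s in at_top. ereal (fst (g s)) < a"
        using eventually_ge_at_top[of 0]
      proof eventually_elim
        case (elim s)
        then have "ereal (fst (g s)) \<le> S" unfolding S_def by (intro SUP_upper) auto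
        then show ?case using a by simp
      qed
    qed
    then have "Lim at_top (\<lambda>t. ereal (fst (g t))) = S" by (intro tendsto_Lim) auto
    then show False using lim ST by simp
  qed
  then show ?thesis unfolding control_curve_def using ac g0 mono by blast
qed

text \<open>The set where \<open>V\<close> is at most \<open>T\<close> is closed and bounded, so its
  supremum belongs to it; beyond it \<open>V\<close> exceeds \<open>T\<close>, and the limit from
  the right gives equality at the end time.\<close>

lemma end_time_props:
  assumes g: "control_curve T g" and T: "0 < T"
  shows "0 < end_time T g" "fst (g (end_time T g)) = T"
    "\<And>t. end_time T g < t \<Longrightarrow> T < fst (g t)"
proof -
  define A where "A = {s. 0 \<le> s \<and> fst (g s) \<le> T}"
  define e where "e = Sup A"
  have mono: "mono_on {0..} (\<lambda>t. fst (g t))" and g0: "g 0 = 0" using g by (auto simp: control_curve_def)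
  have cont: "continuous_on {0..} (\<lambda>t. fst (g t))" using control_curve_continuous[OF g] by (rule continuous_on_fst)
  obtain t1 where t1: "0 \<le> t1" "T < fst (g t1)" using g by (auto simp: control_curve_def)
  have bd: "s \<le> t1" if "s \<in> A" for s
  proof (rule ccontr)
    assume "\<not> s \<le> t1"
    then have "fst (g t1) \<le> fst (g s)" using t1 by (intro mono_onD[OF mono]) auto
    then show False using that t1 by (auto simp: A_def)
  qed
  have 0: "0 \<in> A" using g0 T by (simp add: A_def)
  have bdd: "bdd_above A" using bd by (auto simp: bdd_above_def)
  have cl: "closed A"
  proof -
    have "closed ({0..} \<inter> (\<lambda>t. fst (g t)) -` {..T})"
      by (rule continuous_closed_preimage[OF cont]) auto
    moreover have "{0..} \<inter> (\<lambda>t. fst (g t)) -` {..T} = A" by (auto simp: A_def)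
    ultimately show ?thesis by simp
  qed
  have eA: "e \<in> A" unfolding e_def using 0 bdd cl by (intro closed_contains_Sup) auto
  have gt: "T < fst (g t)" if "e < t" for t
  proof (rule ccontr)
    assume "\<not> T < fst (g t)"
    then have "t \<in> A" using that eA by (auto simp: A_def)
    then have "t \<le> e" unfolding e_def using bdd by (rule cSup_upper)
    then show False using that by simp
  qed
  have "T \<le> fst (g e)"
  proof (rule tendsto_le[of "at_right e" "\<lambda>t. fst (g t)" _ "\<lambda>_. T"])
    have "((\<lambda>t. fst (g t)) \<longlongrightarrow> fst (g e)) (at e within {0..})"
      using cont eA by (auto simp: continuous_on_def A_def)
    then show "((\<lambda>t. fst (g t)) \<longlongrightarrow> fst (g e)) (at_right e)"
      by (rule tendsto_mono[rotated]) (use eA in \<open>auto intro!: at_le simp: A_def\<close>)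
    show "\<forall>\<^sub>F t in at_right e. T \<le> fst (g t)"
      unfolding eventually_at_right_field using gt by (intro exI[of _ "e + 1"]) (auto simp: less_imp_le)
  qed auto
  then have eq: "fst (g e) = T" using eA by (simp add: A_def)
  have e: "end_time T g = e" unfolding end_time_def sharp_def e_def A_def ..
  show "fst (g (end_time T g)) = T" "\<And>t. end_time T g < t \<Longrightarrow> T < fst (g t)"
    unfolding e using eq gt by auto
  have "e \<noteq> 0" using eq g0 T by auto
  then show "0 < end_time T g" unfolding e using eA by (auto simp: A_def)
qed

text \<open>The two branches of the truncation merge because \<open>V\<close> equals
  \<open>T\<close> at the end time.\<close>

lemma truncation_eq_stopped:
  assumes "control_curve T g" "0 < T"
  shows "truncation T g t = g (min t (end_time T g))"
  using end_time_props(2)[OF assms] by (auto simp: truncation_def min_def prod_eq_iff)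

section \<open>Frechet equivalence\<close>

text \<open>An increasing homeomorphism of the half-line, carried together with its inverse so that
  symmetry and composition are immediate.\<close>

definition reparam :: "(real \<Rightarrow> real) \<Rightarrow> (real \<Rightarrow> real) \<Rightarrow> bool" where
  "reparam \<alpha> \<beta> \<longleftrightarrow> continuous_on {0..} \<alpha> \<and> continuous_on {0..} \<beta> \<and> mono_on {0..} \<alpha> \<and> mono_on {0..} \<beta> \<and>
     (\<forall>t\<ge>0. 0 \<le> \<alpha> t \<and> 0 \<le> \<beta> t \<and> \<alpha> (\<beta> t) = t \<and> \<beta> (\<alpha> t) = t)"

lemma reparam_sym: "reparam \<alpha> \<beta> \<Longrightarrow> reparam \<beta> \<alpha>"
  by (auto simp: reparam_def)

lemma reparamD:
  assumes "reparam \<alpha> \<beta>" "0 \<le> t"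
  shows "0 \<le> \<alpha> t" "0 \<le> \<beta> t" "\<alpha> (\<beta> t) = t" "\<beta> (\<alpha> t) = t"
  using assms by (auto simp: reparam_def)

lemma reparam_mono: "reparam \<alpha> \<beta> \<Longrightarrow> 0 \<le> s \<Longrightarrow> s \<le> t \<Longrightarrow> \<alpha> s \<le> \<alpha> t"
  unfolding reparam_def using mono_onD[of "{0..}" \<alpha> s t] by auto

lemma reparam_zero:
  assumes r: "reparam \<alpha> \<beta>" shows "\<alpha> 0 = 0"
  using reparam_mono[OF r, of 0 "\<beta> 0"] reparamD[OF r order_refl] by simp

lemma reparam_le_iff:
  assumes r: "reparam \<alpha> \<beta>" and "0 \<le> s" "0 \<le> t"
  shows "\<alpha> s \<le> t \<longleftrightarrow> s \<le> \<beta> t"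
  using reparam_mono[OF r, of s "\<beta> t"] reparam_mono[OF reparam_sym[OF r], of "\<alpha> s" t] reparamD[OF r] assms by metis

lemma reparam_trans:
  assumes 1: "reparam \<alpha> \<beta>" and 2: "reparam \<alpha>' \<beta>'"
  shows "reparam (\<lambda>t. \<alpha>' (\<alpha> t)) (\<lambda>t. \<beta> (\<beta>' t))"
proof -
  have sub: "\<alpha> ` {0..} \<subseteq> {0..}" "\<beta>' ` {0..} \<subseteq> {0..}" using reparamD[OF 1] reparamD[OF 2] by auto
  have "continuous_on {0..} (\<lambda>t. \<alpha>' (\<alpha> t))" "continuous_on {0..} (\<lambda>t. \<beta> (\<beta>' t))"
    using 1 2 sub unfolding reparam_def by (auto intro: continuous_on_compose2)
  moreover have "mono_on {0..} (\<lambda>t. \<alpha>' (\<alpha> t))" "mono_on {0..} (\<lambda>t. \<beta> (\<beta>' t))"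
    using reparamD[OF 1] reparamD[OF 2]
    by (auto intro!: mono_onI reparam_mono[OF 1] reparam_mono[OF 2] reparam_mono[OF reparam_sym[OF 1]] reparam_mono[OF reparam_sym[OF 2]])
  ultimately show ?thesis using reparamD[OF 1] reparamD[OF 2] unfolding reparam_def by auto
qed

lemma time_changes_reparam:
  assumes a: "\<alpha> \<in> time_changes"
  shows "reparam \<alpha> (inv_into {0..} \<alpha>)"
proof -
  define \<beta> where "\<beta> = inv_into {0..} \<alpha>"
  have bij: "bij_betw \<alpha> {0..} {0..}" and sm: "strict_mono_on {0..} \<alpha>" and ac: "abs_cont_on {0..} \<alpha>" "abs_cont_on {0..} \<beta>"
    using a by (auto simp: time_changes_def \<beta>_def)
  have \<beta>: "0 \<le> \<alpha> t" "0 \<le> \<beta> t" "\<alpha> (\<beta> t) = t" "\<beta> (\<alpha> t) = t" if "0 \<le> t" for t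
    using bij that bij_betw_apply[OF bij] bij_betw_apply[OF bij_betw_inv_into[OF bij]]
      bij_betw_inv_into_right[OF bij] bij_betw_inv_into_left[OF bij] unfolding \<beta>_def by auto
  have m: "mono_on {0..} \<alpha>" using sm by (rule strict_mono_on_imp_mono_on)
  have "mono_on {0..} \<beta>"
  proof (rule mono_onI, rule ccontr)
    fix s t :: real assume st: "s \<in> {0..}" "t \<in> {0..}" "s \<le> t" and "\<not> \<beta> s \<le> \<beta> t"
    then have "\<alpha> (\<beta> t) < \<alpha> (\<beta> s)" using \<beta> by (intro strict_mono_onD[OF sm]) auto
    then show False using \<beta> st by simp
  qed
  moreover have "continuous_on {0..} \<alpha>" "continuous_on {0..} \<beta>"
    using ac by (auto intro!: abs_cont_on_continuous_on simp: is_interval_ci)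
  ultimately show ?thesis using \<beta> m unfolding reparam_def \<beta>_def[symmetric] by blast
qed

text \<open>A pointwise bound instead of an essential supremum, so that closeness can be used at
  individually chosen times such as end times and grid points.\<close>

definition frechet_close :: "(real \<Rightarrow> 'a::real_normed_vector) \<Rightarrow> (real \<Rightarrow> 'a) \<Rightarrow> real \<Rightarrow> bool" where
  "frechet_close g1 g2 \<epsilon> \<longleftrightarrow> (\<exists>\<alpha> \<beta>. reparam \<alpha> \<beta> \<and> (\<forall>t\<ge>0. norm (g1 t - g2 (\<alpha> t)) \<le> \<epsilon>))"

lemma frechet_close_sym:
  assumes "frechet_close g1 g2 \<epsilon>" shows "frechet_close g2 g1 \<epsilon>"
proof -
  obtain \<alpha> \<beta> where r: "reparam \<alpha> \<beta>" and le: "\<And>t. 0 \<le> t \<Longrightarrow> norm (g1 t - g2 (\<alpha> t)) \<le> \<epsilon>"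
    using assms unfolding frechet_close_def by blast
  have "norm (g2 t - g1 (\<beta> t)) \<le> \<epsilon>" if "0 \<le> t" for t
    using le[of "\<beta> t"] reparamD[OF r that] by (simp add: norm_minus_commute)
  then show ?thesis using reparam_sym[OF r] unfolding frechet_close_def by blast
qed

lemma frechet_close_trans:
  assumes "frechet_close g1 g2 \<epsilon>" "frechet_close g2 g3 \<epsilon>'" shows "frechet_close g1 g3 (\<epsilon> + \<epsilon>')"
proof -
  obtain \<alpha> \<beta> where r: "reparam \<alpha> \<beta>" and le: "\<And>t. 0 \<le> t \<Longrightarrow> norm (g1 t - g2 (\<alpha> t)) \<le> \<epsilon>"
    using assms unfolding frechet_close_def by blast
  obtain \<alpha>' \<beta>' where r': "reparam \<alpha>' \<beta>'" and le': "\<And>t. 0 \<le> t \<Longrightarrow> norm (g2 t - g3 (\<alpha>' t)) \<le> \<epsilon>'"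
    using assms unfolding frechet_close_def by blast
  have "norm (g1 t - g3 (\<alpha>' (\<alpha> t))) \<le> \<epsilon> + \<epsilon>'" if "0 \<le> t" for t
  proof -
    have "g1 t - g3 (\<alpha>' (\<alpha> t)) = (g1 t - g2 (\<alpha> t)) + (g2 (\<alpha> t) - g3 (\<alpha>' (\<alpha> t)))" by simp
    then show ?thesis using norm_triangle_mono[OF le[OF that] le'[of "\<alpha> t"]] reparamD[OF r that] by metis
  qed
  then show ?thesis using reparam_trans[OF r r'] unfolding frechet_close_def by blast
qed

text \<open>An essential supremum over a negligible set could be negative; here the half-line has
  positive measure.\<close>

lemma Linf_norm_nonneg: "0 \<le> Linf_norm h"
proof (rule ccontr)
  assume neg: "\<not> 0 \<le> Linf_norm h"
  have "AE t in lebesgue_on {0..}. ereal (norm (h t)) \<le> Linf_norm h"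
    unfolding Linf_norm_def by (rule esssup_AE)
  moreover have "False" if "ereal (norm (h t)) \<le> Linf_norm h" for t
  proof -
    have "0 \<le> ereal (norm (h t))" by simp
    then show False using that neg by (meson order_trans)
  qed
  ultimately have "AE t in lebesgue_on {0::real..}. False" by (rule eventually_mono)
  then have "negligible {x \<in> {0::real..}. \<not> False}" by (subst (asm) AE_lebesgue_on_negligible) auto
  then have "negligible {0..1::real}" by (rule negligible_subset) auto
  then show False using negligible_interval(1)[of 0 "1::real"] by (simp add: box_real)
qed

text \<open>A continuous function that exceeds the bound at one point exceeds it on an interval,
  which is not negligible.\<close>

lemma Linf_norm_less_imp:
  assumes less: "Linf_norm h < ereal \<epsilon>" and cont: "continuous_on {0..} h" and t0: "0 \<le> t0"
  shows "norm (h t0) \<le> \<epsilon>"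
proof (rule ccontr)
  assume gt: "\<not> norm (h t0) \<le> \<epsilon>"
  have "AE t in lebesgue_on {0..}. ereal (norm (h t)) \<le> Linf_norm h"
    unfolding Linf_norm_def by (rule esssup_AE)
  then have "AE t in lebesgue_on {0..}. norm (h t) < \<epsilon>"
    using less by (auto elim!: eventually_mono) (meson le_less_trans less_ereal.simps(1))
  then have neg: "negligible {x \<in> {0..}. \<not> norm (h x) < \<epsilon>}" by (subst (asm) AE_lebesgue_on_negligible) auto
  have "continuous_on {0..} (\<lambda>t. norm (h t))" using cont by (rule continuous_on_norm)
  then obtain d where d: "0 < d" "\<And>t. 0 \<le> t \<Longrightarrow> dist t t0 < d \<Longrightarrow> dist (norm (h t)) (norm (h t0)) < norm (h t0) - \<epsilon>"
    unfolding continuous_on_iff using t0 gt by (metis atLeast_iff diff_gt_0_iff_gt not_le)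
  \<comment> \<open>The interval extends to the right of \<open>t0\<close>, and so stays in the
    half-line even for t0 = 0.\<close>
  have "{t0..t0 + d/2} \<subseteq> {x \<in> {0..}. \<not> norm (h x) < \<epsilon>}"
  proof
    fix t assume "t \<in> {t0..t0 + d/2}"
    then have "0 \<le> t" "dist t t0 < d" using t0 d(1) by (auto simp: dist_real_def)
    then show "t \<in> {x \<in> {0..}. \<not> norm (h x) < \<epsilon>}" using d(2)[of t] by (auto simp: dist_real_def)
  qed
  then have "negligible {t0..t0 + d/2}" using neg negligible_subset by blast
  then show False using negligible_interval(1)[of t0 "t0 + d/2"] d(1) by (simp add: box_real)
qed

lemma frechet_rel_close:
  assumes "(g1, g2) \<in> frechet_rel" "0 < \<epsilon>"
  shows "frechet_close g1 g2 \<epsilon>"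
proof -
  have ac: "abs_cont_on {0..} g1" "abs_cont_on {0..} g2"
    and "(INF \<alpha>\<in>time_changes. Linf_norm (\<lambda>t. g1 t - g2 (\<alpha> t))) < ereal \<epsilon>"
    using assms by (auto simp: frechet_rel_def)
  then obtain \<alpha> where \<alpha>: "\<alpha> \<in> time_changes" "Linf_norm (\<lambda>t. g1 t - g2 (\<alpha> t)) < ereal \<epsilon>"
    unfolding INF_less_iff by blast
  have r: "reparam \<alpha> (inv_into {0..} \<alpha>)" by (rule time_changes_reparam[OF \<alpha>(1)])
  have c: "continuous_on {0..} g1" "continuous_on {0..} g2"
    using ac by (auto intro!: abs_cont_on_continuous_on simp: is_interval_ci)
  have "continuous_on {0..} (\<lambda>t. g1 t - g2 (\<alpha> t))"
    using r reparamD[OF r] by (intro continuous_on_diff c continuous_on_compose2[OF c(2)]) (auto simp: reparam_def)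
  then show ?thesis using Linf_norm_less_imp[OF \<alpha>(2)] r unfolding frechet_close_def by blast
qed

text \<open>The classes are formed among all absolutely continuous curves, so for their members only
  the relation to some curve in \<open>gen_curves\<close> is known. The start at 0 and monotonicity
  survive uniform limits, and exceeding \<open>T\<close> somewhere survives a small
  displacement.\<close>

lemma control_curve_frechet_rel:
  assumes g: "control_curve T g1" and rel: "(g1, g2) \<in> frechet_rel"
  shows "control_curve T g2"
proof -
  have ac: "abs_cont_on {0..} g2" using rel by (auto simp: frechet_rel_def)
  have mono1: "mono_on {0..} (\<lambda>t. fst (g1 t))" using g by (simp add: control_curve_def)
  have fstle: "\<bar>fst x - fst y\<bar> \<le> norm (x - y)" for x y :: "real \<times> (real^'k)"
    using norm_fst_le[of "fst (x - y)" "snd (x - y)"] unfolding prod.collapse by simp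
  have close: "\<exists>\<alpha> \<beta>. reparam \<alpha> \<beta> \<and> (\<forall>t\<ge>0. norm (g2 t - g1 (\<alpha> t)) \<le> e)" if "0 < e" for e
    using frechet_close_sym[OF frechet_rel_close[OF rel that]] unfolding frechet_close_def .
  have "norm (g2 0) \<le> e" if e: "0 < e" for e
  proof -
    obtain \<alpha> \<beta> where r: "reparam \<alpha> \<beta>" and le: "\<forall>t\<ge>0. norm (g2 t - g1 (\<alpha> t)) \<le> e"
      using close[OF e] by blast
    show ?thesis using le[rule_format, of 0] reparam_zero[OF r] g by (simp add: control_curve_def)
  qed
  then have "norm (g2 0) \<le> 0" by (rule field_le_epsilon[of _ 0, simplified])
  then have g0: "g2 0 = 0" by simp
  have mono: "mono_on {0..} (\<lambda>t. fst (g2 t))"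
  proof (rule mono_onI, rule field_le_epsilon)
    fix s t e :: real assume st: "s \<in> {0..}" "t \<in> {0..}" "s \<le> t" and e: "0 < e"
    have e2: "0 < e/2" using e by simp
    obtain \<alpha> \<beta> where r: "reparam \<alpha> \<beta>" and le: "\<forall>t\<ge>0. norm (g2 t - g1 (\<alpha> t)) \<le> e/2"
      using close[OF e2] by blast
    have "fst (g1 (\<alpha> s)) \<le> fst (g1 (\<alpha> t))"
      using st reparamD[OF r] reparam_mono[OF r] by (intro mono_onD[OF mono1]) auto
    moreover have "\<bar>fst (g2 s) - fst (g1 (\<alpha> s))\<bar> \<le> e/2" "\<bar>fst (g2 t) - fst (g1 (\<alpha> t))\<bar> \<le> e/2"
      using le st fstle order_trans by (metis atLeast_iff)+
    ultimately show "fst (g2 s) \<le> fst (g2 t) + e" by linarith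
  qed
  obtain t1 where t1: "0 \<le> t1" "T < fst (g1 t1)" using g by (auto simp: control_curve_def)
  \<comment> \<open>Half of the excess over \<open>T\<close>: a curve that stays this close still
    exceeds \<open>T\<close>.\<close>
  define e where "e = (fst (g1 t1) - T) / 2"
  have e: "0 < e" using t1 by (simp add: e_def)
  obtain \<alpha> \<beta> where r: "reparam \<alpha> \<beta>" and le: "\<forall>t\<ge>0. norm (g1 t - g2 (\<alpha> t)) \<le> e"
    using frechet_rel_close[OF rel e] unfolding frechet_close_def by blast
  have "\<bar>fst (g1 t1) - fst (g2 (\<alpha> t1))\<bar> \<le> e" using le t1 fstle order_trans by metis
  moreover have "2 * e = fst (g1 t1) - T" by (simp add: e_def)
  ultimately have "T < fst (g2 (\<alpha> t1))" using e by linarith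
  then show ?thesis unfolding control_curve_def using ac g0 mono reparamD(1)[OF r t1(1)] by blast
qed

text \<open>Beyond the end time the first component exceeds \<open>T\<close>, so that a reparametrization bringing the curves close
  must bring the end times close, too.\<close>

lemma frechet_close_stopped:
  fixes g1 g2 :: "real \<Rightarrow> real \<times> (real^'k)"
  assumes g1: "control_curve T g1" and g2: "control_curve T g2" and T: "0 < T"
    and close: "\<And>\<epsilon>. 0 < \<epsilon> \<Longrightarrow> frechet_close g1 g2 \<epsilon>" and \<epsilon>: "0 < \<epsilon>"
  shows "frechet_close (\<lambda>t. g1 (min t (end_time T g1))) (\<lambda>t. g2 (min t (end_time T g2))) \<epsilon>"
proof -
  define e1 e2 where "e1 = end_time T g1" and "e2 = end_time T g2"
  have e: "0 < e1" "fst (g1 e1) = T" "\<And>t. e1 < t \<Longrightarrow> T < fst (g1 t)"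
       "0 < e2" "fst (g2 e2) = T" "\<And>t. e2 < t \<Longrightarrow> T < fst (g2 t)"
    using end_time_props[OF g1 T] end_time_props[OF g2 T] by (auto simp: e1_def e2_def)
  have fstle: "\<bar>fst x - fst y\<bar> \<le> norm (x - y)" for x y :: "real \<times> (real^'k)"
    using norm_fst_le[of "fst (x - y)" "snd (x - y)"] unfolding prod.collapse by simp
  have near: "\<exists>d>0. \<forall>t. t \<in> {a..a + d} \<longrightarrow> norm (g t - g a) \<le> \<epsilon>/2"
    if g: "control_curve T g" and a: "0 < a" for g :: "real \<Rightarrow> real \<times> (real^'k)" and a
  proof -
    obtain d where d: "0 < d" "\<And>t. 0 \<le> t \<Longrightarrow> dist t a < d \<Longrightarrow> dist (g t) (g a) < \<epsilon>/2"
      using control_curve_continuous[OF g] a \<epsilon> unfolding continuous_on_iff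
      by (metis atLeast_iff half_gt_zero less_imp_le)
    have "norm (g t - g a) \<le> \<epsilon>/2" if "t \<in> {a..a + d/2}" for t
      using d(2)[of t] that a d(1) by (auto simp: dist_norm)
    then show ?thesis using d(1) by (intro exI[of _ "d/2"]) auto
  qed
  obtain d1 where d1: "0 < d1" "\<And>t. t \<in> {e1..e1 + d1} \<Longrightarrow> norm (g1 t - g1 e1) \<le> \<epsilon>/2"
    using near[OF g1 e(1)] by blast
  obtain d2 where d2: "0 < d2" "\<And>t. t \<in> {e2..e2 + d2} \<Longrightarrow> norm (g2 t - g2 e2) \<le> \<epsilon>/2"
    using near[OF g2 e(4)] by blast
  \<comment> \<open>Below the excess over \<open>T\<close> that either curve has reached shortly
    after its end time. While the first component is at most T + \<kappa>, a curve is therefore less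
    than \<open>d1\<close> or \<open>d2\<close> past its end and has moved by at most
    \<epsilon>/2.\<close>
  define \<kappa> where "\<kappa> = Min {\<epsilon>/2, (fst (g1 (e1 + d1)) - T)/2, (fst (g2 (e2 + d2)) - T)/2}"
  have \<kappa>: "0 < \<kappa>" "\<kappa> \<le> \<epsilon>/2" "T + \<kappa> < fst (g1 (e1 + d1))" "T + \<kappa> < fst (g2 (e2 + d2))"
    using \<epsilon> e(3)[of "e1 + d1"] e(6)[of "e2 + d2"] d1(1) d2(1) unfolding \<kappa>_def by (auto simp: min_def field_simps)
  obtain \<alpha> \<beta> where r: "reparam \<alpha> \<beta>" and le: "\<And>t. 0 \<le> t \<Longrightarrow> norm (g1 t - g2 (\<alpha> t)) \<le> \<kappa>"
    using close[OF \<kappa>(1)] unfolding frechet_close_def by blast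
  have mono1: "fst (g1 s) \<le> fst (g1 t)" if "0 \<le> s" "s \<le> t" for s t
    using g1 that by (auto simp: control_curve_def elim!: mono_onD)
  have mono2: "fst (g2 s) \<le> fst (g2 t)" if "0 \<le> s" "s \<le> t" for s t
    using g2 that by (auto simp: control_curve_def elim!: mono_onD)
  have main: "norm (g1 (min t e1) - g2 (min (\<alpha> t) e2)) \<le> \<epsilon>" if t: "0 \<le> t" for t
  proof (cases "\<alpha> e1 \<le> e2")
    case True
    show ?thesis
    proof (cases "t \<le> e1")
      case True
      then have "\<alpha> t \<le> e2" using reparam_mono[OF r t True] \<open>\<alpha> e1 \<le> e2\<close> by simp
      then show ?thesis using le[OF t] True \<kappa> \<epsilon> by (simp add: min_def)
    next
      case False
      \<comment> \<open>\<open>t\<close> cut off where the second curve stops, so that \<alpha> s =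
        min (\<alpha> t) e2. The first curve has already stopped, and its motion between
        \<open>e1\<close> and \<open>s\<close> is what must be small.\<close>
      define s where "s = min t (\<beta> e2)"
      have e1b: "e1 \<le> \<beta> e2" using reparam_le_iff[OF r, of e1 e2] e True by simp
      have as: "\<alpha> s = min (\<alpha> t) e2"
      proof (cases "t \<le> \<beta> e2")
        case True
        then show ?thesis using reparam_le_iff[OF r t, of e2] e by (simp add: s_def min_def)
      next
        case False
        then show ?thesis using reparam_le_iff[OF r t, of e2] reparamD[OF r, of e2] e by (simp add: s_def min_def)
      qed
      have s: "e1 \<le> s" "0 \<le> s" using False e1b e by (auto simp: s_def)
      have "fst (g1 s) \<le> T + \<kappa>"
      proof -
        have "fst (g2 (\<alpha> s)) \<le> fst (g2 e2)" using as reparamD(1)[OF r s(2)] by (intro mono2) auto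
        then show ?thesis using fstle[of "g1 s" "g2 (\<alpha> s)"] le[OF s(2)] e(5) by linarith
      qed
      then have "s \<le> e1 + d1" using \<kappa>(3) mono1[of "e1 + d1" s] e d1(1) by (smt (verit))
      then have "norm (g1 s - g1 e1) \<le> \<epsilon>/2" using d1(2) s by simp
      moreover have "g1 (min t e1) - g2 (min (\<alpha> t) e2) = (g1 s - g2 (\<alpha> s)) - (g1 s - g1 e1)"
        using False as by (simp add: min_def)
      ultimately show ?thesis using norm_triangle_ineq4[of "g1 s - g2 (\<alpha> s)" "g1 s - g1 e1"] le[OF s(2)] \<kappa>(2) by simp
    qed
  next
    case False
    show ?thesis
    proof (cases "\<alpha> t \<le> e2")
      case True
      then have "t < e1" using False reparam_mono[OF r, of e1 t] e by (smt (verit))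
      then show ?thesis using le[OF t] True \<kappa> \<epsilon> by (simp add: min_def)
    next
      case ne: False
      \<comment> \<open>The mirror case: the second curve has passed \<open>e2\<close> while the
        first still runs, so its motion beyond \<open>e2\<close> must be small.\<close>
      define s where "s = min t e1"
      have s: "0 \<le> s" using t e by (simp add: s_def)
      have as: "e2 \<le> \<alpha> s" using ne False by (auto simp: s_def min_def)
      have "fst (g2 (\<alpha> s)) \<le> T + \<kappa>"
      proof -
        have "fst (g1 s) \<le> fst (g1 e1)" using s by (intro mono1) (auto simp: s_def)
        then show ?thesis using fstle[of "g1 s" "g2 (\<alpha> s)"] le[OF s] e(2) by linarith
      qed
      then have "\<alpha> s \<le> e2 + d2" using \<kappa>(4) mono2[of "e2 + d2" "\<alpha> s"] e d2(1) by (smt (verit))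
      then have "norm (g2 (\<alpha> s) - g2 e2) \<le> \<epsilon>/2" using d2(2) as by simp
      moreover have "g1 (min t e1) - g2 (min (\<alpha> t) e2) = (g1 s - g2 (\<alpha> s)) + (g2 (\<alpha> s) - g2 e2)"
        using ne by (simp add: min_def s_def)
      ultimately show ?thesis using norm_triangle_ineq[of "g1 s - g2 (\<alpha> s)" "g2 (\<alpha> s) - g2 e2"] le[OF s] \<kappa>(2) by simp
    qed
  qed
  show ?thesis unfolding frechet_close_def e1_def[symmetric] e2_def[symmetric] using main r by blast
qed

lemma dist_T_nonneg: "0 \<le> dist_T T p q"
  unfolding dist_T_def by (auto intro!: INF_greatest Linf_norm_nonneg)

text \<open>The members \<open>h1\<close>, \<open>h2\<close> that nearly realize the distance differ
  from the chosen representatives. The detour from one representative over \<open>h1\<close> and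
  \<open>h2\<close> to the other costs \<delta>/2 + \<delta> + \<delta>/2.\<close>

lemma dist_T_less_imp_frechet_close:
  assumes p: "p \<in> gen_controls T" and q: "q \<in> gen_controls T" and T: "0 < T"
    and less: "dist_T T p q < ereal \<delta>"
  shows "control_curve T (representative p)" "control_curve T (representative q)"
    "frechet_close (\<lambda>t. representative p (min t (end_time T (representative p))))
       (\<lambda>t. representative q (min t (end_time T (representative q)))) (2 * \<delta>)"
proof -
  obtain h1 h2 where h: "h1 \<in> p" "h2 \<in> q" "Linf_norm (\<lambda>t. truncation T h1 t - truncation T h2 t) < ereal \<delta>"
    using less unfolding dist_T_def INF_less_iff by auto
  have "0 < \<delta>" using le_less_trans[OF dist_T_nonneg less] by simp
  have cls: "control_curve T g \<and> control_curve T (representative P) \<and>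
      (\<forall>\<epsilon>>0. frechet_close (\<lambda>t. representative P (min t (end_time T (representative P)))) (\<lambda>t. g (min t (end_time T g))) \<epsilon>)"
    if P: "P \<in> gen_controls T" and g: "g \<in> P" for P g
  proof -
    obtain x where x: "x \<in> gen_curves T" "P = frechet_rel `` {x}" using P by (auto simp: gen_controls_def elim: quotientE)
    have rep: "representative P \<in> P" unfolding representative_def using someI[of "\<lambda>g. g \<in> P", OF g] .
    have rel: "(x, g) \<in> frechet_rel" "(x, representative P) \<in> frechet_rel" using x(2) g rep by auto
    have cx: "control_curve T x" by (rule gen_curves_control_curve[OF x(1)])
    have c: "control_curve T g" "control_curve T (representative P)"
      using control_curve_frechet_rel[OF cx] rel by auto
    have "frechet_close (representative P) g \<epsilon>" if "0 < \<epsilon>" for \<epsilon>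
      using frechet_close_trans[OF frechet_close_sym[OF frechet_rel_close[OF rel(2), of "\<epsilon>/2"]] frechet_rel_close[OF rel(1), of "\<epsilon>/2"]] that
      by simp
    then show ?thesis using c frechet_close_stopped[OF c(2,1) T] by blast
  qed
  note c1 = cls[OF p h(1)] and c2 = cls[OF q h(2)]
  show "control_curve T (representative p)" "control_curve T (representative q)" using c1 c2 by auto
  have cont: "continuous_on {0..} (\<lambda>t. g (min t (end_time T g)))" if "control_curve T g" for g :: "real \<Rightarrow> real \<times> (real^'k)"
    using end_time_props(1)[OF that T]
    by (intro continuous_on_compose2[OF control_curve_continuous[OF that]] continuous_intros) auto
  have "norm (h1 (min t (end_time T h1)) - h2 (min t (end_time T h2))) \<le> \<delta>" if "0 \<le> t" for t
  proof (rule Linf_norm_less_imp[OF _ _ that])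
    show "Linf_norm (\<lambda>t. h1 (min t (end_time T h1)) - h2 (min t (end_time T h2))) < ereal \<delta>"
      using h(3) c1 c2 T by (simp add: truncation_eq_stopped)
    show "continuous_on {0..} (\<lambda>t. h1 (min t (end_time T h1)) - h2 (min t (end_time T h2)))"
      using c1 c2 by (intro continuous_on_diff cont) auto
  qed
  moreover have "reparam (\<lambda>t. t) (\<lambda>t. t)" by (auto simp: reparam_def mono_on_def)
  ultimately have "frechet_close (\<lambda>t. h1 (min t (end_time T h1))) (\<lambda>t. h2 (min t (end_time T h2))) \<delta>"
    unfolding frechet_close_def by blast
  then have "frechet_close (\<lambda>t. representative p (min t (end_time T (representative p)))) (\<lambda>t. h2 (min t (end_time T h2))) (\<delta>/2 + \<delta>)"
    using c1 \<open>0 < \<delta>\<close> by (intro frechet_close_trans) auto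
  from frechet_close_trans[OF this frechet_close_sym, of _ "\<delta>/2"] c2 \<open>0 < \<delta>\<close>
  show "frechet_close (\<lambda>t. representative p (min t (end_time T (representative p))))
       (\<lambda>t. representative q (min t (end_time T (representative q)))) (2 * \<delta>)" by simp
qed

section \<open>Affine minorants of the Lagrangian\<close>

text \<open>A hyperplane separates the epigraph from the open vertical ray below the point of the
  graph over \<open>u0\<close>; its slope is the subgradient.\<close>

lemma convex_on_subgradient:
  fixes \<phi> :: "'a::euclidean_space \<Rightarrow> real"
  assumes conv: "convex_on UNIV \<phi>"
  shows "\<exists>b. \<forall>u. \<phi> u0 + b \<bullet> (u - u0) \<le> \<phi> u"
proof -
  have "convex (epigraph UNIV \<phi>)" using conv by (simp add: convex_epigraph)
  moreover have "convex ({u0} \<times> {..<\<phi> u0})" by (intro convex_Times) auto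
  moreover have "epigraph UNIV \<phi> \<noteq> {}" "{u0} \<times> {..<\<phi> u0} \<noteq> {}"
    using lt_ex[of "\<phi> u0"] by (auto simp: epigraph_def)
  moreover have "epigraph UNIV \<phi> \<inter> ({u0} \<times> {..<\<phi> u0}) = {}" by (auto simp: epigraph_def)
  ultimately obtain a \<beta> where a: "a \<noteq> 0" "\<And>p. p \<in> epigraph UNIV \<phi> \<Longrightarrow> a \<bullet> p \<le> \<beta>"
    "\<And>p. p \<in> {u0} \<times> {..<\<phi> u0} \<Longrightarrow> \<beta> \<le> a \<bullet> p"
    using separating_hyperplane_sets by metis
  obtain a1 a2 where a12: "a = (a1, a2)" by fastforce
  have up: "a1 \<bullet> u + a2 * r \<le> \<beta>" if "\<phi> u \<le> r" for u r
    using a(2)[of "(u, r)"] that by (simp add: epigraph_def a12)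
  have lo: "\<beta> \<le> a1 \<bullet> u0 + a2 * r" if "r < \<phi> u0" for r
    using a(3)[of "(u0, r)"] that by (simp add: a12)
  \<comment> \<open>The hyperplane is not vertical: for a2 = 0 the point u0 + a1 would violate the
    separation, and a positive \<open>a2\<close> is excluded by comparing two heights over
    \<open>u0\<close>.\<close>
  have a2: "a2 < 0"
  proof (rule ccontr)
    assume "\<not> a2 < 0"
    then consider "a2 = 0" | "0 < a2" by linarith
    then show False
    proof cases
      case 1
      then have "a1 \<bullet> (u0 + a1) \<le> a1 \<bullet> u0"
        using up[of "u0 + a1" "\<phi> (u0 + a1)"] lo[of "\<phi> u0 - 1"] by simp
      then have "a1 \<bullet> a1 \<le> 0" by (simp add: inner_add_right)
      then have "a1 = 0" by (metis inner_gt_zero_iff not_le)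
      then show False using a(1) 1 a12 by (simp add: zero_prod_def)
    next
      case 2
      then show False using up[of u0 "\<phi> u0"] lo[of "\<phi> u0 - 1"] by (simp add: algebra_simps)
    qed
  qed
  have lo': "\<beta> \<le> a1 \<bullet> u0 + a2 * \<phi> u0"
  proof (rule field_le_epsilon)
    fix e :: real assume "0 < e"
    then have "\<beta> \<le> a1 \<bullet> u0 + a2 * (\<phi> u0 - e / (- a2))" using a2 by (intro lo) (simp add: field_simps)
    also have "\<dots> = a1 \<bullet> u0 + a2 * \<phi> u0 + e" using a2 by (simp add: field_simps)
    finally show "\<beta> \<le> a1 \<bullet> u0 + a2 * \<phi> u0 + e" .
  qed
  show ?thesis
  proof (intro exI allI)
    fix u
    have "a1 \<bullet> (u - u0) \<le> (- a2) * (\<phi> u - \<phi> u0)"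
      using up[of u "\<phi> u"] lo' by (simp add: inner_diff_right algebra_simps)
    then have "a1 \<bullet> (u - u0) / (- a2) \<le> \<phi> u - \<phi> u0" using a2 by (simp add: field_simps)
    then show "\<phi> u0 + (a1 /\<^sub>R (- a2)) \<bullet> (u - u0) \<le> \<phi> u" by (simp add: divide_inverse mult.commute)
  qed
qed

text \<open>An affine function a + b \<bullet> u is stored as the vector z = (a, b), so that
  \<open>z \<bullet> (v, w)\<close> is its homogeneous extension.\<close>

definition minorants :: "(real^'n \<Rightarrow> real^'k \<Rightarrow> real) \<Rightarrow> real^'n \<Rightarrow> (real \<times> (real^'k)) set" where
  "minorants L x = {z. \<forall>u. z \<bullet> (1, u) \<le> L x u}"

lemma minorant_at:
  assumes conv: "convex_on UNIV (L x)"
  obtains z where "z \<in> minorants L x" "z \<bullet> (1, u0) = L x u0"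
proof -
  obtain b where b: "\<And>u. L x u0 + b \<bullet> (u - u0) \<le> L x u" using convex_on_subgradient[OF conv] by blast
  show ?thesis
    by (rule that[of "(L x u0 - b \<bullet> u0, b)"]) (use b in \<open>auto simp: minorants_def inner_diff_right algebra_simps\<close>)
qed

lemma convex_on_slope_mono:
  fixes \<phi> :: "'a::real_vector \<Rightarrow> real"
  assumes conv: "convex_on UNIV \<phi>" and st: "0 < s" "s \<le> t"
  shows "(\<phi> (s *\<^sub>R w) - \<phi> 0) / s \<le> (\<phi> (t *\<^sub>R w) - \<phi> 0) / t"
proof -
  have t: "0 < t" using st by simp
  have "\<phi> ((1 - s/t) *\<^sub>R 0 + (s/t) *\<^sub>R (t *\<^sub>R w)) \<le> (1 - s/t) * \<phi> 0 + (s/t) * \<phi> (t *\<^sub>R w)"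
    by (rule convex_onD[OF conv]) (use st t in auto)
  then have "\<phi> (s *\<^sub>R w) - \<phi> 0 \<le> (s/t) * (\<phi> (t *\<^sub>R w) - \<phi> 0)"
    using t by (simp add: algebra_simps)
  then show ?thesis using st t by (simp add: field_simps)
qed

text \<open>With s = 1/\<eta> the expression is the slope from 0 to s w, which increases with s,
  plus \<phi>(0) \<eta>, which vanishes. The limit is the recession function of \<phi>.\<close>

lemma convex_on_recession_tendsto:
  fixes \<phi> :: "'a::real_vector \<Rightarrow> real"
  assumes conv: "convex_on UNIV \<phi>"
  shows "((\<lambda>\<eta>. ereal (\<phi> (w /\<^sub>R \<eta>) * \<eta>)) \<longlongrightarrow> (SUP s\<in>{0<..}. ereal ((\<phi> (s *\<^sub>R w) - \<phi> 0) / s))) (at_right 0)"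
proof -
  define \<psi> where "\<psi> = (\<lambda>s. (\<phi> (s *\<^sub>R w) - \<phi> 0) / s)"
  define S where "S = (SUP s\<in>{0<..}. ereal (\<psi> s))"
  have pos: "\<forall>\<^sub>F \<eta> in at_right (0::real). 0 < \<eta>" by (simp add: eventually_at_right_less)
  have "((\<lambda>\<eta>. ereal (\<psi> (inverse \<eta>))) \<longlongrightarrow> S) (at_right 0)"
  proof (rule order_tendstoI)
    fix a assume "a < S"
    then obtain s where s: "0 < s" "a < ereal (\<psi> s)" unfolding S_def less_SUP_iff by auto
    have "\<forall>\<^sub>F \<eta> in at_right 0. \<eta> < inverse s" unfolding eventually_at_right_field using s by (intro exI[of _ "inverse s"]) auto
    with pos show "\<forall>\<^sub>F \<eta> in at_right 0. a < ereal (\<psi> (inverse \<eta>))"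
    proof eventually_elim
      case (elim \<eta>)
      then have "s \<le> inverse \<eta>" using s by (simp add: field_simps)
      then have "\<psi> s \<le> \<psi> (inverse \<eta>)" unfolding \<psi>_def by (rule convex_on_slope_mono[OF conv s(1)])
      then show ?case using s(2) by (meson ereal_less_eq(3) less_le_trans)
    qed
  next
    fix a assume a: "S < a"
    show "\<forall>\<^sub>F \<eta> in at_right 0. ereal (\<psi> (inverse \<eta>)) < a"
      using pos
    proof eventually_elim
      case (elim \<eta>)
      then have "ereal (\<psi> (inverse \<eta>)) \<le> S" unfolding S_def by (intro SUP_upper) simp
      then show ?case using a by simp
    qed
  qed
  moreover have "((\<lambda>\<eta>. ereal (\<phi> 0 * \<eta>)) \<longlongrightarrow> ereal (\<phi> 0 * 0)) (at_right 0)"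
    by (intro tendsto_intros)
  ultimately have "((\<lambda>\<eta>. ereal (\<psi> (inverse \<eta>)) + ereal (\<phi> 0 * \<eta>)) \<longlongrightarrow> S + ereal (\<phi> 0 * 0)) (at_right 0)"
    by (intro tendsto_add_ereal_general1) auto
  then have "((\<lambda>\<eta>. ereal (\<psi> (inverse \<eta>)) + ereal (\<phi> 0 * \<eta>)) \<longlongrightarrow> S) (at_right 0)"
    by (simp add: zero_ereal_def[symmetric])
  moreover have "\<forall>\<^sub>F \<eta> in at_right 0. ereal (\<psi> (inverse \<eta>)) + ereal (\<phi> 0 * \<eta>) = ereal (\<phi> (w /\<^sub>R \<eta>) * \<eta>)"
    using pos
  proof eventually_elim
    case (elim \<eta>)
    then show ?case by (simp add: \<psi>_def divide_inverse algebra_simps)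
  qed
  ultimately have "((\<lambda>\<eta>. ereal (\<phi> (w /\<^sub>R \<eta>) * \<eta>)) \<longlongrightarrow> S) (at_right 0)"
    by (rule Lim_transform_eventually)
  then show ?thesis unfolding S_def \<psi>_def .
qed

lemma ext_lagrangian_zero_tendsto:
  assumes conv: "convex_on UNIV (L x)"
  shows "((\<lambda>\<eta>. ereal (L x (w /\<^sub>R \<eta>) * \<eta>)) \<longlongrightarrow> ext_lagrangian L x 0 w) (at_right 0)"
    and "ext_lagrangian L x 0 w = (SUP s\<in>{0<..}. ereal ((L x (s *\<^sub>R w) - L x 0) / s))"
proof -
  note lim = convex_on_recession_tendsto[where \<phi>="L x", OF conv, of w]
  show eq: "ext_lagrangian L x 0 w = (SUP s\<in>{0<..}. ereal ((L x (s *\<^sub>R w) - L x 0) / s))"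
    unfolding ext_lagrangian_def using tendsto_Lim[OF _ lim] by simp
  show "((\<lambda>\<eta>. ereal (L x (w /\<^sub>R \<eta>) * \<eta>)) \<longlongrightarrow> ext_lagrangian L x 0 w) (at_right 0)"
    unfolding eq by (rule lim)
qed

text \<open>For v > 0 a subgradient at w/v is exact after homogenization. For v = 0 the recession
  value is nearly attained by the slope between 0 and some s w, and a subgradient at s w dominates
  that slope.\<close>

lemma ext_lagrangian_less_imp_minorant:
  assumes conv: "convex_on UNIV (L x)" and v: "0 \<le> v" and c: "ereal c < ext_lagrangian L x v w"
  obtains z where "z \<in> minorants L x" "c < z \<bullet> (v, w)"
proof (cases "v = 0")
  case False
  then have v: "0 < v" using v by simp
  obtain z where z: "z \<in> minorants L x" "z \<bullet> (1, w /\<^sub>R v) = L x (w /\<^sub>R v)"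
    using minorant_at[where L=L and x=x, OF conv] by blast
  have "(v, w) = v *\<^sub>R (1, w /\<^sub>R v)" using v by simp
  then have "z \<bullet> (v, w) = L x (w /\<^sub>R v) * v" using z(2) by (metis inner_scaleR_right mult.commute)
  moreover have "c < L x (w /\<^sub>R v) * v" using c v by (simp add: ext_lagrangian_def)
  ultimately show ?thesis using that z(1) by simp
next
  case True
  then obtain s where s: "0 < s" "c < (L x (s *\<^sub>R w) - L x 0) / s"
    using c unfolding True ext_lagrangian_zero_tendsto(2)[where L=L and x=x, OF conv] less_SUP_iff by auto
  obtain z where z: "z \<in> minorants L x" "z \<bullet> (1, s *\<^sub>R w) = L x (s *\<^sub>R w)"
    using minorant_at[where L=L and x=x, OF conv] by blast
  have "z \<bullet> (1, 0) \<le> L x 0" using z(1) by (simp add: minorants_def)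
  then have "L x (s *\<^sub>R w) - L x 0 \<le> z \<bullet> ((1, s *\<^sub>R w) - (1, 0))" using z(2) unfolding inner_diff_right by linarith
  also have "\<dots> = s * (z \<bullet> (v, w))"
  proof -
    have "(1, s *\<^sub>R w) - (1, 0) = s *\<^sub>R (v, w)" using True by simp
    then show ?thesis by (simp only: inner_scaleR_right)
  qed
  finally have "(L x (s *\<^sub>R w) - L x 0) / s \<le> z \<bullet> (v, w)" using s by (simp add: pos_divide_le_eq mult.commute)
  then have "c < z \<bullet> (v, w)" using s(2) by linarith
  then show ?thesis using that z(1) by simp
qed

lemma bounded_on_compact_pairs:
  fixes L :: "'a::euclidean_space \<Rightarrow> 'b::euclidean_space \<Rightarrow> real"
  assumes cont: "continuous_on UNIV (\<lambda>(x, u). L x u)" and Y: "compact Y" and U: "compact U"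
  shows "\<exists>M\<ge>0. \<forall>x\<in>Y. \<forall>u\<in>U. \<bar>L x u\<bar> \<le> M"
proof -
  have "compact ((\<lambda>(x, u). L x u) ` (Y \<times> U))"
    by (intro compact_continuous_image continuous_on_subset[OF cont] compact_Times Y U) auto
  then obtain M where M: "\<forall>y\<in>(\<lambda>(x, u). L x u) ` (Y \<times> U). norm y \<le> M"
    using compact_imp_bounded bounded_iff by metis
  show ?thesis by (intro exI[of _ "max 0 M"]) (use M in force)
qed

text \<open>A subgradient at u = 0 has constant term L x 0; testing the minorant at the unit vector
  in the direction of its slope bounds the slope by 2 M.\<close>

lemma minorants_uniformly_bounded:
  assumes cont: "continuous_on UNIV (\<lambda>(x, u). L x u)" and conv: "\<And>x. convex_on UNIV (L x)" and Y: "compact Y"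
  obtains C where "0 \<le> C" "\<And>x. x \<in> Y \<Longrightarrow> \<exists>z\<in>minorants L x. norm z \<le> C"
proof -
  obtain M where M: "0 \<le> M" "\<And>x u. x \<in> Y \<Longrightarrow> u \<in> cball 0 1 \<Longrightarrow> \<bar>L x u\<bar> \<le> M"
    using bounded_on_compact_pairs[OF cont Y compact_cball] by blast
  have "\<exists>z\<in>minorants L x. norm z \<le> 3 * M" if x: "x \<in> Y" for x
  proof -
    obtain z where z: "z \<in> minorants L x" "z \<bullet> (1, 0) = L x 0" using minorant_at[where L=L and x=x, OF conv] by blast
    obtain a b where ab: "z = (a, b)" by fastforce
    have a: "a = L x 0" using z(2) ab by simp
    have "\<bar>a\<bar> \<le> M" using M(2)[OF x, of 0] a by simp
    moreover have "norm b \<le> 2 * M"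
    proof (cases "b = 0")
      case False
      define u where "u = b /\<^sub>R norm b"
      have u: "norm u = 1" "b \<bullet> u = norm b"
        using False by (auto simp: u_def dot_square_norm power2_eq_square)
      have "a + b \<bullet> u \<le> L x u" using z(1) by (auto simp: minorants_def ab)
      moreover have "\<bar>L x u\<bar> \<le> M" using M(2)[OF x, of u] u by simp
      ultimately show ?thesis using u \<open>\<bar>a\<bar> \<le> M\<close> by linarith
    qed (use M in simp)
    moreover have "norm z \<le> \<bar>a\<bar> + norm b" unfolding ab using norm_Pair_le[of a b] by simp
    ultimately show ?thesis using z(1) by (intro bexI[of _ z]) linarith+
  qed
  then show ?thesis using that[of "3 * M"] M(1) by simp
qed

text \<open>For bounded u this is uniform continuity of \<open>L\<close>. For large u convexity
  along the segment from 0 to u propagates the estimate from a sphere outward, at the price of an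
  error proportional to |u|.\<close>

lemma minorant_stable:
  assumes cont: "continuous_on UNIV (\<lambda>(x, u). L x u)" and conv: "\<And>x. convex_on UNIV (L x)"
    and Y: "compact Y" and R: "0 \<le> R" and \<epsilon>: "0 < \<epsilon>"
  shows "\<exists>\<rho>>0. \<forall>x\<in>Y. \<forall>x'. norm (x' - x) \<le> \<rho> \<longrightarrow> (\<forall>z\<in>minorants L x. norm z \<le> R \<longrightarrow>
    (\<forall>u. z \<bullet> (1, u) - \<epsilon> * norm (1::real, u) \<le> L x' u))"
proof -
  obtain B where "\<forall>x\<in>Y. norm x \<le> B" using compact_imp_bounded[OF Y] unfolding bounded_iff ..
  then have B: "Y \<subseteq> cball 0 B" by auto
  have "\<exists>M. 0 \<le> M \<and> (\<forall>x\<in>cball 0 (B + 1). \<forall>u\<in>{0}. \<bar>L x u\<bar> \<le> M)"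
    by (rule bounded_on_compact_pairs[OF cont compact_cball compact_sing])
  then obtain M where M0: "0 \<le> M \<and> (\<forall>x\<in>cball 0 (B + 1). \<forall>u\<in>{0}. \<bar>L x u\<bar> \<le> M)" ..
  have M: "\<bar>L x 0\<bar> \<le> M" if "x \<in> cball 0 (B + 1)" for x using M0 that by simp
  define C where "C = M + R"
  \<comment> \<open>Chosen so that r \<epsilon> = \<epsilon> + C, where \<open>C\<close> bounds the
    value of \<open>L\<close> at (x', 0) minus the constant term of a minorant: the whole loss on
    the sphere of radius \<open>r\<close> then equals \<theta> \<epsilon> |u| below.\<close>
  define r where "r = (\<epsilon> + C) / \<epsilon>"
  have C: "0 \<le> C" using M0 R by (simp add: C_def)
  have r: "0 < r" using C \<epsilon> by (simp add: r_def)
  have "uniformly_continuous_on (cball 0 (B + 1) \<times> cball 0 r) (\<lambda>(x, u). L x u)"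
    by (intro compact_uniformly_continuous continuous_on_subset[OF cont] compact_Times compact_cball) auto
  then obtain d where d: "0 < d" "\<And>p p'. p \<in> cball 0 (B + 1) \<times> cball 0 r \<Longrightarrow> p' \<in> cball 0 (B + 1) \<times> cball 0 r \<Longrightarrow>
      dist p' p < d \<Longrightarrow> dist ((\<lambda>(x, u). L x u) p') ((\<lambda>(x, u). L x u) p) < \<epsilon>"
    unfolding uniformly_continuous_on_def using \<epsilon> by metis
  define \<rho> where "\<rho> = min 1 (d/2)"
  have \<rho>: "0 < \<rho>" "\<rho> \<le> 1" "\<rho> < d" using d(1) by (auto simp: \<rho>_def)
  have "z \<bullet> (1, u) - \<epsilon> * norm (1::real, u) \<le> L x' u"
    if x: "x \<in> Y" and x': "norm (x' - x) \<le> \<rho>" and z: "z \<in> minorants L x" "norm z \<le> R" for x x' z u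
  proof -
    have xB: "norm x \<le> B" using x B by auto
    have x'B: "norm x' \<le> B + 1" using norm_triangle_sub[of x' x] x' \<rho> xB by linarith
    have near: "z \<bullet> (1, u) - \<epsilon> \<le> L x' u" if u: "norm u \<le> r" for u
    proof -
      have "dist ((\<lambda>(x, u). L x u) (x', u)) ((\<lambda>(x, u). L x u) (x, u)) < \<epsilon>"
        by (rule d(2)) (use xB x'B x' u \<rho> in \<open>auto simp: dist_Pair_Pair dist_norm\<close>)
      moreover have "z \<bullet> (1, u) \<le> L x u" using z(1) by (simp add: minorants_def)
      ultimately show ?thesis by (simp add: dist_real_def)
    qed
    have n1: "1 \<le> norm (1::real, u)" "norm u \<le> norm (1::real, u)"
      using norm_fst_le[of "1::real" u] norm_snd_le[of u "1::real"] by auto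
    show ?thesis
    proof (cases "norm u \<le> r")
      case True
      then show ?thesis using near[OF True] n1(1) \<epsilon> by (smt (verit) mult_left_le mult_le_cancel_left1)
    next
      case False
      \<comment> \<open>\<open>\<theta> *\<^sub>R u\<close> is the point of the segment that lies on
        the sphere of radius \<open>r\<close>, where the first case applies.\<close>
      define \<theta> where "\<theta> = r / norm u"
      have "0 < norm u" using False r by linarith
      then have \<theta>: "0 < \<theta>" "\<theta> < 1" "\<theta> * norm u = r" using False r by (auto simp: \<theta>_def divide_less_eq)
      obtain a b where ab: "z = (a, b)" by fastforce
      have "\<bar>a\<bar> \<le> R" using norm_fst_le[of a b] z(2) ab by simp
      have "L x' (\<theta> *\<^sub>R u) \<le> (1 - \<theta>) * L x' 0 + \<theta> * L x' u"
        using convex_onD[OF conv, of \<theta> 0 u x'] \<theta> by simp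
      moreover have "z \<bullet> (1, \<theta> *\<^sub>R u) - \<epsilon> \<le> L x' (\<theta> *\<^sub>R u)" using \<theta> r by (intro near) simp
      moreover have "(1 - \<theta>) * (L x' 0 - a) \<le> C"
      proof -
        have "L x' 0 - a \<le> C" using M[of x'] x'B \<open>\<bar>a\<bar> \<le> R\<close> by (simp add: C_def)
        then have "(1 - \<theta>) * (L x' 0 - a) \<le> (1 - \<theta>) * C" using \<theta> by (intro mult_left_mono) auto
        also have "\<dots> \<le> 1 * C" using \<theta> C by (intro mult_right_mono) auto
        finally show ?thesis by simp
      qed
      ultimately have "- (\<epsilon> + C) \<le> \<theta> * (L x' u - z \<bullet> (1, u))"
        by (simp add: ab algebra_simps)
      moreover have "\<epsilon> + C = \<theta> * (\<epsilon> * norm u)"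
        using \<theta>(3) \<epsilon> by (simp add: r_def field_simps)
      ultimately have "\<theta> * (- (\<epsilon> * norm u)) \<le> \<theta> * (L x' u - z \<bullet> (1, u))" by simp
      then have "- (\<epsilon> * norm u) \<le> L x' u - z \<bullet> (1, u)" using \<theta>(1) by (simp only: mult_le_cancel_left_pos)
      moreover have "\<epsilon> * norm u \<le> \<epsilon> * norm (1::real, u)" using n1(2) \<epsilon> by simp
      ultimately show ?thesis by simp
    qed
  qed
  then show ?thesis using \<rho>(1) by blast
qed

text \<open>For v > 0 the hypothesis at u = w/v is multiplied by v; the case v = 0 is the limit of
  this along \<eta> -> 0.\<close>

lemma ext_lagrangian_ge:
  assumes conv: "convex_on UNIV (L x)" and v: "0 \<le> v"
    and le: "\<And>u. z \<bullet> (1, u) - \<epsilon> * norm (1::real, u) \<le> L x u"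
  shows "ereal (z \<bullet> (v, w) - \<epsilon> * norm (v, w)) \<le> ext_lagrangian L x v w"
proof -
  have scale: "z \<bullet> (\<eta>, w) - \<epsilon> * norm (\<eta>, w) \<le> L x (w /\<^sub>R \<eta>) * \<eta>" if \<eta>: "0 < \<eta>" for \<eta>
  proof -
    have eq: "(\<eta>, w) = \<eta> *\<^sub>R (1, w /\<^sub>R \<eta>)" using \<eta> by simp
    have "z \<bullet> (\<eta>, w) - \<epsilon> * norm (\<eta>, w) = \<eta> * (z \<bullet> (1, w /\<^sub>R \<eta>) - \<epsilon> * norm (1::real, w /\<^sub>R \<eta>))"
      unfolding eq inner_scaleR_right norm_scaleR using \<eta> by (simp only: abs_of_pos) (simp add: algebra_simps)
    also have "\<dots> \<le> \<eta> * L x (w /\<^sub>R \<eta>)" using le \<eta> by (intro mult_left_mono) auto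
    finally show ?thesis by (simp add: mult.commute)
  qed
  show ?thesis
  proof (cases "v = 0")
    case False
    then show ?thesis using scale[of v] v by (simp add: ext_lagrangian_def)
  next
    case True
    have "((\<lambda>\<eta>. ereal (z \<bullet> (\<eta>, w) - \<epsilon> * norm (\<eta>, w))) \<longlongrightarrow> ereal (z \<bullet> (0, w) - \<epsilon> * norm (0::real, w))) (at_right 0)"
      by (intro tendsto_intros)
    moreover have "\<forall>\<^sub>F \<eta> in at_right 0. ereal (z \<bullet> (\<eta>, w) - \<epsilon> * norm (\<eta>, w)) \<le> ereal (L x (w /\<^sub>R \<eta>) * \<eta>)"
      using eventually_at_right_less[of 0] by eventually_elim (use scale in simp)
    ultimately show ?thesis unfolding True
      by (rule tendsto_le[OF trivial_limit_at_right_real ext_lagrangian_zero_tendsto(1)[where L=L and x=x, OF conv]])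
  qed
qed

section \<open>Stability of trajectories\<close>

text \<open>Linearity in the control reduces the claim to products of a continuous coefficient with
  an integrable coordinate.\<close>

lemma absolutely_integrable_linear_field:
  fixes \<Phi> :: "'b::euclidean_space \<Rightarrow> 'c::euclidean_space \<Rightarrow> 'd::euclidean_space" and q :: "real \<Rightarrow> 'b"
  assumes lin: "\<And>x. linear (\<Phi> x)" and cont: "\<And>\<zeta>. continuous_on UNIV (\<lambda>x. \<Phi> x \<zeta>)"
    and q: "continuous_on {a..b} q" and \<eta>: "\<eta> absolutely_integrable_on {a..b}"
  shows "(\<lambda>r. \<Phi> (q r) (\<eta> r)) absolutely_integrable_on {a..b}"
proof -
  have "(\<lambda>r. (\<eta> r \<bullet> i) *\<^sub>R \<Phi> (q r) i) absolutely_integrable_on {a..b}" for i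
  proof (rule absolutely_integrable_bounded_measurable_product[where h="\<lambda>x (u::real). u *\<^sub>R x"])
    have c: "continuous_on {a..b} (\<lambda>r. \<Phi> (q r) i)"
      using q by (intro continuous_on_compose2[OF cont]) auto
    show "bilinear (\<lambda>(x::'d) (u::real). u *\<^sub>R x)"
      unfolding bilinear_def by (auto intro!: linearI simp: scaleR_add_left scaleR_add_right)
    show "(\<lambda>r. \<Phi> (q r) i) \<in> borel_measurable (lebesgue_on {a..b})"
      using c by (intro continuous_imp_measurable_on_sets_lebesgue) auto
    show "bounded ((\<lambda>r. \<Phi> (q r) i) ` {a..b})"
      using c by (intro compact_imp_bounded compact_continuous_image) auto
    show "(\<lambda>r. \<eta> r \<bullet> i) absolutely_integrable_on {a..b}"
      using absolutely_integrable_linear[OF \<eta> bounded_linear_inner_left[of i]] by (simp add: o_def)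
  qed auto
  then have "(\<lambda>r. \<Sum>i\<in>Basis. (\<eta> r \<bullet> i) *\<^sub>R \<Phi> (q r) i) absolutely_integrable_on {a..b}"
    by (intro absolutely_integrable_sum) auto
  moreover have "\<Phi> (q r) (\<eta> r) = (\<Sum>i\<in>Basis. (\<eta> r \<bullet> i) *\<^sub>R \<Phi> (q r) i)" for r
  proof -
    have "\<Phi> (q r) (\<Sum>i\<in>Basis. (\<eta> r \<bullet> i) *\<^sub>R i) = (\<Sum>i\<in>Basis. (\<eta> r \<bullet> i) *\<^sub>R \<Phi> (q r) i)"
      by (simp add: linear_sum[OF lin] linear_scale[OF lin])
    then show ?thesis by (simp add: euclidean_representation)
  qed
  ultimately show ?thesis by simp
qed

text \<open>With A the bound for weight j/2, absorbing half of the maximum on a further piece turns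
  \<eta> + A j/2 into 2 \<eta> + A j. The factor j + 1 instead of j makes the sequence visibly
  increasing.\<close>

fun gronwall_const :: "nat \<Rightarrow> real" where
  "gronwall_const 0 = 1"
| "gronwall_const (Suc j) = 2 + (real j + 1) * gronwall_const j"

lemma gronwall_const_ge1: "1 \<le> gronwall_const j"
proof (induction j)
  case (Suc j)
  then have "0 \<le> (real j + 1) * gronwall_const j" by (intro mult_nonneg_nonneg) auto
  then show ?case by simp
qed simp

lemma gronwall_const_mono: "gronwall_const j \<le> gronwall_const (Suc j)"
proof -
  have "1 * gronwall_const j \<le> (real j + 1) * gronwall_const j"
    using gronwall_const_ge1[of j] by (intro mult_right_mono) auto
  then show ?thesis by simp
qed

lemma integral_weighted_bounds:
  fixes \<phi> m :: "real \<Rightarrow> real"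
  assumes c: "continuous_on {a..b} \<phi>" and m: "m absolutely_integrable_on {a..b}" and m0: "\<And>r. 0 \<le> m r"
    and X: "\<And>r. a \<le> r \<Longrightarrow> r \<le> b \<Longrightarrow> \<phi> r \<le> X"
  shows "(\<lambda>r. \<phi> r * m r) integrable_on {a..b}" "integral {a..b} (\<lambda>r. \<phi> r * m r) \<le> X * integral {a..b} m"
proof -
  have "(\<lambda>r. \<phi> r * m r) absolutely_integrable_on {a..b}"
    using c by (intro absolutely_integrable_bounded_measurable_product_real m continuous_imp_measurable_on_sets_lebesgue
       compact_imp_bounded compact_continuous_image) auto
  then show int: "(\<lambda>r. \<phi> r * m r) integrable_on {a..b}" by (rule set_lebesgue_integral_eq_integral(1))
  have mi: "m integrable_on {a..b}" using m by (rule set_lebesgue_integral_eq_integral(1))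
  have "integral {a..b} (\<lambda>r. \<phi> r * m r) \<le> integral {a..b} (\<lambda>r. X * m r)"
    by (rule integral_le[OF int integrable_on_mult_right[OF mi]]) (use X m0 in \<open>auto intro!: mult_right_mono\<close>)
  then show "integral {a..b} (\<lambda>r. \<phi> r * m r) \<le> X * integral {a..b} m" by simp
qed

text \<open>The induction runs along the level sets of the weight: on a piece where \<open>K * \<integral>m \<le> 1/2\<close> the maximum of \<open>\<phi>\<close>
  can be absorbed into the left-hand side.\<close>

lemma gronwall_level_sets:
  fixes \<phi> m :: "real \<Rightarrow> real"
  assumes c: "continuous_on {0..S} \<phi>" and m: "m absolutely_integrable_on {0..S}" and m0: "\<And>r. 0 \<le> m r"
    and K: "0 \<le> K" and \<eta>: "0 \<le> \<eta>"
    and ineq: "\<And>s. 0 \<le> s \<Longrightarrow> s \<le> S \<Longrightarrow> \<phi> s \<le> \<eta> + K * integral {0..s} (\<lambda>r. \<phi> r * m r)"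
  shows "0 \<le> s \<Longrightarrow> s \<le> S \<Longrightarrow> K * integral {0..s} m \<le> real j / 2 \<Longrightarrow> \<phi> s \<le> gronwall_const j * \<eta>"
proof (induction j arbitrary: s)
  case 0
  have mI: "m absolutely_integrable_on {0..s}" using 0 by (intro absolutely_integrable_on_subinterval[OF m]) auto
  have cs: "continuous_on {0..s} \<phi>" using 0 by (intro continuous_on_subset[OF c]) auto
  obtain x where "\<forall>y\<in>{0..s}. \<phi> y \<le> \<phi> x"
    using continuous_attains_sup[of "{0..s}" \<phi>] cs 0 by auto
  then have X: "\<phi> r \<le> \<phi> x" if "0 \<le> r" "r \<le> s" for r using that by simp
  \<comment> \<open>The maximum of \<phi> may be negative; its positive part makes the product with
    a nonpositive weight nonpositive.\<close>
  have "integral {0..s} (\<lambda>r. \<phi> r * m r) \<le> max 0 (\<phi> x) * integral {0..s} m"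
    using X by (intro integral_weighted_bounds(2)[OF cs mI m0]) (auto intro: max.coboundedI2)
  then have "K * integral {0..s} (\<lambda>r. \<phi> r * m r) \<le> max 0 (\<phi> x) * (K * integral {0..s} m)"
    using K by (metis mult_left_mono mult.left_commute)
  also have "\<dots> \<le> 0" using 0 mult_nonneg_nonpos[of "max 0 (\<phi> x)" "K * integral {0..s} m"] by simp
  finally show ?case using ineq[of s] 0 by simp
next
  case (Suc j)
  define A where "A = gronwall_const j * \<eta>"
  have A: "0 \<le> A" unfolding A_def using \<eta> gronwall_const_ge1[of j] by (intro mult_nonneg_nonneg) auto
  have cs: "continuous_on {0..s} \<phi>" using Suc.prems by (intro continuous_on_subset[OF c]) auto
  obtain r0 where r0: "0 \<le> r0" "r0 \<le> s" "\<And>r. 0 \<le> r \<Longrightarrow> r \<le> s \<Longrightarrow> \<phi> r \<le> \<phi> r0"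
    using continuous_attains_sup[of "{0..s}" \<phi>] cs Suc.prems by auto
  have mI: "m absolutely_integrable_on {a..b}" if "0 \<le> a" "b \<le> S" for a b
    using that by (intro absolutely_integrable_on_subinterval[OF m]) auto
  have mi: "m integrable_on {a..b}" if "0 \<le> a" "b \<le> S" for a b
    using mI[OF that] by (rule set_lebesgue_integral_eq_integral(1))
  have "\<phi> r0 \<le> gronwall_const (Suc j) * \<eta>"
  proof (cases "K * integral {0..r0} m \<le> real j / 2")
    case True
    then have "\<phi> r0 \<le> gronwall_const j * \<eta>" using Suc.IH r0 Suc.prems by auto
    also have "\<dots> \<le> gronwall_const (Suc j) * \<eta>" using gronwall_const_mono \<eta> by (intro mult_right_mono) auto
    finally show ?thesis .
  next
    case False
    have "continuous_on {0..r0} (\<lambda>s. K * integral {0..s} m)"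
      using r0 Suc.prems by (intro continuous_intros indefinite_integral_continuous_1 mi) auto
    then obtain s1 where s1: "0 \<le> s1" "s1 \<le> r0" "K * integral {0..s1} m = real j / 2"
      using IVT'[of "\<lambda>s. K * integral {0..s} m" 0 "real j / 2" r0] False r0 by auto
    have c1: "continuous_on {0..s1} \<phi>" "continuous_on {s1..r0} \<phi>" "continuous_on {0..r0} \<phi>"
      using s1 r0 Suc.prems by (auto intro!: continuous_on_subset[OF c])
    have small: "\<phi> r \<le> A" if "0 \<le> r" "r \<le> s1" for r
    proof -
      have "integral {0..r} m \<le> integral {0..s1} m"
        using that s1 r0 Suc.prems m0 by (intro integral_subset_le mi) auto
      then have "K * integral {0..r} m \<le> real j / 2" using K s1(3) by (metis mult_left_mono)
      then show ?thesis unfolding A_def using that s1 r0 Suc.prems by (intro Suc.IH) auto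
    qed
    have int: "(\<lambda>r. \<phi> r * m r) integrable_on {0..r0}"
      using r0 Suc.prems s1 by (intro integral_weighted_bounds(1)[OF c1(3) mI m0, where X="\<phi> r0"]) auto
    have split: "integral {0..r0} (\<lambda>r. \<phi> r * m r) = integral {0..s1} (\<lambda>r. \<phi> r * m r) + integral {s1..r0} (\<lambda>r. \<phi> r * m r)"
      "integral {0..r0} m = integral {0..s1} m + integral {s1..r0} m"
      using Henstock_Kurzweil_Integration.integral_combine[OF s1(1,2) int]
        Henstock_Kurzweil_Integration.integral_combine[OF s1(1,2) mi[of 0 r0]] r0 Suc.prems by auto
    have "integral {0..s1} (\<lambda>r. \<phi> r * m r) \<le> A * integral {0..s1} m"
      using s1 r0 Suc.prems by (intro integral_weighted_bounds(2)[OF c1(1) mI m0 small]) auto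
    moreover have "integral {s1..r0} (\<lambda>r. \<phi> r * m r) \<le> \<phi> r0 * integral {s1..r0} m"
      using s1 r0 Suc.prems by (intro integral_weighted_bounds(2)[OF c1(2) mI m0 r0(3)]) auto
    ultimately have le: "integral {0..r0} (\<lambda>r. \<phi> r * m r) \<le> A * integral {0..s1} m + \<phi> r0 * integral {s1..r0} m"
      unfolding split by linarith
    have "K * integral {0..r0} m \<le> K * integral {0..s} m"
      using r0 Suc.prems m0 K by (intro mult_left_mono integral_subset_le mi) auto
    then have half: "K * integral {s1..r0} m \<le> 1/2"
      using Suc.prems(3) s1(3) unfolding split(2) by (simp add: field_simps)
    show ?thesis
    proof (cases "0 \<le> \<phi> r0")
      case True
      have "\<phi> r0 \<le> \<eta> + K * (A * integral {0..s1} m + \<phi> r0 * integral {s1..r0} m)"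
        using ineq[of r0] r0 Suc.prems mult_left_mono[OF le K] by auto
      also have "\<dots> = \<eta> + A * (K * integral {0..s1} m) + \<phi> r0 * (K * integral {s1..r0} m)" by (simp add: algebra_simps)
      also have "\<dots> \<le> \<eta> + A * (real j / 2) + \<phi> r0 * (1/2)"
        unfolding s1(3) using half True A by (intro add_mono mult_left_mono) auto
      finally have "\<phi> r0 \<le> 2 * \<eta> + A * real j" by (simp add: field_simps)
      also have "\<dots> \<le> gronwall_const (Suc j) * \<eta>" using A by (simp add: A_def algebra_simps)
      finally show ?thesis .
    next
      case False
      have "0 \<le> gronwall_const (Suc j) * \<eta>" using \<eta> gronwall_const_ge1[of "Suc j"] by (intro mult_nonneg_nonneg) auto
      then show ?thesis using False by linarith
    qed
  qed
  then show ?case using r0(3)[of s] Suc.prems by linarith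
qed

text \<open>The integral inequality is available only while \<phi> stays below 1, which is where a
  Lipschitz constant is known. At the first time with \<phi> = 1 the Gronwall bound would still
  apply and give a value below 1.\<close>

lemma gronwall_bootstrap:
  fixes \<phi> m :: "real \<Rightarrow> real"
  assumes c: "continuous_on {0..S} \<phi>" and m: "m absolutely_integrable_on {0..S}" and m0: "\<And>r. 0 \<le> m r"
    and K: "0 \<le> K" and \<eta>: "0 \<le> \<eta>" and S: "0 \<le> S" and \<phi>0: "\<phi> 0 = 0"
    and ineq: "\<And>s. 0 \<le> s \<Longrightarrow> s \<le> S \<Longrightarrow> (\<And>r. 0 \<le> r \<Longrightarrow> r \<le> s \<Longrightarrow> \<phi> r \<le> 1) \<Longrightarrow>
        \<phi> s \<le> \<eta> + K * integral {0..s} (\<lambda>r. \<phi> r * m r)"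
    and j: "K * integral {0..S} m \<le> real j / 2" and small: "gronwall_const j * \<eta> < 1"
  shows "\<phi> S \<le> gronwall_const j * \<eta>"
proof -
  have part: "\<phi> s \<le> gronwall_const j * \<eta>" if s: "0 \<le> s" "s \<le> S" and le1: "\<And>r. 0 \<le> r \<Longrightarrow> r \<le> s \<Longrightarrow> \<phi> r \<le> 1" for s
  proof (rule gronwall_level_sets[of s \<phi> m K \<eta> s j])
    show "continuous_on {0..s} \<phi>" using s by (intro continuous_on_subset[OF c]) auto
    show ms: "m absolutely_integrable_on {0..s}" using s by (intro absolutely_integrable_on_subinterval[OF m]) auto
    have "integral {0..s} m \<le> integral {0..S} m"
      using s m0 m ms by (intro integral_subset_le) (auto simp: set_lebesgue_integral_eq_integral(1))
    then show "K * integral {0..s} m \<le> real j / 2" using K j by (meson mult_left_mono order_trans)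
    fix r assume "0 \<le> r" "r \<le> s"
    then show "\<phi> r \<le> \<eta> + K * integral {0..r} (\<lambda>r. \<phi> r * m r)" using s le1 by (intro ineq) auto
  qed (use m0 K \<eta> s in auto)
  have "\<phi> s \<le> 1" if s: "0 \<le> s" "s \<le> S" for s
  proof (rule ccontr)
    assume gt: "\<not> \<phi> s \<le> 1"
    define B where "B = {0..S} \<inter> \<phi> -` {1}"
    have B: "closed B" unfolding B_def by (rule continuous_closed_preimage[OF c]) auto
    have cross: "\<exists>r'\<in>B. r' \<le> r" if r: "0 \<le> r" "r \<le> S" "1 < \<phi> r" for r
    proof -
      have "\<exists>x\<ge>0. x \<le> r \<and> \<phi> x = 1"
        using r \<phi>0 by (intro IVT' continuous_on_subset[OF c]) auto
      then show ?thesis using r by (auto simp: B_def)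
    qed
    have ne: "B \<noteq> {}" using cross[of s] gt s by auto
    have bdd: "bdd_below B" by (auto simp: B_def bdd_below_def)
    define s1 where "s1 = Inf B"
    have s1: "s1 \<in> B" unfolding s1_def by (rule closed_contains_Inf[OF ne bdd B])
    have "\<phi> r \<le> 1" if r: "0 \<le> r" "r \<le> s1" for r
    proof (rule ccontr)
      assume "\<not> \<phi> r \<le> 1"
      then obtain r' where r': "r' \<in> B" "r' \<le> r" using cross[of r] r s1 by (auto simp: B_def)
      have "s1 \<le> r'" unfolding s1_def by (rule cInf_lower[OF r'(1) bdd])
      then have "r = s1" using r' r by simp
      then show False using s1 \<open>\<not> \<phi> r \<le> 1\<close> by (simp add: B_def)
    qed
    then have "\<phi> s1 \<le> gronwall_const j * \<eta>" using s1 by (intro part) (auto simp: B_def)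
    then show False using s1 small by (simp add: B_def)
  qed
  then show ?thesis using part S by simp
qed

lemma norm_integral_le_weighted:
  fixes h :: "real \<Rightarrow> 'd::euclidean_space" and \<eta> :: "real \<Rightarrow> 'c::euclidean_space"
  assumes int: "(\<lambda>r. h r) integrable_on {a..b}" and \<eta>: "\<eta> absolutely_integrable_on {a..b}"
    and le: "\<And>r. a \<le> r \<Longrightarrow> r \<le> b \<Longrightarrow> norm (h r) \<le> c * norm (\<eta> r)"
  shows "norm (integral {a..b} h) \<le> c * integral {a..b} (\<lambda>r. norm (\<eta> r))"
proof -
  have ni: "(\<lambda>r. norm (\<eta> r)) integrable_on {a..b}"
    using absolutely_integrable_norm[OF \<eta>] by (simp add: set_lebesgue_integral_eq_integral(1) o_def)
  have "norm (integral {a..b} h) \<le> integral {a..b} (\<lambda>r. c * norm (\<eta> r))"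
    by (rule integral_norm_bound_integral[OF int integrable_on_mult_right[OF ni]]) (use le in auto)
  then show ?thesis by simp
qed

section \<open>Dependence of trajectories on the primitives of their controls\<close>

context
  fixes \<Phi> :: "'b::euclidean_space \<Rightarrow> 'c::euclidean_space \<Rightarrow> 'b"
  assumes lin: "\<And>x. linear (\<Phi> x)"
    and lip: "\<And>B. \<exists>K. \<forall>x\<in>cball 0 B. \<forall>x'\<in>cball 0 B. \<forall>\<zeta>. norm (\<Phi> x \<zeta> - \<Phi> x' \<zeta>) \<le> K * norm (x - x') * norm \<zeta>"
begin

lemma linear_field_Lipschitz:
  obtains K where "0 \<le> K"
    "\<And>x x' \<zeta>. norm x \<le> B \<Longrightarrow> norm x' \<le> B \<Longrightarrow> norm (\<Phi> x \<zeta> - \<Phi> x' \<zeta>) \<le> K * norm (x - x') * norm \<zeta>"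
proof -
  obtain K where K: "\<forall>x\<in>cball 0 B. \<forall>x'\<in>cball 0 B. \<forall>\<zeta>. norm (\<Phi> x \<zeta> - \<Phi> x' \<zeta>) \<le> K * norm (x - x') * norm \<zeta>"
    using lip[of B] by blast
  show ?thesis
  proof (rule that[of "max 0 K"])
    fix x x' :: 'b and \<zeta> :: 'c assume x: "norm x \<le> B" "norm x' \<le> B"
    have "norm (\<Phi> x \<zeta> - \<Phi> x' \<zeta>) \<le> K * norm (x - x') * norm \<zeta>" using K x by simp
    also have "\<dots> \<le> max 0 K * norm (x - x') * norm \<zeta>" by (intro mult_right_mono) auto
    finally show "norm (\<Phi> x \<zeta> - \<Phi> x' \<zeta>) \<le> max 0 K * norm (x - x') * norm \<zeta>" .
  qed simp
qed

lemma linear_field_continuous: "continuous_on UNIV (\<lambda>x. \<Phi> x \<zeta>)"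
proof -
  have "isCont (\<lambda>x. \<Phi> x \<zeta>) x" for x
  proof -
    obtain K where K: "0 \<le> K" "\<And>z z' \<zeta>. norm z \<le> norm x + 1 \<Longrightarrow> norm z' \<le> norm x + 1 \<Longrightarrow>
        norm (\<Phi> z \<zeta> - \<Phi> z' \<zeta>) \<le> K * norm (z - z') * norm \<zeta>" using linear_field_Lipschitz[of "norm x + 1"] by metis
    have "\<forall>\<^sub>F z in at x. norm (\<Phi> z \<zeta> - \<Phi> x \<zeta>) \<le> K * norm (z - x) * norm \<zeta>"
      unfolding eventually_at
    proof (intro exI[of _ 1] conjI ballI impI)
      fix z assume "z \<noteq> x \<and> dist z x < 1"
      then have "norm z \<le> norm x + 1" using norm_triangle_sub[of z x] by (simp add: dist_norm)
      then show "norm (\<Phi> z \<zeta> - \<Phi> x \<zeta>) \<le> K * norm (z - x) * norm \<zeta>" by (intro K(2)) auto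
    qed simp
    moreover have "((\<lambda>z. K * norm (z - x) * norm \<zeta>) \<longlongrightarrow> K * norm (x - x) * norm \<zeta>) (at x)"
      by (intro tendsto_intros)
    then have "((\<lambda>z. K * norm (z - x) * norm \<zeta>) \<longlongrightarrow> 0) (at x)" by simp
    ultimately have "((\<lambda>z. \<Phi> z \<zeta> - \<Phi> x \<zeta>) \<longlongrightarrow> 0) (at x)" by (rule Lim_null_comparison)
    then show ?thesis unfolding isCont_def by (rule LIM_zero_cancel)
  qed
  then show ?thesis by (simp add: continuous_at_imp_continuous_on)
qed

text \<open>Only the primitives of the controls are close. On a piece where \<open>y\<close> hardly
  moves, the field is nearly a fixed linear map of the control, so its integral depends on the
  primitive alone. Finitely many pieces, fixed by \<open>y\<close>, control the error of exchanging
  the controls along \<open>y\<close>; Gronwall's lemma then handles the difference of the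
  states.\<close>

lemma trajectory_stability:
  fixes \<xi> :: "real \<Rightarrow> 'c" and y :: "real \<Rightarrow> 'b"
  assumes \<xi>: "\<And>t. 0 \<le> t \<Longrightarrow> \<xi> absolutely_integrable_on {0..t}" "\<And>t. 0 \<le> t \<Longrightarrow> integral {0..t} (\<lambda>r. norm (\<xi> r)) \<le> \<Lambda>"
    and y: "continuous_on {0..} y" "\<And>t. 0 \<le> t \<Longrightarrow> y t = x0 + integral {0..t} (\<lambda>r. \<Phi> (y r) (\<xi> r))"
    and e: "0 \<le> e" "\<And>t. e \<le> t \<Longrightarrow> y t = y e" and \<epsilon>: "0 < \<epsilon>"
  shows "\<exists>\<delta>>0. \<forall>\<alpha> \<beta> \<eta> z. reparam \<alpha> \<beta> \<longrightarrow>
    (\<forall>t\<ge>0. \<eta> absolutely_integrable_on {0..t} \<and> integral {0..t} (\<lambda>r. norm (\<eta> r)) \<le> \<Lambda>) \<longrightarrow>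
    continuous_on {0..} z \<longrightarrow> (\<forall>t\<ge>0. z t = x0 + integral {0..t} (\<lambda>r. \<Phi> (z r) (\<eta> r))) \<longrightarrow>
    (\<forall>t\<ge>0. norm (integral {0..t} \<xi> - integral {0..\<alpha> t} \<eta>) \<le> \<delta>) \<longrightarrow>
    (\<forall>t\<ge>0. norm (y t - z (\<alpha> t)) \<le> \<epsilon>)"
proof -
  have cy: "continuous_on {0..e} y" using y(1) by (rule continuous_on_subset) auto
  obtain B where "\<forall>x\<in>y ` {0..e}. norm x \<le> B"
    using compact_imp_bounded[OF compact_continuous_image[OF cy compact_Icc]] unfolding bounded_iff ..
  then have B0: "norm (y t) \<le> B" if "t \<in> {0..e}" for t using that by blast
  have B: "norm (y t) \<le> B" if "0 \<le> t" for t
  proof (cases "t \<le> e")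
    case True
    then show ?thesis using B0[of t] that by simp
  next
    case False
    then show ?thesis using B0[of e] e(1) e(2)[of t] by simp
  qed
  have B_nn: "0 \<le> B" using B[of 0] norm_ge_zero[of "y 0"] by linarith
  \<comment> \<open>The radius B + 1 leaves room for the perturbed trajectory as long as it is
    within distance 1 of \<open>y\<close>.\<close>
  obtain K where K: "0 \<le> K" "\<And>x x' \<zeta>. norm x \<le> B + 1 \<Longrightarrow> norm x' \<le> B + 1 \<Longrightarrow>
      norm (\<Phi> x \<zeta> - \<Phi> x' \<zeta>) \<le> K * norm (x - x') * norm \<zeta>" using linear_field_Lipschitz[of "B + 1"] by metis
  obtain M0 where M0: "\<And>\<zeta>. norm (\<Phi> 0 \<zeta>) \<le> M0 * norm \<zeta>" "0 < M0"
    using linear_bounded_pos[OF lin[of 0]] by blast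
  define M where "M = M0 + K * B"
  have M: "norm (\<Phi> x \<zeta>) \<le> M * norm \<zeta>" if "norm x \<le> B" for x \<zeta>
  proof -
    have "norm (\<Phi> x \<zeta> - \<Phi> 0 \<zeta>) \<le> K * norm (x - 0) * norm \<zeta>" using that B_nn by (intro K(2)) auto
    also have "\<dots> \<le> K * B * norm \<zeta>" using that K(1) by (intro mult_right_mono mult_left_mono) auto
    finally show ?thesis using M0(1)[of \<zeta>] norm_triangle_sub[of "\<Phi> x \<zeta>" "\<Phi> 0 \<zeta>"]
      unfolding M_def distrib_right by linarith
  qed
  have Mpos: "0 < M" using M0(2) K(1) B_nn by (simp add: M_def add_pos_nonneg)
  have \<Lambda>0: "0 \<le> \<Lambda>" using \<xi>(2)[of 0] by simp
  \<comment> \<open>The number of portions of weight 1/2 into which Gronwall's lemma divides the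
    total weight, at most K \<Lambda>.\<close>
  obtain j :: nat where j: "2 * K * \<Lambda> \<le> real j" using real_arch_simple by blast
  define A where "A = gronwall_const j"
  have A1: "1 \<le> A" unfolding A_def by (rule gronwall_const_ge1)
  define \<eta>0 where "\<eta>0 = min \<epsilon> (1/2) / A"
  have \<eta>0: "0 < \<eta>0" "A * \<eta>0 \<le> \<epsilon>" "A * \<eta>0 < 1" using \<epsilon> A1 by (auto simp: \<eta>0_def)
  \<comment> \<open>The oscillation errors add up to at most om times the sum of both lengths, 2
    \<Lambda>; this is to cost half of \<open>\<eta>0\<close>.\<close>
  define om where "om = \<eta>0 / (4 * (\<Lambda> + 1))"
  have om: "0 < om" using \<eta>0 \<Lambda>0 by (simp add: om_def)
  have om2: "om * (2 * \<Lambda>) \<le> \<eta>0 / 2"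
  proof -
    have "om * (2 * \<Lambda>) \<le> om * (2 * (\<Lambda> + 1))" using om by (intro mult_left_mono) auto
    also have "\<dots> = \<eta>0 / 2" using \<Lambda>0 by (simp add: om_def divide_simps)
    finally show ?thesis .
  qed
  obtain h where h: "0 < h" "\<And>s t. 0 \<le> s \<Longrightarrow> s \<le> t \<Longrightarrow> t \<le> s + h \<Longrightarrow> K * norm (y t - y s) \<le> om"
  proof -
    have "uniformly_continuous_on {0..e} y" using cy by (rule compact_uniformly_continuous) simp
    moreover have "0 < om / (K + 1)" using om K(1) by simp
    ultimately obtain d where d: "0 < d" "\<And>s t. s \<in> {0..e} \<Longrightarrow> t \<in> {0..e} \<Longrightarrow> dist t s < d \<Longrightarrow> dist (y t) (y s) < om / (K + 1)"
      unfolding uniformly_continuous_on_def by metis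
    show ?thesis
    proof (rule that[of "d/2"])
      fix s t assume st: "0 \<le> s" "s \<le> t" "t \<le> s + d/2"
      have "y s = y (min s e)" "y t = y (min t e)" using e(2)[of s] e(2)[of t] by (auto simp: min_def)
      moreover have "dist (y (min t e)) (y (min s e)) < om / (K + 1)"
        using st e d(1) by (intro d(2)) (auto simp: dist_real_def min_def)
      ultimately have "norm (y t - y s) \<le> om / (K + 1)" by (simp add: dist_norm)
      then have "K * norm (y t - y s) \<le> (K + 1) * (om / (K + 1))" using K(1) by (intro mult_mono) auto
      then show "K * norm (y t - y s) \<le> om" using K(1) by simp
    qed (use d in simp)
  qed
  obtain m :: nat where m: "e / h \<le> real m" using real_arch_simple by blast
  then have mh: "e \<le> real m * h" using h(1) by (simp add: divide_le_eq)
  \<comment> \<open>Each of the \<open>m\<close> grid steps up to \<open>e\<close>, and one more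
    step beyond it, costs 2 M \<delta>; together they may cost the other half of
    \<open>\<eta>0\<close>.\<close>
  define \<delta> where "\<delta> = \<eta>0 / (4 * M * (real m + 1))"
  have \<delta>: "0 < \<delta>" "(real m + 1) * (2 * M * \<delta>) = \<eta>0 / 2"
    using \<eta>0 Mpos by (auto simp: \<delta>_def divide_simps)
  have key: "norm (y t0 - z (\<alpha> t0)) \<le> \<epsilon>"
    if r: "reparam \<alpha> \<beta>" and \<eta>: "\<And>t. 0 \<le> t \<Longrightarrow> \<eta> absolutely_integrable_on {0..t}"
      "\<And>t. 0 \<le> t \<Longrightarrow> integral {0..t} (\<lambda>r. norm (\<eta> r)) \<le> \<Lambda>"
      and z: "continuous_on {0..} z" "\<And>t. 0 \<le> t \<Longrightarrow> z t = x0 + integral {0..t} (\<lambda>r. \<Phi> (z r) (\<eta> r))"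
      and close: "\<And>t. 0 \<le> t \<Longrightarrow> norm (integral {0..t} \<xi> - integral {0..\<alpha> t} \<eta>) \<le> \<delta>" and t0: "0 \<le> t0"
    for \<alpha> \<beta> \<eta> z t0
  proof -
    note rD = reparamD[OF r]
    have cb: "continuous_on {0..} (\<lambda>r. y (\<beta> r))"
      using r rD by (intro continuous_on_compose2[OF y(1)]) (auto simp: reparam_def)
    have \<eta>s: "\<eta> absolutely_integrable_on {a..b}" and \<xi>s: "\<xi> absolutely_integrable_on {a..b}" if "0 \<le> a" "0 \<le> b" for a b
      using that by (auto intro: absolutely_integrable_on_subinterval[OF \<eta>(1)[of b]] absolutely_integrable_on_subinterval[OF \<xi>(1)[of b]])
    have lini: "(\<lambda>r. \<Phi> (q r) (\<zeta> r)) integrable_on {a..b}"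
      if "continuous_on {a..b} q" "\<zeta> absolutely_integrable_on {a..b}" for a b q and \<zeta> :: "real \<Rightarrow> 'c"
      using absolutely_integrable_linear_field[OF lin linear_field_continuous that] by (rule set_lebesgue_integral_eq_integral(1))
    have nint: "(\<lambda>r. norm (\<zeta> r)) integrable_on {a..b}" if "\<zeta> absolutely_integrable_on {a..b}" for a b and \<zeta> :: "real \<Rightarrow> 'c"
      using absolutely_integrable_norm[OF that] by (simp add: set_lebesgue_integral_eq_integral(1) o_def)
    \<comment> \<open>The effect of exchanging the control while the state is kept on
      \<open>y\<close>, transported by \<beta>.\<close>
    define D where "D = (\<lambda>t. integral {0..\<alpha> t} (\<lambda>r. \<Phi> (y (\<beta> r)) (\<eta> r)) - integral {0..t} (\<lambda>r. \<Phi> (y r) (\<xi> r)))"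
    define N where "N = (\<lambda>t. integral {0..\<alpha> t} (\<lambda>r. norm (\<eta> r)) + integral {0..t} (\<lambda>r. norm (\<xi> r)))"
    have step: "norm (D t) \<le> norm (D s) + om * (N t - N s) + 2 * M * \<delta>"
      if st: "0 \<le> s" "s \<le> t" and osc: "\<And>r. s \<le> r \<Longrightarrow> r \<le> t \<Longrightarrow> K * norm (y r - y s) \<le> om" for s t
    proof -
      have a: "0 \<le> \<alpha> s" "\<alpha> s \<le> \<alpha> t" using rD(1)[OF st(1)] reparam_mono[OF r st] by auto
      have t: "0 \<le> t" using st by simp
      have cy': "continuous_on {a..b} y" "continuous_on {a..b} (\<lambda>r. y (\<beta> r))" if "0 \<le> a" for a b
        using that by (auto intro!: continuous_on_subset[OF y(1)] continuous_on_subset[OF cb])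
      have i1: "(\<lambda>r. \<Phi> (y (\<beta> r)) (\<eta> r)) integrable_on {a..b}" "(\<lambda>r. \<Phi> (y r) (\<xi> r)) integrable_on {a..b}"
        "(\<lambda>r. \<Phi> (y s) (\<eta> r)) integrable_on {a..b}" "(\<lambda>r. \<Phi> (y s) (\<xi> r)) integrable_on {a..b}"
        if "0 \<le> a" "0 \<le> b" for a b
        using that \<eta>s[OF that] \<xi>s[OF that] cy' by (auto intro!: lini)
      have i2: "\<eta> integrable_on {a..b}" "\<xi> integrable_on {a..b}" if "0 \<le> a" "0 \<le> b" for a b
        using \<eta>s[OF that] \<xi>s[OF that] by (auto intro: set_lebesgue_integral_eq_integral(1))
      have comb: "integral {0..\<alpha> t} h' = integral {0..\<alpha> s} h' + integral {\<alpha> s..\<alpha> t} h'" if "h' integrable_on {0..\<alpha> t}" for h' :: "real \<Rightarrow> 'e::euclidean_space"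
        using Henstock_Kurzweil_Integration.integral_combine[OF a that] by simp
      have comb': "integral {0..t} h' = integral {0..s} h' + integral {s..t} h'" if "h' integrable_on {0..t}" for h' :: "real \<Rightarrow> 'e::euclidean_space"
        using Henstock_Kurzweil_Integration.integral_combine[OF st that] by simp
      have at: "0 \<le> \<alpha> t" using a by simp
      have lI: "integral {a..b} (\<lambda>r. \<Phi> (y s) (\<zeta> r)) = \<Phi> (y s) (integral {a..b} \<zeta>)" if "\<zeta> integrable_on {a..b}" for a b \<zeta>
        using integral_linear[OF that linear_conv_bounded_linear[THEN iffD1, OF lin[of "y s"]]] by (simp add: o_def)
      define I1 where "I1 = integral {\<alpha> s..\<alpha> t} (\<lambda>r. \<Phi> (y (\<beta> r)) (\<eta> r) - \<Phi> (y s) (\<eta> r))"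
      define I2 where "I2 = integral {s..t} (\<lambda>r. \<Phi> (y r) (\<xi> r) - \<Phi> (y s) (\<xi> r))"
      define J where "J = integral {\<alpha> s..\<alpha> t} \<eta> - integral {s..t} \<xi>"
      have I1: "I1 = integral {\<alpha> s..\<alpha> t} (\<lambda>r. \<Phi> (y (\<beta> r)) (\<eta> r)) - \<Phi> (y s) (integral {\<alpha> s..\<alpha> t} \<eta>)"
        unfolding I1_def using i1[OF a(1) at] i2[OF a(1) at] by (simp add: Henstock_Kurzweil_Integration.integral_diff lI)
      have I2: "I2 = integral {s..t} (\<lambda>r. \<Phi> (y r) (\<xi> r)) - \<Phi> (y s) (integral {s..t} \<xi>)"
        unfolding I2_def using i1[OF st(1) t] i2[OF st(1) t] by (simp add: Henstock_Kurzweil_Integration.integral_diff lI)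
      \<comment> \<open>With the state frozen at \<open>y s\<close>, linearity turns the difference
        of the two integrals into the field applied to the difference \<open>J\<close> of the
        increments of the primitives.\<close>
      have Dts: "D t - D s = I1 - I2 + \<Phi> (y s) J"
        unfolding D_def I1 I2 J_def linear_diff[OF lin]
        using comb[OF i1(1)[OF order_refl at]] comb'[OF i1(2)[OF order_refl t]] by (simp add: algebra_simps)
      have near: "norm (\<Phi> (y r') \<zeta> - \<Phi> (y s) \<zeta>) \<le> om * norm \<zeta>" if "s \<le> r'" "r' \<le> t" for r' \<zeta>
      proof -
        have "norm (y r') \<le> B + 1" "norm (y s) \<le> B + 1" using B[of r'] B[of s] that st by auto
        then have "norm (\<Phi> (y r') \<zeta> - \<Phi> (y s) \<zeta>) \<le> K * norm (y r' - y s) * norm \<zeta>" by (rule K(2))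
        also have "\<dots> \<le> om * norm \<zeta>" using osc[OF that] by (intro mult_right_mono) auto
        finally show ?thesis .
      qed
      have b1: "norm I1 \<le> om * integral {\<alpha> s..\<alpha> t} (\<lambda>r. norm (\<eta> r))"
        unfolding I1_def
      proof (rule norm_integral_le_weighted)
        show "(\<lambda>r. \<Phi> (y (\<beta> r)) (\<eta> r) - \<Phi> (y s) (\<eta> r)) integrable_on {\<alpha> s..\<alpha> t}"
          using i1[OF a(1) at] by (intro Henstock_Kurzweil_Integration.integrable_diff) auto
        show "\<eta> absolutely_integrable_on {\<alpha> s..\<alpha> t}" by (rule \<eta>s[OF a(1) at])
        fix r' assume r': "\<alpha> s \<le> r'" "r' \<le> \<alpha> t"
        have "s \<le> \<beta> r'" "\<beta> r' \<le> t"
          using reparam_le_iff[OF r st(1), of r'] reparam_mono[OF reparam_sym[OF r], of r' "\<alpha> t"] rD(4)[OF t] r' a by auto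
        then show "norm (\<Phi> (y (\<beta> r')) (\<eta> r') - \<Phi> (y s) (\<eta> r')) \<le> om * norm (\<eta> r')" by (rule near)
      qed
      have b2: "norm I2 \<le> om * integral {s..t} (\<lambda>r. norm (\<xi> r))"
        unfolding I2_def
      proof (rule norm_integral_le_weighted)
        show "(\<lambda>r. \<Phi> (y r) (\<xi> r) - \<Phi> (y s) (\<xi> r)) integrable_on {s..t}"
          using i1[OF st(1) t] by (intro Henstock_Kurzweil_Integration.integrable_diff) auto
        show "\<xi> absolutely_integrable_on {s..t}" by (rule \<xi>s[OF st(1) t])
      qed (rule near)
      have "J = (integral {0..s} \<xi> - integral {0..\<alpha> s} \<eta>) - (integral {0..t} \<xi> - integral {0..\<alpha> t} \<eta>)"
        unfolding J_def using comb[OF i2(1)[OF order_refl at]] comb'[OF i2(2)[OF order_refl t]] by (simp add: algebra_simps)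
      then have "norm J \<le> \<delta> + \<delta>" using norm_triangle_ineq4 close[OF st(1)] close[OF t] by (metis add_mono order_trans)
      then have "M * norm J \<le> M * (2 * \<delta>)" using Mpos by (intro mult_left_mono) auto
      then have "norm (\<Phi> (y s) J) \<le> M * (2 * \<delta>)" using M[OF B[OF st(1)], of J] by linarith
      moreover have "N t - N s = integral {\<alpha> s..\<alpha> t} (\<lambda>r. norm (\<eta> r)) + integral {s..t} (\<lambda>r. norm (\<xi> r))"
        unfolding N_def using comb[OF nint[OF \<eta>s[OF order_refl at]]] comb'[OF nint[OF \<xi>s[OF order_refl t]]] by simp
      moreover have "norm (D t) \<le> norm (D s) + (norm I1 + norm I2 + norm (\<Phi> (y s) J))"
      proof -
        have "D t = D s + ((I1 - I2) + \<Phi> (y s) J)" using Dts by (simp add: algebra_simps)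
        then show ?thesis
          using norm_triangle_ineq[of "D s" "(I1 - I2) + \<Phi> (y s) J"] norm_triangle_ineq[of "I1 - I2" "\<Phi> (y s) J"]
            norm_triangle_ineq4[of I1 I2] by simp
      qed
      ultimately show ?thesis using b1 b2 by (simp add: distrib_left)
    qed
    have D0: "D 0 = 0" "N 0 = 0" unfolding D_def N_def by (simp_all add: reparam_zero[OF r])
    have grid: "norm (D t) \<le> om * N t + real i * (2 * M * \<delta>)" if "0 \<le> t" "t \<le> real i * h" for t i
      using that
    proof (induction i arbitrary: t)
      case 0
      then show ?case using D0 by simp
    next
      case (Suc i)
      define s where "s = max 0 (t - h)"
      have s: "0 \<le> s" "s \<le> t" "s \<le> real i * h" "t \<le> s + h" using Suc.prems h(1) by (auto simp: s_def algebra_simps)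
      have "norm (D t) \<le> norm (D s) + om * (N t - N s) + 2 * M * \<delta>"
        by (rule step[OF s(1,2)]) (use h(2) s in auto)
      moreover have "norm (D s) \<le> om * N s + real i * (2 * M * \<delta>)" by (rule Suc.IH[OF s(1,3)])
      ultimately show ?case by (simp add: algebra_simps)
    qed
    have Dle: "norm (D t) \<le> \<eta>0" if t: "0 \<le> t" for t
    proof -
      have "norm (D t) \<le> om * N t + (real m + 1) * (2 * M * \<delta>)"
      proof (cases "t \<le> e")
        case True
        have "norm (D t) \<le> om * N t + real m * (2 * M * \<delta>)" using True mh by (intro grid t) auto
        moreover have "0 \<le> 2 * M * \<delta>" using Mpos \<delta>(1) by simp
        ultimately show ?thesis by (simp add: distrib_right)
      next
        case False
        \<comment> \<open>After \<open>e\<close> the trajectory \<open>y\<close> rests, so one step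
          of any length suffices.\<close>
        have "norm (D t) \<le> norm (D e) + om * (N t - N e) + 2 * M * \<delta>"
        proof (rule step[OF e(1)])
          show "e \<le> t" using False by simp
          fix r' assume "e \<le> r'"
          then have "y r' = y e" by (rule e(2))
          then show "K * norm (y r' - y e) \<le> om" using om by simp
        qed
        moreover have "norm (D e) \<le> om * N e + real m * (2 * M * \<delta>)" using e(1) mh by (intro grid) auto
        ultimately show ?thesis by (simp add: algebra_simps)
      qed
      moreover have "N t \<le> 2 * \<Lambda>" unfolding N_def using \<xi>(2)[OF t] \<eta>(2)[OF rD(1)[OF t]] by simp
      then have "om * N t \<le> om * (2 * \<Lambda>)" using om by (intro mult_left_mono) auto
      then have "om * N t \<le> \<eta>0 / 2" using om2 by linarith
      ultimately show ?thesis using \<delta>(2) by simp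
    qed
    define S where "S = \<alpha> t0"
    have S: "0 \<le> S" unfolding S_def by (rule rD(1)[OF t0])
    define \<phi> where "\<phi> = (\<lambda>s. norm (z s - y (\<beta> s)))"
    have y0: "y 0 = x0" "z 0 = x0" using y(2)[of 0] z(2)[of 0] by auto
    have "\<phi> S \<le> gronwall_const j * \<eta>0"
    proof (rule gronwall_bootstrap[of S \<phi> "\<lambda>r. norm (\<eta> r)" K])
      show "continuous_on {0..S} \<phi>" unfolding \<phi>_def
        by (intro continuous_intros continuous_on_subset[OF z(1)] continuous_on_subset[OF cb]) auto
      show "(\<lambda>r. norm (\<eta> r)) absolutely_integrable_on {0..S}"
        using absolutely_integrable_norm[OF \<eta>(1)[OF S]] by (simp add: o_def)
      show "\<phi> 0 = 0" unfolding \<phi>_def using y0 reparam_zero[OF reparam_sym[OF r]] by simp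
      have "K * integral {0..S} (\<lambda>r. norm (\<eta> r)) \<le> K * \<Lambda>" using \<eta>(2)[OF S] K(1) by (intro mult_left_mono) auto
      then show "K * integral {0..S} (\<lambda>r. norm (\<eta> r)) \<le> real j / 2" using j by simp
      show "gronwall_const j * \<eta>0 < 1" using \<eta>0 by (simp add: A_def)
      fix s assume s: "0 \<le> s" "s \<le> S" and le1: "\<And>r. 0 \<le> r \<Longrightarrow> r \<le> s \<Longrightarrow> \<phi> r \<le> 1"
      have c: "continuous_on {0..s} z" "continuous_on {0..s} (\<lambda>r. y (\<beta> r))" "continuous_on {0..s} \<phi>"
        unfolding \<phi>_def by (auto intro!: continuous_intros continuous_on_subset[OF z(1)] continuous_on_subset[OF cb])
      have i: "(\<lambda>r. \<Phi> (z r) (\<eta> r)) integrable_on {0..s}" "(\<lambda>r. \<Phi> (y (\<beta> r)) (\<eta> r)) integrable_on {0..s}"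
        using c \<eta>(1)[OF s(1)] by (auto intro!: lini)
      have "z s - y (\<beta> s) = integral {0..s} (\<lambda>r. \<Phi> (z r) (\<eta> r)) - integral {0..\<beta> s} (\<lambda>r. \<Phi> (y r) (\<xi> r))"
        using z(2)[OF s(1)] y(2)[OF rD(2)[OF s(1)]] by simp
      \<comment> \<open>The difference of the trajectories splits into the effect of different
        states under the same control and the exchange error \<open>D\<close>.\<close>
      also have "\<dots> = integral {0..s} (\<lambda>r. \<Phi> (z r) (\<eta> r) - \<Phi> (y (\<beta> r)) (\<eta> r)) + D (\<beta> s)"
        unfolding D_def rD(3)[OF s(1)] using i by (simp add: Henstock_Kurzweil_Integration.integral_diff)
      finally have "\<phi> s \<le> norm (integral {0..s} (\<lambda>r. \<Phi> (z r) (\<eta> r) - \<Phi> (y (\<beta> r)) (\<eta> r))) + norm (D (\<beta> s))"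
        unfolding \<phi>_def by (metis norm_triangle_ineq)
      also have "norm (integral {0..s} (\<lambda>r. \<Phi> (z r) (\<eta> r) - \<Phi> (y (\<beta> r)) (\<eta> r))) \<le> integral {0..s} (\<lambda>r. K * (\<phi> r * norm (\<eta> r)))"
      proof (rule integral_norm_bound_integral)
        show "(\<lambda>r. \<Phi> (z r) (\<eta> r) - \<Phi> (y (\<beta> r)) (\<eta> r)) integrable_on {0..s}"
          using i by (rule Henstock_Kurzweil_Integration.integrable_diff)
        have "(\<lambda>r. norm (\<eta> r)) absolutely_integrable_on {0..s}"
          using absolutely_integrable_norm[OF \<eta>(1)[OF s(1)]] by (simp add: o_def)
        then have "(\<lambda>r. \<phi> r * norm (\<eta> r)) integrable_on {0..s}"
          by (intro integral_weighted_bounds(1)[OF c(3), where X=1]) (use le1 in auto)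
        then show "(\<lambda>r. K * (\<phi> r * norm (\<eta> r))) integrable_on {0..s}" by (rule integrable_on_mult_right)
        fix r' assume r': "r' \<in> {0..s}"
        have b: "norm (y (\<beta> r')) \<le> B" using r' rD(2)[of r'] by (intro B) auto
        moreover have "norm (z r') \<le> norm (y (\<beta> r')) + \<phi> r'" unfolding \<phi>_def using norm_triangle_sub[of "z r'" "y (\<beta> r')"] by simp
        ultimately have "norm (z r') \<le> B + 1" "norm (y (\<beta> r')) \<le> B + 1" using le1[of r'] r' by auto
        then show "norm (\<Phi> (z r') (\<eta> r') - \<Phi> (y (\<beta> r')) (\<eta> r')) \<le> K * (\<phi> r' * norm (\<eta> r'))"
          unfolding \<phi>_def using K(2) by (metis mult.assoc)
      qed
      also have "norm (D (\<beta> s)) \<le> \<eta>0" by (rule Dle[OF rD(2)[OF s(1)]])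
      finally show "\<phi> s \<le> \<eta>0 + K * integral {0..s} (\<lambda>r. \<phi> r * norm (\<eta> r))" by simp
    qed (use K \<eta>0 S in auto)
    then have "\<phi> S \<le> \<epsilon>" using \<eta>0(2) unfolding A_def by simp
    then show ?thesis unfolding \<phi>_def S_def rD(4)[OF t0] by (simp add: norm_minus_commute)
  qed
  show ?thesis
  proof (intro exI[of _ \<delta>] conjI allI impI)
    fix \<alpha> \<beta> :: "real \<Rightarrow> real" and \<eta> :: "real \<Rightarrow> 'c" and z :: "real \<Rightarrow> 'b" and t :: real
    assume "reparam \<alpha> \<beta>" "\<forall>t\<ge>0. \<eta> absolutely_integrable_on {0..t} \<and> integral {0..t} (\<lambda>r. norm (\<eta> r)) \<le> \<Lambda>"
      "continuous_on {0..} z" "\<forall>t\<ge>0. z t = x0 + integral {0..t} (\<lambda>r. \<Phi> (z r) (\<eta> r))"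
      "\<forall>t\<ge>0. norm (integral {0..t} \<xi> - integral {0..\<alpha> t} \<eta>) \<le> \<delta>" "0 \<le> t"
    then show "norm (y t - z (\<alpha> t)) \<le> \<epsilon>" by (intro key[of \<alpha> \<beta> \<eta> z t]) simp_all
  qed (rule \<delta>(1))
qed

end

section \<open>Approximation of the cost from below\<close>

text \<open>Since \<open>t\<close> lies between the end points, the remainders at both of them are
  small multiples of the length of the interval itself.\<close>

lemma difference_quotient_straddle:
  fixes g :: "real \<Rightarrow> 'a::real_normed_vector"
  assumes g: "(g has_vector_derivative d) (at t within S)"
    and uv: "\<And>n. u n \<le> t" "\<And>n. t \<le> v n" "\<And>n. u n < v n" "\<And>n. u n \<in> S" "\<And>n. v n \<in> S"
    and lim: "(\<lambda>n. v n - u n) \<longlonglongrightarrow> 0"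
  shows "(\<lambda>n. (g (v n) - g (u n)) /\<^sub>R (v n - u n)) \<longlonglongrightarrow> d"
proof (rule LIMSEQ_I)
  fix r :: real assume r: "0 < r"
  obtain \<delta> where \<delta>: "0 < \<delta>" "\<And>s. s \<in> S \<Longrightarrow> norm (s - t) < \<delta> \<Longrightarrow> norm (g s - g t - (s - t) *\<^sub>R d) \<le> (r/2) * norm (s - t)"
    using g r unfolding has_vector_derivative_def has_derivative_within_alt by (metis half_gt_zero)
  obtain n0 where n0: "\<And>n. n \<ge> n0 \<Longrightarrow> norm (v n - u n - 0) < \<delta>"
    using LIMSEQ_D[OF lim \<delta>(1)] by blast
  have "norm ((g (v n) - g (u n)) /\<^sub>R (v n - u n) - d) < r" if n: "n \<ge> n0" for n
  proof -
    define h where "h = v n - u n"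
    have h: "0 < h" "h < \<delta>" using uv(3)[of n] n0[OF n] by (auto simp: h_def)
    have "norm (g (v n) - g t - (v n - t) *\<^sub>R d) \<le> (r/2) * norm (v n - t)"
      using uv(1,2)[of n] h uv(5)[of n] by (intro \<delta>(2)) (auto simp: h_def)
    moreover have "norm (g (u n) - g t - (u n - t) *\<^sub>R d) \<le> (r/2) * norm (u n - t)"
      using uv(1,2)[of n] h uv(4)[of n] by (intro \<delta>(2)) (auto simp: h_def)
    moreover have eq: "g (v n) - g (u n) - h *\<^sub>R d = (g (v n) - g t - (v n - t) *\<^sub>R d) - (g (u n) - g t - (u n - t) *\<^sub>R d)"
      by (simp add: h_def algebra_simps)
    ultimately have "norm (g (v n) - g (u n) - h *\<^sub>R d) \<le> (r/2) * norm (v n - t) + (r/2) * norm (u n - t)"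
      unfolding eq by (intro order_trans[OF norm_triangle_ineq4 add_mono])
    also have "\<dots> = (r/2) * (norm (v n - t) + norm (u n - t))" by (simp only: distrib_left)
    also have "norm (v n - t) + norm (u n - t) = h" using uv(1,2)[of n] by (simp add: h_def)
    finally have le: "norm (g (v n) - g (u n) - h *\<^sub>R d) \<le> (r/2) * h" .
    have "(g (v n) - g (u n)) /\<^sub>R h - d = (g (v n) - g (u n) - h *\<^sub>R d) /\<^sub>R h"
      using h by (simp add: scaleR_diff_right)
    then have "norm ((g (v n) - g (u n)) /\<^sub>R h - d) = norm (g (v n) - g (u n) - h *\<^sub>R d) / h"
      using h by (simp add: divide_inverse mult.commute)
    also have "\<dots> \<le> r/2" using le h by (simp add: pos_divide_le_eq)
    finally show ?thesis using r by (simp add: h_def)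
  qed
  then show "\<exists>no. \<forall>n\<ge>no. norm ((g (v n) - g (u n)) /\<^sub>R (v n - u n) - d) < r" by blast
qed

lemma e2ennreal_ereal_eq: "e2ennreal (ereal x) = ennreal x"
  by (metis e2ennreal_neg ennreal_neg enn2ereal_ennreal e2ennreal_enn2ereal ereal_less_eq(5) linorder_le_cases)

lemma ereal_integral_of_integrable:
  fixes f :: "'a \<Rightarrow> real"
  assumes f: "integrable M f"
  shows "ereal_integral M (\<lambda>x. ereal (f x)) = ereal (integral\<^sup>L M f)"
proof -
  have fin: "(\<integral>\<^sup>+x. ennreal (f x) \<partial>M) < \<infinity>" "(\<integral>\<^sup>+x. ennreal (- f x) \<partial>M) < \<infinity>"
    using f unfolding real_integrable_def by (auto simp: less_top)
  then obtain a b where ab: "0 \<le> a" "(\<integral>\<^sup>+x. ennreal (f x) \<partial>M) = ennreal a" "0 \<le> b" "(\<integral>\<^sup>+x. ennreal (- f x) \<partial>M) = ennreal b"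
    by (metis ennreal_cases infinity_ennreal_def less_irrefl)
  then show "ereal_integral M (\<lambda>x. ereal (f x)) = ereal (integral\<^sup>L M f)"
    unfolding ereal_integral_def real_lebesgue_integral_def[OF f] by (simp add: e2ennreal_ereal_eq)
qed

text \<open>\<open>nn_integral\<close> is monotone for arbitrary functions, which allows integrands
  of unknown measurability.\<close>

lemma ereal_integral_mono_AE:
  assumes "AE x in M. h1 x \<le> h2 x"
  shows "ereal_integral M h1 \<le> ereal_integral M h2"
  unfolding ereal_integral_def
proof (rule ereal_minus_mono)
  show "enn2ereal (\<integral>\<^sup>+x. e2ennreal (h1 x) \<partial>M) \<le> enn2ereal (\<integral>\<^sup>+x. e2ennreal (h2 x) \<partial>M)"
    using assms by (intro less_eq_ennreal.rep_eq[THEN iffD1] nn_integral_mono_AE) (auto elim!: eventually_mono intro: e2ennreal_mono)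
  show "enn2ereal (\<integral>\<^sup>+x. e2ennreal (- h2 x) \<partial>M) \<le> enn2ereal (\<integral>\<^sup>+x. e2ennreal (- h1 x) \<partial>M)"
    using assms by (intro less_eq_ennreal.rep_eq[THEN iffD1] nn_integral_mono_AE) (auto elim!: eventually_mono intro: e2ennreal_mono)
qed

text \<open>The integrand itself need not be known to be measurable: Fatou's lemma is applied to step functions
  built from difference quotients of \<open>g\<close> and near-optimal minorants on a fine grid.\<close>

lemma cost_approximation:
  fixes g :: "real \<Rightarrow> real \<times> (real^'k)" and L :: "real^'n \<Rightarrow> real^'k \<Rightarrow> real"
  assumes e: "0 < e" and \<xi>: "\<xi> absolutely_integrable_on {0..e}"
    and g: "\<And>s t. 0 \<le> s \<Longrightarrow> s \<le> t \<Longrightarrow> t \<le> e \<Longrightarrow> norm (g t - g s) \<le> integral {s..t} (\<lambda>r. norm (\<xi> r))"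
    and N: "negligible N" "\<And>t. t \<in> {0..e} - N \<Longrightarrow> (g has_vector_derivative \<xi> t) (at t within {0..e}) \<and> 0 \<le> fst (\<xi> t)"
    and y: "continuous_on {0..e} y"
    and cont: "continuous_on UNIV (\<lambda>(x, u). L x u)" and conv: "\<And>x. convex_on UNIV (L x)" and \<epsilon>: "0 < \<epsilon>"
    and c: "ereal c < ereal_integral (lebesgue_on {0..e}) (\<lambda>t. ext_lagrangian L (y t) (fst (\<xi> t)) (snd (\<xi> t)))"
  shows "\<exists>m z \<rho>. 0 < m \<and> 0 < \<rho> \<and>
    (\<forall>i<m. \<forall>t. real i * (e / real m) \<le> t \<longrightarrow> t \<le> real (Suc i) * (e / real m) \<longrightarrow> (\<forall>x. norm (x - y t) \<le> \<rho> \<longrightarrow>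
      (\<forall>v w. 0 \<le> v \<longrightarrow> ereal (z i \<bullet> (v, w) - \<epsilon> * norm (v, w)) \<le> ext_lagrangian L x v w))) \<and>
    c < (\<Sum>i<m. z i \<bullet> (g (real (Suc i) * (e / real m)) - g (real i * (e / real m))))"
proof -
  define Y where "Y = y ` {0..e}"
  have Y: "compact Y" unfolding Y_def using y by (intro compact_continuous_image) auto
  obtain C where C: "0 \<le> C" "\<And>x. x \<in> Y \<Longrightarrow> \<exists>z\<in>minorants L x. norm z \<le> C"
    using minorants_uniformly_bounded[OF cont conv Y] by blast
  define R where "R = (\<lambda>n::nat. C + real n)"
  have "\<exists>\<rho>>0. \<forall>x\<in>Y. \<forall>x'. norm (x' - x) \<le> \<rho> \<longrightarrow> (\<forall>z\<in>minorants L x. norm z \<le> R n \<longrightarrow>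
    (\<forall>u. z \<bullet> (1, u) - \<epsilon> * norm (1::real, u) \<le> L x' u))" for n
    using C(1) by (intro minorant_stable[OF cont conv Y _ \<epsilon>]) (simp add: R_def)
  then obtain \<rho> where \<rho>: "\<And>n. 0 < \<rho> n" "\<And>n x x' z u. x \<in> Y \<Longrightarrow> norm (x' - x) \<le> \<rho> n \<Longrightarrow> z \<in> minorants L x \<Longrightarrow> norm z \<le> R n \<Longrightarrow>
    z \<bullet> (1, u) - \<epsilon> * norm (1::real, u) \<le> L x' u" by metis
  have uc: "uniformly_continuous_on {0..e} y" using y by (rule compact_uniformly_continuous) simp
  have "\<exists>d>0. \<forall>s\<in>{0..e}. \<forall>t\<in>{0..e}. dist t s < d \<longrightarrow> dist (y t) (y s) < \<rho> n / 2" for n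
    using uc \<rho>(1)[of n] unfolding uniformly_continuous_on_def by (metis half_gt_zero)
  then obtain d where d: "\<And>n. 0 < d n" "\<And>n s t. s \<in> {0..e} \<Longrightarrow> t \<in> {0..e} \<Longrightarrow> dist t s < d n \<Longrightarrow> dist (y t) (y s) < \<rho> n / 2"
    by metis
  have "\<exists>m. n < m \<and> e / d n < real m" for n
  proof -
    obtain k :: nat where "max (real n) (e / d n) < real k" using reals_Archimedean2 by blast
    then show ?thesis by (intro exI[of _ k]) auto
  qed
  \<comment> \<open>The first condition sends the mesh to 0, the second makes it smaller than
    \<open>d n\<close>, so that \<open>y\<close> varies by less than \<open>\<rho> n / 2\<close> on
    a cell.\<close>
  then obtain m where m: "\<And>n. n < m n" "\<And>n. e / d n < real (m n)" by metis
  have m0: "0 < m n" for n using m(1)[of n] by simp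
  define h where "h = (\<lambda>n. e / real (m n))"
  have h: "0 < h n" "h n < d n" "real (m n) * h n = e" for n
    using e m0[of n] m(2)[of n] d(1)[of n] by (auto simp: h_def field_simps)
  define \<tau> where "\<tau> = (\<lambda>n i. real i * h n)"
  have \<tau>: "\<tau> n 0 = 0" "\<tau> n (m n) = e" "\<tau> n (Suc i) = \<tau> n i + h n" "0 \<le> \<tau> n i" for n i
    using h(1,3)[of n] by (auto simp: \<tau>_def algebra_simps)
  have \<tau>e: "\<tau> n (Suc i) \<le> e" if "i < m n" for n i
  proof -
    have "real (Suc i) * h n \<le> real (m n) * h n" using that h(1)[of n] by (intro mult_right_mono) auto
    then show ?thesis using h(3)[of n] by (simp add: \<tau>_def)
  qed
  define \<Delta> where "\<Delta> = (\<lambda>n i. g (\<tau> n (Suc i)) - g (\<tau> n i))"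
  \<comment> \<open>Minorants at all points of the cell compete, not only those at a grid point:
    this way a minorant at the given t takes part in every cell around t.\<close>
  define A where "A = (\<lambda>n i. {z. norm z \<le> R n \<and> (\<exists>t\<in>{\<tau> n i..\<tau> n (Suc i)}. z \<in> minorants L (y t))})"
  have cell: "t \<in> {0..e}" if "i < m n" "t \<in> {\<tau> n i..\<tau> n (Suc i)}" for n i t
    using that \<tau>e[OF that(1)] \<tau>(4)[of n i] by auto
  have base: "\<exists>z\<in>A n i. norm z \<le> C" if i: "i < m n" for n i
  proof -
    have "\<tau> n i \<in> {\<tau> n i..\<tau> n (Suc i)}" using \<tau>(3)[of n i] h(1)[of n] by simp
    moreover from this have "y (\<tau> n i) \<in> Y" using cell[OF i] by (auto simp: Y_def)
    then obtain z where "z \<in> minorants L (y (\<tau> n i))" "norm z \<le> C" using C(2) by blast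
    ultimately show ?thesis unfolding A_def R_def by (intro bexI[of _ z]) auto
  qed
  \<comment> \<open>The supremum over the competitors need not be attained. Over all cells the
    tolerances h n / (n + 1) sum to e / (n + 1), which tends to 0.\<close>
  have "\<exists>z\<in>A n i. \<forall>z'\<in>A n i. z' \<bullet> \<Delta> n i \<le> z \<bullet> \<Delta> n i + h n / real (Suc n)" if i: "i < m n" for n i
  proof -
    define B where "B = (\<lambda>z. z \<bullet> \<Delta> n i) ` A n i"
    have ne: "B \<noteq> {}" using base[OF i] by (auto simp: B_def)
    have bd: "bdd_above B"
    proof (rule bdd_aboveI)
      fix b assume "b \<in> B"
      then obtain z where z: "norm z \<le> R n" "b = z \<bullet> \<Delta> n i" by (auto simp: B_def A_def)
      have "b \<le> norm z * norm (\<Delta> n i)" using z norm_cauchy_schwarz by simp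
      also have "\<dots> \<le> R n * norm (\<Delta> n i)" using z(1) by (intro mult_right_mono) auto
      finally show "b \<le> R n * norm (\<Delta> n i)" .
    qed
    have "Sup B - h n / real (Suc n) < Sup B" using h(1)[of n] by simp
    then obtain b where b: "b \<in> B" "Sup B - h n / real (Suc n) < b" using less_cSup_iff[OF ne bd] by blast
    then obtain z where z: "z \<in> A n i" "b = z \<bullet> \<Delta> n i" by (auto simp: B_def)
    have "z' \<bullet> \<Delta> n i \<le> z \<bullet> \<Delta> n i + h n / real (Suc n)" if "z' \<in> A n i" for z'
    proof -
      have "z' \<bullet> \<Delta> n i \<le> Sup B" using that bd by (intro cSup_upper) (auto simp: B_def)
      then show ?thesis using b(2) z(2) by simp
    qed
    then show ?thesis using z(1) by blast
  qed
  then have "\<forall>n i. \<exists>z. i < m n \<longrightarrow> z \<in> A n i \<and> (\<forall>z'\<in>A n i. z' \<bullet> \<Delta> n i \<le> z \<bullet> \<Delta> n i + h n / real (Suc n))" by blast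
  then obtain z where "\<forall>n i. i < m n \<longrightarrow> z n i \<in> A n i \<and> (\<forall>z'\<in>A n i. z' \<bullet> \<Delta> n i \<le> z n i \<bullet> \<Delta> n i + h n / real (Suc n))"
    unfolding choice_iff by blast
  then have z: "\<And>n i. i < m n \<Longrightarrow> z n i \<in> A n i"
    "\<And>n i z'. i < m n \<Longrightarrow> z' \<in> A n i \<Longrightarrow> z' \<bullet> \<Delta> n i \<le> z n i \<bullet> \<Delta> n i + h n / real (Suc n)" by blast+
  define S where "S = (\<lambda>n. \<Sum>i<m n. z n i \<bullet> \<Delta> n i)"
  have "\<exists>n. c < S n"
  proof (rule ccontr)
    assume "\<nexists>n. c < S n"
    then have Sc: "S n \<le> c" for n by (simp add: not_less)
    define M where "M = lebesgue_on {0..e}"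
    define l where "l = integral {0..e} (\<lambda>r. norm (\<xi> r))"
    \<comment> \<open>With q the difference quotient of \<open>g\<close> on the cell, this dominates
      w \<bullet> q + C |q| for every competitor w, the last summand paying for near-optimality. As
      some competitor has norm at most \<open>C\<close>, the value is nonnegative, as Fatou's lemma
      requires.\<close>
    define a where "a = (\<lambda>n i. z n i \<bullet> \<Delta> n i / h n + C * norm (\<Delta> n i) / h n + 1 / real (Suc n))"
    define I where "I = (\<lambda>n i. {\<tau> n i..<\<tau> n (Suc i)})"
    define \<phi> where "\<phi> = (\<lambda>n t. \<Sum>i<m n. ennreal (a n i) * indicator (I n i) t)"
    have lowq: "w \<bullet> (\<Delta> n i /\<^sub>R h n) + C * norm (\<Delta> n i /\<^sub>R h n) \<le> a n i" if "i < m n" "w \<in> A n i" for n i w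
    proof -
      have "w \<bullet> \<Delta> n i / h n \<le> (z n i \<bullet> \<Delta> n i + h n / real (Suc n)) / h n"
        using z(2)[OF that] h(1)[of n] by (intro divide_right_mono) auto
      also have "\<dots> = z n i \<bullet> \<Delta> n i / h n + 1 / real (Suc n)" using h(1)[of n] by (simp add: add_divide_distrib)
      finally show ?thesis using h(1)[of n] unfolding a_def by (simp add: divide_inverse mult.commute mult.left_commute)
    qed
    have a0: "0 \<le> a n i" if i: "i < m n" for n i
    proof -
      obtain w where w: "w \<in> A n i" "norm w \<le> C" using base[OF i] by blast
      define q where "q = \<Delta> n i /\<^sub>R h n"
      have "- (w \<bullet> q) \<le> norm w * norm q" using norm_cauchy_schwarz[of "- w" q] by simp
      also have "\<dots> \<le> C * norm q" using w(2) by (intro mult_right_mono) auto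
      finally show ?thesis using lowq[OF i w(1)] unfolding q_def by linarith
    qed
    have Im: "I n i \<in> sets M" "emeasure M (I n i) = ennreal (h n)" if i: "i < m n" for n i
    proof -
      have sub: "I n i \<subseteq> {0..e}" using cell[OF i] by (auto simp: I_def)
      then show "I n i \<in> sets M" unfolding M_def by (subst sets_restrict_space_iff) (auto simp: I_def)
      have "emeasure M (I n i) = emeasure lebesgue (I n i)"
        unfolding M_def using sub by (intro emeasure_restrict_space) auto
      also have "\<dots> = ennreal (h n)" using \<tau>(3)[of n i] h(1)[of n] by (simp add: I_def)
      finally show "emeasure M (I n i) = ennreal (h n)" .
    qed
    have \<phi>m: "\<phi> n \<in> borel_measurable M" for n
      unfolding \<phi>_def using Im(1) by (intro borel_measurable_sum borel_measurable_times_ennreal borel_measurable_const borel_measurable_indicator) auto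
    have ai: "(\<lambda>r. norm (\<xi> r)) absolutely_integrable_on {0..e}" using absolutely_integrable_norm[OF \<xi>] by (simp add: o_def)
    have ni0: "(\<lambda>r. norm (\<xi> r)) integrable_on {0..e}" using ai by (rule set_lebesgue_integral_eq_integral(1))
    have sumnorm: "(\<Sum>i<m n. norm (\<Delta> n i)) \<le> l" for n
    proof -
      have "(\<Sum>i<k. norm (\<Delta> n i)) \<le> integral {0..\<tau> n k} (\<lambda>r. norm (\<xi> r))" if "k \<le> m n" for k
        using that
      proof (induction k)
        case 0
        then show ?case by (simp add: \<tau>)
      next
        case (Suc k)
        have k: "k < m n" using Suc.prems by simp
        have ni: "(\<lambda>r. norm (\<xi> r)) integrable_on {0..\<tau> n (Suc k)}"
          by (rule integrable_on_subinterval[OF ni0]) (use \<tau>e[OF k] in auto)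
        have "norm (\<Delta> n k) \<le> integral {\<tau> n k..\<tau> n (Suc k)} (\<lambda>r. norm (\<xi> r))"
          unfolding \<Delta>_def using \<tau>(3,4)[of n k] h(1)[of n] \<tau>e[OF k] by (intro g) auto
        moreover have "integral {0..\<tau> n k} (\<lambda>r. norm (\<xi> r)) + integral {\<tau> n k..\<tau> n (Suc k)} (\<lambda>r. norm (\<xi> r)) = integral {0..\<tau> n (Suc k)} (\<lambda>r. norm (\<xi> r))"
          using \<tau>(3,4)[of n k] h(1)[of n] by (intro Henstock_Kurzweil_Integration.integral_combine ni) auto
        ultimately show ?case using Suc by simp
      qed
      from this[OF order_refl] show ?thesis by (simp add: \<tau> l_def)
    qed
    have \<phi>int: "(\<integral>\<^sup>+t. \<phi> n t \<partial>M) \<le> ennreal (c + C * l + e / real (Suc n))" "0 \<le> c + C * l + e / real (Suc n)" for n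
    proof -
      have "(\<integral>\<^sup>+t. \<phi> n t \<partial>M) = (\<Sum>i<m n. (\<integral>\<^sup>+t. ennreal (a n i) * indicator (I n i) t \<partial>M))"
        unfolding \<phi>_def using Im(1) by (intro nn_integral_sum) (auto intro!: borel_measurable_times_ennreal borel_measurable_indicator)
      also have "\<dots> = (\<Sum>i<m n. ennreal (a n i * h n))"
        using Im a0 h(1)[of n] by (intro sum.cong) (auto simp: nn_integral_cmult_indicator ennreal_mult less_imp_le)
      also have "\<dots> = ennreal (\<Sum>i<m n. a n i * h n)"
        using a0 h(1)[of n] by (intro sum_ennreal) (auto intro: mult_nonneg_nonneg less_imp_le)
      finally have eq: "(\<integral>\<^sup>+t. \<phi> n t \<partial>M) = ennreal (\<Sum>i<m n. a n i * h n)" .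
      have "(\<Sum>i<m n. a n i * h n) = (\<Sum>i<m n. z n i \<bullet> \<Delta> n i + C * norm (\<Delta> n i) + h n / real (Suc n))"
        using h(1)[of n] by (intro sum.cong) (simp_all add: a_def distrib_right)
      also have "\<dots> = S n + C * (\<Sum>i<m n. norm (\<Delta> n i)) + real (m n) * (h n / real (Suc n))"
        by (simp add: sum.distrib S_def sum_distrib_left)
      also have "\<dots> \<le> c + C * l + e / real (Suc n)"
        using Sc[of n] mult_left_mono[OF sumnorm[of n] C(1)] h(3)[of n] by (simp add: times_divide_eq_right[symmetric])
      finally have le: "(\<Sum>i<m n. a n i * h n) \<le> c + C * l + e / real (Suc n)" .
      then show "(\<integral>\<^sup>+t. \<phi> n t \<partial>M) \<le> ennreal (c + C * l + e / real (Suc n))" unfolding eq by (rule ennreal_leI)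
      have "0 \<le> (\<Sum>i<m n. a n i * h n)" using a0 h(1)[of n] by (intro sum_nonneg mult_nonneg_nonneg) (auto intro: less_imp_le)
      then show "0 \<le> c + C * l + e / real (Suc n)" using le by simp
    qed
    have lim_bd: "(\<lambda>n. c + C * l + e / real (Suc n)) \<longlonglongrightarrow> c + C * l"
    proof -
      have "(\<lambda>n. c + C * l + e * inverse (real (Suc n))) \<longlonglongrightarrow> c + C * l + e * 0"
        by (intro tendsto_intros LIMSEQ_inverse_real_of_nat)
      then show ?thesis by (simp add: divide_inverse)
    qed
    have r0: "0 \<le> c + C * l" using lim_bd \<phi>int(2) by (intro LIMSEQ_le_const[OF lim_bd]) auto
    define H where "H = (\<lambda>t. liminf (\<lambda>n. \<phi> n t))"
    have Hm: "H \<in> borel_measurable M" unfolding H_def using \<phi>m by measurable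
    have Hint: "(\<integral>\<^sup>+t. H t \<partial>M) \<le> ennreal (c + C * l)"
    proof -
      have "(\<integral>\<^sup>+t. H t \<partial>M) \<le> liminf (\<lambda>n. \<integral>\<^sup>+t. \<phi> n t \<partial>M)" unfolding H_def by (rule nn_integral_liminf[OF \<phi>m])
      also have "\<dots> \<le> liminf (\<lambda>n. ennreal (c + C * l + e / real (Suc n)))" using \<phi>int(1) by (intro Liminf_mono) auto
      also have "\<dots> = ennreal (c + C * l)" using lim_bd by (intro lim_imp_Liminf tendsto_ennrealI) auto
      finally show ?thesis .
    qed
    \<comment> \<open>A minorant w at \<open>y t\<close> competes as soon as \<open>R n\<close>
      reaches its norm; since the difference quotients converge at \<open>t\<close>, the lower limit
      dominates it.\<close>
    have key: "ennreal (w \<bullet> \<xi> t + C * norm (\<xi> t)) \<le> H t" if t: "t \<in> {0..<e} - N" and w: "w \<in> minorants L (y t)" for t w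
    proof -
      have "\<exists>i<m n. t \<in> I n i" for n
      proof -
        define i where "i = nat \<lfloor>t / h n\<rfloor>"
        have tn: "0 \<le> t / h n" using t h(1)[of n] by simp
        have 1: "real i \<le> t / h n" "t / h n < real i + 1" unfolding i_def using tn by (auto simp: of_nat_nat)
        then have "real i * h n \<le> t" "t < (real i + 1) * h n" using h(1)[of n] by (auto simp: field_simps)
        then have "t \<in> I n i" by (simp add: I_def \<tau>_def algebra_simps)
        moreover have "real i * h n < real (m n) * h n" using \<open>real i * h n \<le> t\<close> t h(3)[of n] by simp
        then have "i < m n" using h(1)[of n] by simp
        ultimately show ?thesis by blast
      qed
      then obtain i where i: "\<And>n. i n < m n" "\<And>n. t \<in> I n (i n)" by metis
      define q where "q = (\<lambda>n. \<Delta> n (i n) /\<^sub>R h n)"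
      have "q \<longlonglongrightarrow> \<xi> t"
      proof -
        have hq: "h n = \<tau> n (Suc (i n)) - \<tau> n (i n)" for n using \<tau>(3)[of n "i n"] by simp
        have "h \<longlonglongrightarrow> 0"
        proof (rule tendsto_sandwich[of "\<lambda>_. 0" _ _ "\<lambda>n. e * inverse (real (Suc n))"])
          show "\<forall>\<^sub>F n in sequentially. 0 \<le> h n" using h(1) by (intro always_eventually allI less_imp_le)
          show "\<forall>\<^sub>F n in sequentially. h n \<le> e * inverse (real (Suc n))"
          proof (rule always_eventually, rule allI)
            fix n
            have "real (Suc n) \<le> real (m n)" using m(1)[of n] by simp
            then show "h n \<le> e * inverse (real (Suc n))"
              unfolding h_def using e by (simp add: divide_inverse le_imp_inverse_le)
          qed
          show "(\<lambda>n. e * inverse (real (Suc n))) \<longlonglongrightarrow> 0"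
            using tendsto_mult_right_zero[OF LIMSEQ_inverse_real_of_nat] by simp
        qed simp
        then have lim: "(\<lambda>n. \<tau> n (Suc (i n)) - \<tau> n (i n)) \<longlonglongrightarrow> 0" by (simp add: hq[symmetric])
        have gt: "(g has_vector_derivative \<xi> t) (at t within {0..e})" using N(2)[of t] t by auto
        have "(\<lambda>n. (g (\<tau> n (Suc (i n))) - g (\<tau> n (i n))) /\<^sub>R (\<tau> n (Suc (i n)) - \<tau> n (i n))) \<longlonglongrightarrow> \<xi> t"
        proof (rule difference_quotient_straddle[OF gt _ _ _ _ _ lim])
          fix n
          show "\<tau> n (i n) \<le> t" "t \<le> \<tau> n (Suc (i n))" "\<tau> n (i n) < \<tau> n (Suc (i n))"
            using i(2)[of n] by (auto simp: I_def)
          then show "\<tau> n (i n) \<in> {0..e}" "\<tau> n (Suc (i n)) \<in> {0..e}" using cell[OF i(1)[of n]] by auto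
        qed
        then show ?thesis unfolding q_def \<Delta>_def hq[symmetric] .
      qed
      then have "(\<lambda>n. ennreal (w \<bullet> q n + C * norm (q n))) \<longlonglongrightarrow> ennreal (w \<bullet> \<xi> t + C * norm (\<xi> t))"
        by (intro tendsto_intros tendsto_ennrealI)
      then have "ennreal (w \<bullet> \<xi> t + C * norm (\<xi> t)) = liminf (\<lambda>n. ennreal (w \<bullet> q n + C * norm (q n)))"
        by (intro lim_imp_Liminf[symmetric]) auto
      also have "\<dots> \<le> H t"
        unfolding H_def
      proof (rule Liminf_mono)
        obtain n0 :: nat where n0: "norm w \<le> real n0" using real_arch_simple by blast
        show "\<forall>\<^sub>F n in sequentially. ennreal (w \<bullet> q n + C * norm (q n)) \<le> \<phi> n t"
          using eventually_ge_at_top[of n0]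
        proof eventually_elim
          case (elim n)
          have "norm w \<le> R n" using n0 elim C(1) unfolding R_def by simp
          then have "w \<in> A n (i n)" using w i(2)[of n] unfolding A_def I_def by auto
          then have "w \<bullet> q n + C * norm (q n) \<le> a n (i n)" unfolding q_def by (rule lowq[OF i(1)])
          then have "ennreal (w \<bullet> q n + C * norm (q n)) \<le> ennreal (a n (i n)) * indicator (I n (i n)) t"
            using i(2)[of n] by (simp add: ennreal_leI)
          also have "\<dots> \<le> \<phi> n t" unfolding \<phi>_def using i(1)[of n] by (intro member_le_sum) auto
          finally show ?case .
        qed
      qed
      finally show ?thesis .
    qed
    define H' where "H' = (\<lambda>t. enn2real (H t))"
    have fin: "AE t in M. H t \<noteq> \<infinity>"
      using Hint by (intro nn_integral_PInf_AE Hm) (metis ennreal_less_top infinity_ennreal_def le_less_trans less_irrefl)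
    then have HH': "AE t in M. H t = ennreal (H' t)"
      unfolding H'_def by eventually_elim (simp add: less_top)
    have H'm: "H' \<in> borel_measurable M" unfolding H'_def using Hm by measurable
    have H'int: "integrable M H'" "integral\<^sup>L M H' \<le> c + C * l"
    proof -
      have eq: "(\<integral>\<^sup>+t. ennreal (H' t) \<partial>M) = (\<integral>\<^sup>+t. H t \<partial>M)"
        using HH' by (intro nn_integral_cong_AE) (auto elim: eventually_mono)
      show "integrable M H'"
      proof (rule integrableI_bounded[OF H'm])
        have "(\<integral>\<^sup>+t. ennreal (norm (H' t)) \<partial>M) = (\<integral>\<^sup>+t. ennreal (H' t) \<partial>M)" by (simp add: H'_def)
        also have "\<dots> \<le> ennreal (c + C * l)" unfolding eq by (rule Hint)
        finally show "(\<integral>\<^sup>+t. ennreal (norm (H' t)) \<partial>M) < \<infinity>" using ennreal_less_top le_less_trans by (metis infinity_ennreal_def)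
      qed
      show "integral\<^sup>L M H' \<le> c + C * l"
      proof -
        have "integral\<^sup>L M H' = enn2real (\<integral>\<^sup>+t. ennreal (H' t) \<partial>M)"
          by (rule integral_eq_nn_integral[OF H'm]) (simp add: H'_def)
        also have "\<dots> \<le> c + C * l" unfolding eq using Hint r0 by (intro enn2real_leI)
        finally show ?thesis .
      qed
    qed
    have \<xi>n: "integrable M (\<lambda>t. norm (\<xi> t))" "integral\<^sup>L M (\<lambda>t. norm (\<xi> t)) = l"
    proof -
      show int: "integrable M (\<lambda>t. norm (\<xi> t))"
        unfolding M_def by (rule absolutely_integrable_imp_integrable[OF ai]) simp
      then show "integral\<^sup>L M (\<lambda>t. norm (\<xi> t)) = l"
        unfolding M_def l_def by (intro lebesgue_integral_eq_integral) auto
    qed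
    \<comment> \<open>Removing the shift C |\<xi>| leaves a majorant of the integrand whose integral
      is at most \<open>c\<close>, against the choice of \<open>c\<close>.\<close>
    define F where "F = (\<lambda>t. H' t - C * norm (\<xi> t))"
    have Fi: "integrable M F" "integral\<^sup>L M F \<le> c"
      unfolding F_def using H'int \<xi>n by auto
    have "AE t in M. ext_lagrangian L (y t) (fst (\<xi> t)) (snd (\<xi> t)) \<le> ereal (F t)"
    proof -
      have "AE t in M. t \<in> {0..<e} - N"
      proof -
        have "{t \<in> {0..e}. t \<notin> {0..<e} - N} \<subseteq> insert e N" by auto
        then have "negligible {t \<in> {0..e}. t \<notin> {0..<e} - N}" using N(1) by (meson negligible_insert negligible_subset)
        then show ?thesis unfolding M_def by (subst AE_lebesgue_on_negligible) auto
      qed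
      with HH' show ?thesis
      proof eventually_elim
        case (elim t)
        show ?case
        proof (rule ccontr)
          assume "\<not> ?thesis"
          then have lt: "ereal (F t) < ext_lagrangian L (y t) (fst (\<xi> t)) (snd (\<xi> t))" by simp
          have v: "0 \<le> fst (\<xi> t)" using N(2)[of t] elim(2) by auto
          obtain w where w: "w \<in> minorants L (y t)" "F t < w \<bullet> (fst (\<xi> t), snd (\<xi> t))"
            using ext_lagrangian_less_imp_minorant[where L=L and x="y t", OF conv v lt] by blast
          have "ennreal (w \<bullet> \<xi> t + C * norm (\<xi> t)) \<le> ennreal (H' t)" using key[OF elim(2) w(1)] elim(1) by simp
          then have "w \<bullet> \<xi> t + C * norm (\<xi> t) \<le> H' t" by (subst (asm) ennreal_le_iff) (auto simp: H'_def)
          then show False using w(2) unfolding F_def by simp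
        qed
      qed
    qed
    then have "ereal_integral M (\<lambda>t. ext_lagrangian L (y t) (fst (\<xi> t)) (snd (\<xi> t))) \<le> ereal_integral M (\<lambda>t. ereal (F t))"
      by (rule ereal_integral_mono_AE)
    also have "\<dots> \<le> ereal c" unfolding ereal_integral_of_integrable[OF Fi(1)] using Fi(2) by simp
    finally show False using c unfolding M_def by simp
  qed
  then obtain n where n: "c < S n" by blast
  show ?thesis
  proof (intro exI[of _ "m n"] exI[of _ "z n"] exI[of _ "\<rho> n / 2"] conjI allI impI)
    show "0 < m n" by (rule m0)
    \<comment> \<open>The other half of \<open>\<rho> n\<close> absorbs the variation of
      \<open>y\<close> between \<open>t\<close> and the point of the cell where the minorant was
      taken.\<close>
    show "0 < \<rho> n / 2" using \<rho>(1) by simp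
    show "c < (\<Sum>i<m n. z n i \<bullet> (g (real (Suc i) * (e / real (m n))) - g (real i * (e / real (m n)))))"
      using n unfolding S_def \<Delta>_def \<tau>_def h_def by simp
    fix i t x v w assume i: "i < m n" and t: "real i * (e / real (m n)) \<le> t" "t \<le> real (Suc i) * (e / real (m n))"
      and x: "norm (x - y t) \<le> \<rho> n / 2" and v: "0 \<le> (v::real)"
    have tI: "t \<in> {\<tau> n i..\<tau> n (Suc i)}" using t by (simp add: \<tau>_def h_def)
    obtain s where s: "s \<in> {\<tau> n i..\<tau> n (Suc i)}" "z n i \<in> minorants L (y s)" "norm (z n i) \<le> R n"
      using z(1)[OF i] by (auto simp: A_def)
    have "dist t s < d n" using tI s(1) \<tau>(3)[of n i] h(2)[of n] by (auto simp: dist_real_def)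
    then have "dist (y t) (y s) < \<rho> n / 2" using cell[OF i tI] cell[OF i s(1)] by (intro d(2))
    then have xs: "norm (x - y s) \<le> \<rho> n" using x norm_triangle_ineq[of "x - y t" "y t - y s"] by (simp add: dist_norm)
    have "y s \<in> Y" using cell[OF i s(1)] by (auto simp: Y_def)
    from \<rho>(2)[OF this xs s(2,3)]
    show "ereal (z n i \<bullet> (v, w) - \<epsilon> * norm (v, w)) \<le> ext_lagrangian L x v w"
      by (intro ext_lagrangian_ge[OF conv v])
  qed
qed

section \<open>Existence of maximal solutions\<close>

lemma abs_cont_on_cong:
  assumes ac: "abs_cont_on J F" and eq: "\<And>t. t \<in> J \<Longrightarrow> F' t = F t"
  shows "abs_cont_on J F'"
  unfolding abs_cont_on_def
proof (intro allI impI)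
  fix a b \<epsilon> :: real assume ab: "{a..b} \<subseteq> J" and \<epsilon>: "0 < \<epsilon>"
  obtain \<delta> where \<delta>: "\<delta> > 0" "\<forall>D. D division_of \<Union>D \<and> \<Union>D \<subseteq> {a..b} \<and> (\<Sum>k\<in>D. Sup k - Inf k) < \<delta> \<longrightarrow>
      (\<Sum>k\<in>D. norm (F (Sup k) - F (Inf k))) < \<epsilon>"
    using abs_cont_onD[OF ac ab \<epsilon>] by blast
  have "(\<Sum>k\<in>D. norm (F' (Sup k) - F' (Inf k))) = (\<Sum>k\<in>D. norm (F (Sup k) - F (Inf k)))"
    if D: "D division_of \<Union>D" "\<Union>D \<subseteq> {a..b}" for D
  proof (rule sum.cong)
    fix k assume k: "k \<in> D"
    obtain u v where uv: "k = {u..v}" "u \<le> v" "Inf k = u" "Sup k = v" by (rule real_division_cell[OF D(1) k])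
    have "k \<subseteq> J" using k D(2) ab by blast
    then have "u \<in> J" "v \<in> J" using uv by auto
    then show "norm (F' (Sup k) - F' (Inf k)) = norm (F (Sup k) - F (Inf k))" using eq uv by simp
  qed simp
  then show "\<exists>\<delta>>0. \<forall>d. d division_of \<Union>d \<and> \<Union>d \<subseteq> {a..b} \<and> (\<Sum>k\<in>d. Sup k - Inf k) < \<delta> \<longrightarrow>
      (\<Sum>k\<in>d. norm (F' (Sup k) - F' (Inf k))) < \<epsilon>"
    using \<delta> by (intro exI[of _ \<delta>]) auto
qed

lemma abs_cont_on_singleton: "abs_cont_on {a..a::real} F"
  unfolding abs_cont_on_def
proof (intro allI impI exI[of _ 1] conjI)
  fix c d \<epsilon> :: real and D assume cd: "{c..d} \<subseteq> {a..a}" and \<epsilon>: "0 < \<epsilon>"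
    and D: "D division_of \<Union>D \<and> \<Union>D \<subseteq> {c..d} \<and> (\<Sum>k\<in>D. Sup k - Inf k) < 1"
  have "norm (F (Sup k) - F (Inf k)) = 0" if k: "k \<in> D" for k
  proof -
    obtain u v where uv: "k = {u..v}" "u \<le> v" "Inf k = u" "Sup k = v" using real_division_cell[OF _ k] D by blast
    have "k \<subseteq> {a..a}" using k D cd by blast
    then have "u \<in> {a..a}" "v \<in> {a..a}" using uv(1,2) by auto
    then show ?thesis using uv by simp
  qed
  then have "(\<Sum>k\<in>D. norm (F (Sup k) - F (Inf k))) = 0" by simp
  then show "(\<Sum>k\<in>D. norm (F (Sup k) - F (Inf k))) < \<epsilon>" using \<epsilon> by simp
qed simp

lemma abs_cont_onI:
  fixes F :: "real \<Rightarrow> 'a::real_normed_vector"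
  assumes "\<And>a b. a \<le> b \<Longrightarrow> {a..b} \<subseteq> J \<Longrightarrow> abs_cont_on {a..b} F"
  shows "abs_cont_on J F"
  unfolding abs_cont_on_def
proof (intro allI impI)
  fix a b \<epsilon> :: real assume ab: "{a..b} \<subseteq> J" and \<epsilon>: "0 < \<epsilon>"
  show "\<exists>\<delta>>0. \<forall>d. d division_of \<Union>d \<and> \<Union>d \<subseteq> {a..b} \<and> (\<Sum>k\<in>d. Sup k - Inf k) < \<delta> \<longrightarrow>
      (\<Sum>k\<in>d. norm (F (Sup k) - F (Inf k))) < \<epsilon>"
  proof (cases "a \<le> b")
    case True
    show ?thesis by (rule abs_cont_onD[OF assms[OF True ab] order_refl \<epsilon>])
  next
    case False
    have empty: "d = {}" if "d division_of \<Union>d" "\<Union>d \<subseteq> {a..b}" for d :: "real set set"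
    proof (rule ccontr)
      assume "d \<noteq> {}"
      then obtain k where k: "k \<in> d" by blast
      have "k \<noteq> {}" using division_ofD(3)[OF that(1) k] .
      then show False using that(2) k False by auto
    qed
    have "(\<Sum>k\<in>d. norm (F (Sup k) - F (Inf k))) < \<epsilon>" if "d division_of \<Union>d" "\<Union>d \<subseteq> {a..b}" for d :: "real set set"
    proof -
      have "d = {}" by (rule empty[OF that])
      then show ?thesis using \<epsilon> by simp
    qed
    then show ?thesis by (intro exI[of _ 1]) simp
  qed
qed

lemma is_interval_sets_lebesgue:
  fixes J :: "real set"
  assumes "is_interval J" shows "J \<in> sets lebesgue"
  using real_interval_borel_measurable[OF assms] by simp

text \<open>The function of a solution is arbitrary off its interval; the graph forgets those values
  and turns extension of solutions into inclusion.\<close>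

definition graph_on :: "real set \<Rightarrow> (real \<Rightarrow> 'a) \<Rightarrow> (real \<times> 'a) set" where
  "graph_on J y = (\<lambda>t. (t, y t)) ` J"

lemma graph_on_subset_iff: "graph_on J y \<subseteq> graph_on J' y' \<longleftrightarrow> J \<subseteq> J' \<and> (\<forall>t\<in>J. y' t = y t)"
  by (auto simp: graph_on_def)

text \<open>Any exceptional point of the union is exceptional for one of countably many members, chosen to contain a rational
  point further to the right, unless it is the right end point.\<close>

lemma is_solution_chain_Union:
  fixes u :: "real \<Rightarrow> real \<times> (real^'k)"
  assumes C: "C \<noteq> {}" and sol: "\<And>J y. (J, y) \<in> C \<Longrightarrow> is_solution f G x0 u J y"
    and chain: "\<And>J y J' y'. (J, y) \<in> C \<Longrightarrow> (J', y') \<in> C \<Longrightarrow> graph_on J y \<subseteq> graph_on J' y' \<or> graph_on J' y' \<subseteq> graph_on J y"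
  obtains y where "is_solution f G x0 u (\<Union>(fst ` C)) y" "graph_on (\<Union>(fst ` C)) y = (\<Union>(J, y)\<in>C. graph_on J y)"
proof -
  define U where "U = \<Union>(fst ` C)"
  have "\<exists>v. \<forall>J' y'. (J', y') \<in> C \<longrightarrow> t \<in> J' \<longrightarrow> v = y' t" if tU: "t \<in> U" for t
  proof -
    obtain J y where Jy: "(J, y) \<in> C" "t \<in> J" using tU by (auto simp: U_def)
    have "y t = y' t" if "(J', y') \<in> C" "t \<in> J'" for J' y'
      using chain[OF Jy(1) that(1)] Jy(2) that(2) unfolding graph_on_subset_iff by auto
    then show ?thesis by blast
  qed
  then obtain y where y0: "\<And>t. t \<in> U \<Longrightarrow> \<forall>J' y'. (J', y') \<in> C \<longrightarrow> t \<in> J' \<longrightarrow> y t = y' t" by metis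
  have y: "y t = y' t" if "(J', y') \<in> C" "t \<in> J'" for t J' y'
  proof -
    have "t \<in> U" using that by (force simp: U_def)
    then show ?thesis using y0 that by blast
  qed
  have D: "is_interval J" "0 \<in> J" "J \<subseteq> {0..}" "abs_cont_on J y'" "y' 0 = x0"
    "negligible {t \<in> J. \<not> (y' has_vector_derivative fst (u t) *\<^sub>R f (y' t) + (\<Sum>i\<in>UNIV. snd (u t) $ i *\<^sub>R G i (y' t))) (at t within J)}"
    if "(J, y') \<in> C" for J y'
  proof -
    have int: "is_interval J" using sol[OF that] by (simp add: is_solution_def)
    then have "J \<in> sets lebesgue" by (rule is_interval_sets_lebesgue)
    with int show "is_interval J" "0 \<in> J" "J \<subseteq> {0..}" "abs_cont_on J y'" "y' 0 = x0"
     "negligible {t \<in> J. \<not> (y' has_vector_derivative fst (u t) *\<^sub>R f (y' t) + (\<Sum>i\<in>UNIV. snd (u t) $ i *\<^sub>R G i (y' t))) (at t within J)}"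
      using sol[OF that] by (auto simp: is_solution_def AE_lebesgue_on_negligible)
  qed
  have two: "\<exists>J y'. (J, y') \<in> C \<and> a \<in> J \<and> b \<in> J" if "a \<in> U" "b \<in> U" for a b
  proof -
    obtain J1 y1 J2 y2 where "(J1, y1) \<in> C" "a \<in> J1" "(J2, y2) \<in> C" "b \<in> J2" using \<open>a \<in> U\<close> \<open>b \<in> U\<close> by (auto simp: U_def)
    moreover from this have "J1 \<subseteq> J2 \<or> J2 \<subseteq> J1" using chain unfolding graph_on_subset_iff by blast
    ultimately show ?thesis by blast
  qed
  have sub: "J \<subseteq> U" if "(J, y') \<in> C" for J y' using that by (force simp: U_def)
  have iU: "is_interval U"
    unfolding is_interval_1
  proof (intro ballI allI impI)
    fix a b x assume "a \<in> U" "b \<in> U" "a \<le> x \<and> x \<le> b"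
    then obtain J y' where J: "(J, y') \<in> C" "a \<in> J" "b \<in> J" using two by blast
    then have "x \<in> J" using D(1)[OF J(1)] \<open>a \<le> x \<and> x \<le> b\<close> unfolding is_interval_1 by blast
    then show "x \<in> U" using sub[OF J(1)] by blast
  qed
  obtain J0 y0 where J0: "(J0, y0) \<in> C" using C by fastforce
  have U0: "0 \<in> U" "y 0 = x0" using D(2,5)[OF J0] sub[OF J0] y[OF J0] by auto
  have Unn: "U \<subseteq> {0..}" using D(3) unfolding U_def by fastforce
  have ac: "abs_cont_on U y"
  proof (rule abs_cont_onI)
    fix a b :: real assume ab: "a \<le> b" "{a..b} \<subseteq> U"
    then have "a \<in> U" "b \<in> U" by auto
    then obtain J y' where J: "(J, y') \<in> C" "a \<in> J" "b \<in> J" using two by blast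
    have "{a..b} \<subseteq> J"
    proof
      fix x assume "x \<in> {a..b}"
      then show "x \<in> J" using D(1)[OF J(1)] J(2,3) unfolding is_interval_1 by (meson atLeastAtMost_iff)
    qed
    then show "abs_cont_on {a..b} y"
      using y[OF J(1)] by (intro abs_cont_on_cong[OF abs_cont_on_subset[OF D(4)[OF J(1)]]]) auto
  qed
  define bad where "bad = (\<lambda>J y'. {t \<in> J. \<not> (y' has_vector_derivative fst (u t) *\<^sub>R f (y' t) + (\<Sum>i\<in>UNIV. snd (u t) $ i *\<^sub>R G i (y' t))) (at t within J)})"
  have "\<exists>p. p \<in> C \<and> q \<in> fst p" if "q \<in> U" for q using that by (auto simp: U_def)
  then obtain pick where pick: "\<And>q. q \<in> U \<Longrightarrow> pick q \<in> C \<and> q \<in> fst (pick q)" by metis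
  have "bad U y \<subseteq> (\<Union>q\<in>\<rat> \<inter> U. bad (fst (pick q)) (snd (pick q))) \<union> {t \<in> U. \<forall>s\<in>U. s \<le> t}"
  proof
    fix t assume t: "t \<in> bad U y"
    then have tU: "t \<in> U" by (simp add: bad_def)
    show "t \<in> (\<Union>q\<in>\<rat> \<inter> U. bad (fst (pick q)) (snd (pick q))) \<union> {t \<in> U. \<forall>s\<in>U. s \<le> t}"
    proof (cases "\<forall>s\<in>U. s \<le> t")
      case False
      then obtain s where s: "s \<in> U" "t < s" by (auto simp: not_le)
      obtain q where q: "q \<in> \<rat>" "t < q" "q < s" using Rats_dense_in_real[OF s(2)] by blast
      have qU: "q \<in> U" using iU tU s q unfolding is_interval_1 by (meson less_imp_le)
      obtain J y' where J: "pick q = (J, y')" by fastforce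
      then have JC: "(J, y') \<in> C" "q \<in> J" using pick[OF qU] by auto
      have tJ: "t \<in> J" using D(1,2)[OF JC(1)] JC(2) q(2) tU Unn unfolding is_interval_1
        by (metis atLeast_iff less_imp_le subsetD)
      \<comment> \<open>\<open>J\<close> contains 0 and a rational q beyond \<open>t\<close>, hence
        agrees with \<open>U\<close> below q.\<close>
      have "at t within J = at t within U"
      proof (rule at_within_nhd[of t "{..<q}"])
        have "x \<in> J" if "x \<in> U" "x < q" for x
          using D(1,2)[OF JC(1)] JC(2) that Unn unfolding is_interval_1 by (metis atLeast_iff less_imp_le subsetD)
        then show "J \<inter> {..<q} - {t} = U \<inter> {..<q} - {t}" using sub[OF JC(1)] by blast
      qed (use q in auto)
      then have "(y has_vector_derivative d) (at t within U)" if "(y' has_vector_derivative d) (at t within J)" for d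
        using has_vector_derivative_transform[OF tJ _ that, of y] y[OF JC(1)] by simp
      moreover have "y t = y' t" using y[OF JC(1) tJ] .
      ultimately have "t \<in> bad J y'" using t tJ unfolding bad_def by auto
      then show ?thesis using q qU J by (auto intro!: bexI[of _ q])
    qed (use tU in auto)
  qed
  moreover have "negligible (\<Union>((\<lambda>q. bad (fst (pick q)) (snd (pick q))) ` (\<rat> \<inter> U)))"
  proof (rule negligible_countable_Union)
    show "countable ((\<lambda>q. bad (fst (pick q)) (snd (pick q))) ` (\<rat> \<inter> U))"
      by (intro countable_image countable_Int1 countable_rat)
    fix S assume "S \<in> (\<lambda>q. bad (fst (pick q)) (snd (pick q))) ` (\<rat> \<inter> U)"
    then obtain q where q: "q \<in> U" "S = bad (fst (pick q)) (snd (pick q))" by blast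
    have "(fst (pick q), snd (pick q)) \<in> C" using pick[OF q(1)] by simp
    from D(6)[OF this] show "negligible S" unfolding q(2) bad_def .
  qed
  moreover have "negligible {t \<in> U. \<forall>s\<in>U. s \<le> t}"
  proof -
    have "\<exists>x. {t \<in> U. \<forall>s\<in>U. s \<le> t} \<subseteq> {x}"
    proof (cases "\<exists>x\<in>U. \<forall>s\<in>U. s \<le> x")
      case True
      then obtain x where "x \<in> U" "\<forall>s\<in>U. s \<le> x" by blast
      then show ?thesis by (intro exI[of _ x]) (auto intro: antisym)
    next
      case False
      then have empty: "{t \<in> U. \<forall>s\<in>U. s \<le> t} = {}" by blast
      show ?thesis unfolding empty by simp
    qed
    then show ?thesis using negligible_subset negligible_sing by blast
  qed
  ultimately have neg: "negligible (bad U y)" by (meson negligible_Un negligible_subset)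
  have "U \<in> sets lebesgue" using iU by (rule is_interval_sets_lebesgue)
  then have "is_solution f G x0 u U y"
    unfolding is_solution_def using iU U0 Unn ac neg unfolding bad_def by (simp add: AE_lebesgue_on_negligible)
  moreover have "graph_on U y = (\<Union>(J, y)\<in>C. graph_on J y)"
    using y unfolding graph_on_def U_def by force
  ultimately show ?thesis using that unfolding U_def by blast
qed

text \<open>Zorn's lemma for graphs ordered by inclusion. This existence is what gives content to
  the choice made in \<open>maximal_solution\<close>.\<close>

lemma maximal_solution_exists:
  fixes u :: "real \<Rightarrow> real \<times> (real^'k)"
  shows "\<exists>J y. is_maximal_solution f G x0 u J y"
proof -
  define P where "P = {(J, y). is_solution f G x0 u J y}"
  define A where "A = (\<lambda>(J, y). graph_on J y) ` P"
  \<comment> \<open>A first solution: {0} is negligible, so the differential equation holds there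
    vacuously.\<close>
  have triv: "is_solution f G x0 u {0} (\<lambda>_. x0)"
  proof -
    have "abs_cont_on {0..0::real} (\<lambda>_. x0)" by (rule abs_cont_on_singleton)
    moreover have "AE t in lebesgue_on {0::real}. Q t" for Q :: "real \<Rightarrow> bool"
      by (subst AE_lebesgue_on_negligible) (auto intro: negligible_subset[of "{0}"])
    ultimately show ?thesis unfolding is_solution_def by (auto simp: is_interval_1)
  qed
  have "\<exists>M\<in>A. \<forall>X\<in>A. M \<subseteq> X \<longrightarrow> X = M"
  proof (rule subset_Zorn_nonempty)
    show "A \<noteq> {}" using triv by (auto simp: A_def P_def)
    fix CC assume CC: "CC \<noteq> {}" "subset.chain A CC"
    define C where "C = {p \<in> P. (\<lambda>(J, y). graph_on J y) p \<in> CC}"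
    have CCeq: "CC = (\<lambda>(J, y). graph_on J y) ` C"
      using CC(2) unfolding C_def A_def subset.chain_def by blast
    obtain y where y: "is_solution f G x0 u (\<Union>(fst ` C)) y" "graph_on (\<Union>(fst ` C)) y = (\<Union>(J, y)\<in>C. graph_on J y)"
    proof (rule is_solution_chain_Union[of C f G x0 u])
      show "C \<noteq> {}" using CC(1) CCeq by auto
      show "is_solution f G x0 u J y" if "(J, y) \<in> C" for J y using that by (simp add: C_def P_def)
      fix J y J' y' assume "(J, y) \<in> C" "(J', y') \<in> C"
      then have "graph_on J y \<in> CC" "graph_on J' y' \<in> CC" by (auto simp: C_def)
      then show "graph_on J y \<subseteq> graph_on J' y' \<or> graph_on J' y' \<subseteq> graph_on J y"
        using CC(2) by (auto simp: subset.chain_def)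
    qed blast
    have "\<Union>CC = graph_on (\<Union>(fst ` C)) y" unfolding y(2) CCeq by auto
    then show "\<Union>CC \<in> A" using y(1) unfolding A_def P_def by force
  qed
  then obtain J y where Jy: "is_solution f G x0 u J y" "\<And>J' y'. is_solution f G x0 u J' y' \<Longrightarrow> graph_on J y \<subseteq> graph_on J' y' \<Longrightarrow> graph_on J' y' = graph_on J y"
    unfolding A_def P_def by auto
  have "J' = J" if "is_solution f G x0 u J' y'" "J \<subseteq> J'" "\<forall>t\<in>J. y' t = y t" for J' y'
  proof -
    have "graph_on J' y' = graph_on J y" using that by (intro Jy(2)) (auto simp: graph_on_subset_iff)
    then have "fst ` graph_on J' y' = fst ` graph_on J y" by simp
    then show ?thesis by (simp add: graph_on_def image_image)
  qed
  then show ?thesis unfolding is_maximal_solution_def using Jy(1) by blast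
qed

lemma trajectory_is_solution:
  fixes u :: "real \<Rightarrow> real \<times> (real^'k)"
  shows "is_solution f G x0 u (trajectory_domain f G x0 u) (trajectory f G x0 u)"
proof -
  have "\<exists>p. is_maximal_solution f G x0 u (fst p) (snd p)" using maximal_solution_exists[of f G x0 u] by auto
  then have "is_maximal_solution f G x0 u (fst (maximal_solution f G x0 u)) (snd (maximal_solution f G x0 u))"
    unfolding maximal_solution_def by (rule someI_ex)
  then show ?thesis by (simp add: is_maximal_solution_def trajectory_domain_def trajectory_def)
qed

section \<open>Lower semicontinuity\<close>

text \<open>The right-hand side as a field that is linear in the control, the form in which the
  stability result takes it.\<close>

definition control_field :: "(real^'n \<Rightarrow> real^'n) \<Rightarrow> ('k::finite \<Rightarrow> real^'n \<Rightarrow> real^'n) \<Rightarrow> real^'n \<Rightarrow> real \<times> (real^'k) \<Rightarrow> real^'n" where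
  "control_field f G x \<zeta> = fst \<zeta> *\<^sub>R f x + (\<Sum>i\<in>UNIV. snd \<zeta> $ i *\<^sub>R G i x)"

lemma linear_control_field: "linear (control_field f G x)"
  by (rule linearI) (simp_all add: control_field_def scaleR_add_left sum.distrib scaleR_add_right scaleR_sum_right)

lemma local_lipschitz_norm_le:
  fixes f :: "'a::euclidean_space \<Rightarrow> 'b::euclidean_space"
  assumes "local_lipschitz (UNIV :: real set) UNIV (\<lambda>_. f)"
  shows "\<exists>K\<ge>0. \<forall>x\<in>cball 0 B. \<forall>x'\<in>cball 0 B. norm (f x - f x') \<le> K * norm (x - x')"
proof -
  have ll: "local_lipschitz {0::real} (cball 0 B) (\<lambda>_. f)"
    using assms by (rule local_lipschitz_subset) auto
  obtain K where "\<And>t. t \<in> {0::real} \<Longrightarrow> K-lipschitz_on (cball 0 B) f"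
    by (rule local_lipschitz_compact_implies_lipschitz[where X="cball 0 B" and T="{0::real}" and f="\<lambda>_. f"]) (use ll in auto)
  then have "K-lipschitz_on (cball 0 B) f" by simp
  then show ?thesis
    unfolding lipschitz_on_def by (auto simp: dist_norm)
qed

lemma control_field_Lipschitz:
  fixes f :: "real^'n \<Rightarrow> real^'n" and G :: "'k::finite \<Rightarrow> real^'n \<Rightarrow> real^'n"
  assumes f: "local_lipschitz (UNIV :: real set) UNIV (\<lambda>_. f)"
    and G: "\<And>i. local_lipschitz (UNIV :: real set) UNIV (\<lambda>_. G i)"
  shows "\<exists>K. \<forall>x\<in>cball 0 B. \<forall>x'\<in>cball 0 B. \<forall>\<zeta>.
    norm (control_field f G x \<zeta> - control_field f G x' \<zeta>) \<le> K * norm (x - x') * norm \<zeta>"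
proof -
  obtain Kf where Kf: "0 \<le> Kf" "\<forall>x\<in>cball 0 B. \<forall>x'\<in>cball 0 B. norm (f x - f x') \<le> Kf * norm (x - x')"
    using local_lipschitz_norm_le[OF f] by blast
  have "\<forall>i. \<exists>K\<ge>0. \<forall>x\<in>cball 0 B. \<forall>x'\<in>cball 0 B. norm (G i x - G i x') \<le> K * norm (x - x')"
    using local_lipschitz_norm_le[OF G] by blast
  then obtain KG where KG: "\<And>i. 0 \<le> KG i" "\<And>i. \<forall>x\<in>cball 0 B. \<forall>x'\<in>cball 0 B. norm (G i x - G i x') \<le> KG i * norm (x - x')"
    by metis
  show ?thesis
  proof (intro exI[of _ "Kf + (\<Sum>i\<in>UNIV. KG i)"] ballI allI)
    fix x x' :: "real^'n" and \<zeta> :: "real \<times> (real^'k)" assume x: "x \<in> cball 0 B" "x' \<in> cball 0 B"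
    obtain v w where \<zeta>: "\<zeta> = (v, w)" by fastforce
    have v: "\<bar>v\<bar> \<le> norm \<zeta>" and w: "\<bar>w $ i\<bar> \<le> norm \<zeta>" for i
      using norm_fst_le[of v w] norm_snd_le[of w v] component_le_norm_cart[of w i] unfolding \<zeta> by auto
    have "control_field f G x \<zeta> - control_field f G x' \<zeta> = v *\<^sub>R (f x - f x') + (\<Sum>i\<in>UNIV. w $ i *\<^sub>R (G i x - G i x'))"
      by (simp add: control_field_def \<zeta> scaleR_diff_right sum_subtractf)
    also have "norm \<dots> \<le> norm (v *\<^sub>R (f x - f x')) + (\<Sum>i\<in>UNIV. norm (w $ i *\<^sub>R (G i x - G i x')))"
      by (intro order_trans[OF norm_triangle_ineq] add_left_mono norm_sum)
    also have "\<dots> \<le> norm \<zeta> * (Kf * norm (x - x')) + (\<Sum>i\<in>UNIV. norm \<zeta> * (KG i * norm (x - x')))"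
      unfolding norm_scaleR using v w Kf KG x by (intro add_mono sum_mono mult_mono) auto
    also have "\<dots> = (Kf + (\<Sum>i\<in>UNIV. KG i)) * norm (x - x') * norm \<zeta>"
    proof -
      have "(\<Sum>i\<in>UNIV. norm \<zeta> * (KG i * norm (x - x'))) = norm \<zeta> * norm (x - x') * (\<Sum>i\<in>UNIV. KG i)"
        unfolding sum_distrib_left by (intro sum.cong) (simp_all add: mult_ac)
      then show ?thesis by (simp add: algebra_simps)
    qed
    finally show "norm (control_field f G x \<zeta> - control_field f G x' \<zeta>) \<le> (Kf + (\<Sum>i\<in>UNIV. KG i)) * norm (x - x') * norm \<zeta>" .
  qed
qed

text \<open>Membership in {..e} is the form in which \<open>integral_restrict_Int\<close> recognizes
  a restricted integrand.\<close>

lemma integral_stopped: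
  fixes \<xi> :: "real \<Rightarrow> 'a::euclidean_space"
  shows "integral {0..t} (\<lambda>r. if r \<in> {..e} then \<xi> r else 0) = integral {0..min t e} \<xi>"
proof -
  have "{..e} \<inter> {0..t} = {0..min t e}" by auto
  then show ?thesis by (simp only: integral_restrict_Int)
qed

lemma absolutely_integrable_stopped:
  fixes \<xi> :: "real \<Rightarrow> 'a::euclidean_space"
  assumes \<xi>: "\<xi> absolutely_integrable_on {0..e}"
  shows "(\<lambda>r. if r \<in> {..e} then \<xi> r else 0) absolutely_integrable_on {0..t}"
proof -
  have eq: "{..e} \<inter> {0..t} = {0..min t e}" by auto
  have "\<xi> absolutely_integrable_on {0..min t e}"
    by (rule absolutely_integrable_on_subinterval[OF \<xi>]) auto
  moreover have "(\<lambda>r. norm (if r \<in> {..e} then \<xi> r else 0)) = (\<lambda>r. if r \<in> {..e} then norm (\<xi> r) else 0)" by auto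
  ultimately show ?thesis
    unfolding absolutely_integrable_on_def by (simp only: integrable_restrict_Int eq)
qed

text \<open>The sign of the derivative is recovered from monotonicity, which is known for every
  member of a class. Quotients to the right of t also serve at t = 0.\<close>

lemma control_curve_ae:
  assumes g: "control_curve T g"
  shows "\<exists>N. negligible N \<and> (\<forall>t. 0 \<le> t \<longrightarrow> t \<notin> N \<longrightarrow>
    (g has_vector_derivative curve_deriv g t) (at t within {0..}) \<and> 0 \<le> fst (curve_deriv g t))"
proof -
  have ac: "abs_cont_on {0..} g" and mono: "mono_on {0..} (\<lambda>t. fst (g t))" using g by (auto simp: control_curve_def)
  obtain N where N: "negligible N"
    "\<And>t. 0 \<le> t \<Longrightarrow> t \<notin> N \<Longrightarrow> (g has_vector_derivative curve_deriv g t) (at t within {0..})"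
    using curve_deriv_ae[OF ac] by blast
  have "0 \<le> fst (curve_deriv g t)" if t: "0 \<le> t" "t \<notin> N" for t
  proof -
    have "(g has_vector_derivative curve_deriv g t) (at t within {t..})"
      by (rule has_vector_derivative_within_subset[OF N(2)[OF t]]) (use t in auto)
    then have "((\<lambda>s. fst (g s)) has_vector_derivative fst (curve_deriv g t)) (at t within {t..})"
      by (rule bounded_linear.has_vector_derivative[OF bounded_linear_fst])
    then have "((\<lambda>s. (fst (g s) - fst (g t)) / (s - t)) \<longlongrightarrow> fst (curve_deriv g t)) (at_right t)"
      unfolding has_real_derivative_iff_has_vector_derivative[symmetric] has_field_derivative_iff at_within_Ici_at_right .
    moreover have "\<forall>\<^sub>F s in at_right t. 0 \<le> (fst (g s) - fst (g t)) / (s - t)"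
      using eventually_at_right_less[of t]
    proof eventually_elim
      case (elim s)
      then have "fst (g t) \<le> fst (g s)" using t by (intro mono_onD[OF mono]) auto
      then show ?case using elim by simp
    qed
    ultimately show ?thesis by (rule tendsto_lowerbound) simp
  qed
  then show ?thesis using N by blast
qed

lemma trajectory_has_integral:
  fixes g :: "real \<Rightarrow> real \<times> (real^'k)" and f :: "real^'n \<Rightarrow> real^'n"
  assumes dom: "{0..e} \<subseteq> trajectory_domain f G x0 (curve_deriv g)" and e: "0 \<le> e"
  defines "y \<equiv> trajectory f G x0 (curve_deriv g)"
  shows "continuous_on {0..e} y" "y 0 = x0"
    "\<And>t. 0 \<le> t \<Longrightarrow> t \<le> e \<Longrightarrow> ((\<lambda>r. control_field f G (y r) (curve_deriv g r)) has_integral (y t - x0)) {0..t}"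
proof -
  define J where "J = trajectory_domain f G x0 (curve_deriv g)"
  have sol: "is_solution f G x0 (curve_deriv g) J y" unfolding J_def y_def by (rule trajectory_is_solution)
  then have J: "is_interval J" "abs_cont_on J y" and y0: "y 0 = x0" by (auto simp: is_solution_def)
  define N where "N = {t \<in> J. \<not> (y has_vector_derivative control_field f G (y t) (curve_deriv g t)) (at t within J)}"
  have N: "negligible N"
    using sol is_interval_sets_lebesgue[OF J(1)] unfolding is_solution_def N_def control_field_def
    by (simp add: AE_lebesgue_on_negligible)
  have ac: "abs_cont_on {0..e} y" using abs_cont_on_subset[OF J(2)] dom unfolding J_def by blast
  show "continuous_on {0..e} y" by (rule abs_cont_on_continuous_on[OF ac]) simp
  show "y 0 = x0" by (rule y0)
  fix t assume t: "0 \<le> t" "t \<le> e"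
  have "((\<lambda>r. control_field f G (y r) (curve_deriv g r)) has_integral (y t - y 0)) {0..t}"
  proof (rule abs_cont_on_has_integral[OF t(1) _ N])
    show "abs_cont_on {0..t} y" using t by (intro abs_cont_on_subset[OF ac]) auto
    fix s assume s: "s \<in> {0..t} - N"
    have sub: "{0..t} \<subseteq> J" using dom t unfolding J_def by auto
    have "(y has_vector_derivative control_field f G (y s) (curve_deriv g s)) (at s within J)" using s sub by (auto simp: N_def)
    then show "(y has_vector_derivative control_field f G (y s) (curve_deriv g s)) (at s within {0..t})"
      by (rule has_vector_derivative_within_subset) (rule sub)
  qed
  then show "((\<lambda>r. control_field f G (y r) (curve_deriv g r)) has_integral (y t - x0)) {0..t}" by (simp add: y0)
qed

text \<open>Stopping at the end time makes curves with different end times comparable on the whole half-line.\<close>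

lemma stopped_trajectory:
  fixes g :: "real \<Rightarrow> real \<times> (real^'k)" and f :: "real^'n \<Rightarrow> real^'n"
  assumes g: "control_curve T g" and T: "0 < T"
    and dom: "{0..end_time T g} \<subseteq> trajectory_domain f G x0 (curve_deriv g)"
  defines "e \<equiv> end_time T g"
  defines "\<xi> \<equiv> (\<lambda>r. if r \<in> {..end_time T g} then curve_deriv g r else 0)"
  defines "y \<equiv> (\<lambda>t. trajectory f G x0 (curve_deriv g) (min t (end_time T g)))"
  shows "0 \<le> t \<Longrightarrow> \<xi> absolutely_integrable_on {0..t}"
    "0 \<le> t \<Longrightarrow> integral {0..t} \<xi> = g (min t e)"
    "0 \<le> t \<Longrightarrow> integral {0..t} (\<lambda>r. norm (\<xi> r)) \<le> truncated_length T g"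
    "continuous_on {0..} y"
    "0 \<le> t \<Longrightarrow> y t = x0 + integral {0..t} (\<lambda>r. control_field f G (y r) (\<xi> r))"
proof -
  have ac: "abs_cont_on {0..} g" and g0: "g 0 = 0" using g by (auto simp: control_curve_def)
  have e: "0 < e" unfolding e_def by (rule end_time_props(1)[OF g T])
  have ai: "curve_deriv g absolutely_integrable_on {0..e}" using e by (intro curve_deriv_has_integral(2)[OF ac]) auto
  show "\<xi> absolutely_integrable_on {0..t}" unfolding \<xi>_def e_def[symmetric] by (rule absolutely_integrable_stopped[OF ai])
  show "integral {0..t} \<xi> = g (min t e)" if t: "0 \<le> t"
  proof -
    have "integral {0..t} \<xi> = integral {0..min t e} (curve_deriv g)" unfolding \<xi>_def e_def[symmetric] by (rule integral_stopped)
    also have "\<dots> = g (min t e) - g 0" using t e by (intro integral_unique curve_deriv_has_integral(1)[OF ac]) auto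
    finally show ?thesis by (simp add: g0)
  qed
  show "integral {0..t} (\<lambda>r. norm (\<xi> r)) \<le> truncated_length T g" if t: "0 \<le> t"
  proof -
    have ni: "(\<lambda>r. norm (curve_deriv g r)) integrable_on {0..s}" if "0 \<le> s" for s
      using absolutely_integrable_norm[OF curve_deriv_has_integral(2)[OF ac order_refl that]]
      by (simp add: set_lebesgue_integral_eq_integral(1) o_def)
    have "(\<lambda>r. norm (\<xi> r)) = (\<lambda>r. if r \<in> {..e} then norm (curve_deriv g r) else 0)" by (auto simp: \<xi>_def e_def)
    then have "integral {0..t} (\<lambda>r. norm (\<xi> r)) = integral {0..min t e} (\<lambda>r. norm (curve_deriv g r))"
      by (simp only: integral_stopped)
    also have "\<dots> \<le> integral {0..e} (\<lambda>r. norm (curve_deriv g r))"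
      using t e by (intro integral_subset_le ni) auto
    also have "\<dots> = truncated_length T g"
      unfolding truncated_length_def e_def[symmetric] using e by (intro curve_length_eq_integral[OF ac, symmetric]) simp
    finally show ?thesis .
  qed
  define Y where "Y = trajectory f G x0 (curve_deriv g)"
  note traj = trajectory_has_integral[OF dom less_imp_le[OF e[unfolded e_def]], folded Y_def, folded e_def]
  show "continuous_on {0..} y"
    unfolding y_def Y_def[symmetric] e_def[symmetric] using e
    by (intro continuous_on_compose2[OF traj(1)] continuous_intros) auto
  show "y t = x0 + integral {0..t} (\<lambda>r. control_field f G (y r) (\<xi> r))" if t: "0 \<le> t"
  proof -
    \<comment> \<open>Beyond the end time the control is 0, and with it the field; before it the
      stopped trajectory is the original one.\<close>
    have "(\<lambda>r. control_field f G (y r) (\<xi> r)) = (\<lambda>r. if r \<in> {..e} then control_field f G (Y r) (curve_deriv g r) else 0)"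
      by (auto simp: \<xi>_def y_def Y_def e_def control_field_def fun_eq_iff min_def)
    then have "integral {0..t} (\<lambda>r. control_field f G (y r) (\<xi> r)) = integral {0..min t e} (\<lambda>r. control_field f G (Y r) (curve_deriv g r))"
      by (simp only: integral_stopped)
    also have "\<dots> = Y (min t e) - x0" using t e by (intro integral_unique traj(3)) auto
    finally show ?thesis by (simp add: y_def Y_def e_def)
  qed
qed

text \<open>The homogeneous minorants are integrated cell by cell; since \<open>z i\<close> is
  constant on its cell, only the increments of the curve \<open>h\<close> remain, and the errors sum
  to \<epsilon> times the length.\<close>

lemma cost_lower_bound:
  fixes \<eta> :: "real \<Rightarrow> real \<times> (real^'k)"
  assumes e: "0 < e" and \<eta>: "\<eta> absolutely_integrable_on {0..e}"
    and h: "\<And>s t. 0 \<le> s \<Longrightarrow> s \<le> t \<Longrightarrow> t \<le> e \<Longrightarrow> integral {s..t} \<eta> = h t - h s"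
    and N: "negligible N" "\<And>t. t \<in> {0..e} - N \<Longrightarrow> 0 \<le> fst (\<eta> t)"
    and \<sigma>: "\<sigma> 0 = 0" "\<sigma> m = e" "\<And>i. i < m \<Longrightarrow> \<sigma> i \<le> \<sigma> (Suc i)"
    and le: "\<And>i s v w. i < m \<Longrightarrow> \<sigma> i \<le> s \<Longrightarrow> s < \<sigma> (Suc i) \<Longrightarrow> 0 \<le> v \<Longrightarrow>
      ereal (z i \<bullet> (v, w) - \<epsilon> * norm (v, w)) \<le> ext_lagrangian L (x s) v w"
  shows "ereal ((\<Sum>i<m. z i \<bullet> (h (\<sigma> (Suc i)) - h (\<sigma> i))) - \<epsilon> * integral {0..e} (\<lambda>r. norm (\<eta> r)))
    \<le> ereal_integral (lebesgue_on {0..e}) (\<lambda>s. ext_lagrangian L (x s) (fst (\<eta> s)) (snd (\<eta> s)))"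
proof -
  have mono: "\<sigma> i \<le> \<sigma> j" if "i \<le> j" "j \<le> m" for i j
    using that
  proof (induction j rule: dec_induct)
    case (step j)
    then show ?case using \<sigma>(3)[of j] by simp
  qed simp
  have rng: "0 \<le> \<sigma> i" "\<sigma> i \<le> e" if "i \<le> m" for i using mono[of 0 i] mono[of i m] that \<sigma>(1,2) by auto
  \<comment> \<open>Half-open cells are disjoint, also when \<sigma> takes the same value twice and
    a cell is empty.\<close>
  define I where "I = (\<lambda>i. {\<sigma> i..<\<sigma> (Suc i)})"
  define k where "k = (\<lambda>i s. if s \<in> I i then z i \<bullet> \<eta> s else 0)"
  define \<Psi> where "\<Psi> = (\<lambda>s. (\<Sum>i<m. k i s) - \<epsilon> * norm (\<eta> s))"
  have zi: "(\<lambda>s. z i \<bullet> \<eta> s) absolutely_integrable_on {0..e}" for i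
    using absolutely_integrable_linear[OF \<eta> bounded_linear_inner_right[of "z i"]] by (simp add: o_def)
  have ki: "k i absolutely_integrable_on {0..e}" for i
  proof -
    have "(\<lambda>s. indicat_real (I i) s * (z i \<bullet> \<eta> s)) absolutely_integrable_on {0..e}"
    proof (rule absolutely_integrable_bounded_measurable_product_real[OF _ _ _ zi])
      have "indicat_real (I i) \<in> borel_measurable lebesgue" unfolding I_def by (intro borel_measurable_indicator) auto
      then show "indicat_real (I i) \<in> borel_measurable (lebesgue_on {0..e})" by (rule measurable_restrict_space1)
      show "bounded (indicat_real (I i) ` {0..e})" unfolding bounded_iff by (intro exI[of _ 1]) (auto simp: indicator_def)
    qed simp
    moreover have "k i = (\<lambda>s. indicat_real (I i) s * (z i \<bullet> \<eta> s))" by (auto simp: k_def indicator_def)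
    ultimately show ?thesis by simp
  qed
  have kint: "integral {0..e} (k i) = z i \<bullet> (h (\<sigma> (Suc i)) - h (\<sigma> i))" if i: "i < m" for i
  proof -
    have r: "0 \<le> \<sigma> i" "\<sigma> i \<le> \<sigma> (Suc i)" "\<sigma> (Suc i) \<le> e" using rng[of i] rng[of "Suc i"] \<sigma>(3)[OF i] i by auto
    have "I i \<inter> {0..e} = I i" using r by (auto simp: I_def)
    then have "integral {0..e} (k i) = integral (I i) (\<lambda>s. z i \<bullet> \<eta> s)" unfolding k_def by (simp only: integral_restrict_Int)
    also have "\<dots> = integral {\<sigma> i..\<sigma> (Suc i)} (\<lambda>s. z i \<bullet> \<eta> s)"
      unfolding I_def by (rule integral_subset_negligible) (auto intro: negligible_subset[of "{\<sigma> (Suc i)}"])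
    also have "\<dots> = z i \<bullet> integral {\<sigma> i..\<sigma> (Suc i)} \<eta>"
    proof -
      have "\<eta> absolutely_integrable_on {\<sigma> i..\<sigma> (Suc i)}" using r by (intro absolutely_integrable_on_subinterval[OF \<eta>]) auto
      then have "\<eta> integrable_on {\<sigma> i..\<sigma> (Suc i)}" by (rule set_lebesgue_integral_eq_integral(1))
      from integral_linear[OF this bounded_linear_inner_right[of "z i"]] show ?thesis by (simp add: o_def)
    qed
    finally show ?thesis using h[OF r] by simp
  qed
  have ni: "(\<lambda>s. norm (\<eta> s)) absolutely_integrable_on {0..e}" using absolutely_integrable_norm[OF \<eta>] by (simp add: o_def)
  have sk: "(\<lambda>s. \<Sum>i<m. k i s) absolutely_integrable_on {0..e}" by (intro absolutely_integrable_sum ki) auto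
  have nk: "(\<lambda>s. \<epsilon> * norm (\<eta> s)) absolutely_integrable_on {0..e}"
    using absolutely_integrable_scaleR_left[OF ni, of \<epsilon>] by simp
  have \<Psi>: "\<Psi> absolutely_integrable_on {0..e}"
    unfolding \<Psi>_def by (rule set_integral_diff(1)[OF sk nk])
  have int: "integrable (lebesgue_on {0..e}) \<Psi>" by (rule absolutely_integrable_imp_integrable[OF \<Psi>]) simp
  note hk = set_lebesgue_integral_eq_integral(1)
  have "integral\<^sup>L (lebesgue_on {0..e}) \<Psi> = integral {0..e} \<Psi>" by (rule lebesgue_integral_eq_integral[OF int]) simp
  also have "\<dots> = integral {0..e} (\<lambda>s. \<Sum>i<m. k i s) - integral {0..e} (\<lambda>s. \<epsilon> * norm (\<eta> s))"
    unfolding \<Psi>_def by (rule Henstock_Kurzweil_Integration.integral_diff[OF hk[OF sk] hk[OF nk]])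
  also have "integral {0..e} (\<lambda>s. \<Sum>i<m. k i s) = (\<Sum>i<m. z i \<bullet> (h (\<sigma> (Suc i)) - h (\<sigma> i)))"
    using kint by (subst Henstock_Kurzweil_Integration.integral_sum) (auto intro: hk[OF ki])
  also have "integral {0..e} (\<lambda>s. \<epsilon> * norm (\<eta> s)) = \<epsilon> * integral {0..e} (\<lambda>s. norm (\<eta> s))" by simp
  finally have eq: "integral\<^sup>L (lebesgue_on {0..e}) \<Psi> = (\<Sum>i<m. z i \<bullet> (h (\<sigma> (Suc i)) - h (\<sigma> i))) - \<epsilon> * integral {0..e} (\<lambda>s. norm (\<eta> s))" .
  have cover: "\<exists>i<m. s \<in> I i" if s: "0 \<le> s" "s < e" for s
  proof -
    have "s < \<sigma> j \<Longrightarrow> j \<le> m \<Longrightarrow> \<exists>i<j. s \<in> I i" for j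
    proof (induction j)
      case 0
      then show ?case using s \<sigma>(1) by simp
    next
      case (Suc j)
      show ?case
      proof (cases "s < \<sigma> j")
        case True
        then show ?thesis using Suc by (meson Suc_leD less_SucI)
      next
        case False
        then show ?thesis using Suc.prems(1) by (intro exI[of _ j]) (simp add: I_def)
      qed
    qed
    then show ?thesis using s \<sigma>(2) by simp
  qed
  \<comment> \<open>The point \<open>e\<close> lies in no half-open cell and is discarded together
    with \<open>N\<close>.\<close>
  have "AE s in lebesgue_on {0..e}. s \<in> {0..<e} - N"
  proof -
    have "{t \<in> {0..e}. t \<notin> {0..<e} - N} \<subseteq> insert e N" by auto
    then have "negligible {t \<in> {0..e}. t \<notin> {0..<e} - N}" using N(1) by (meson negligible_insert negligible_subset)
    then show ?thesis by (subst AE_lebesgue_on_negligible) auto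
  qed
  then have "AE s in lebesgue_on {0..e}. ereal (\<Psi> s) \<le> ext_lagrangian L (x s) (fst (\<eta> s)) (snd (\<eta> s))"
  proof eventually_elim
    case (elim s)
    obtain i where i: "i < m" "s \<in> I i" using cover[of s] elim by auto
    have "s \<notin> I j" if j: "j < m" "j \<noteq> i" for j
    proof (cases "j < i")
      case True
      then have "\<sigma> (Suc j) \<le> \<sigma> i" using i(1) by (intro mono) auto
      then show ?thesis using i(2) by (auto simp: I_def)
    next
      case False
      then have "\<sigma> (Suc i) \<le> \<sigma> j" using j by (intro mono) auto
      then show ?thesis using i(2) by (auto simp: I_def)
    qed
    then have "k j s = (if j = i then z i \<bullet> \<eta> s else 0)" if "j < m" for j using that i(2) by (auto simp: k_def)
    then have "(\<Sum>j<m. k j s) = (\<Sum>j<m. if j = i then z i \<bullet> \<eta> s else 0)" by (intro sum.cong) auto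
    also have "\<dots> = z i \<bullet> \<eta> s" using i(1) by simp
    finally have "\<Psi> s = z i \<bullet> (fst (\<eta> s), snd (\<eta> s)) - \<epsilon> * norm (fst (\<eta> s), snd (\<eta> s))" by (simp add: \<Psi>_def)
    moreover have "0 \<le> fst (\<eta> s)" using N(2)[of s] elim by auto
    ultimately show ?case using le[OF i(1), of s "fst (\<eta> s)" "snd (\<eta> s)"] i(2) by (simp add: I_def)
  qed
  then have "ereal_integral (lebesgue_on {0..e}) (\<lambda>s. ereal (\<Psi> s)) \<le> ereal_integral (lebesgue_on {0..e}) (\<lambda>s. ext_lagrangian L (x s) (fst (\<eta> s)) (snd (\<eta> s)))"
    by (rule ereal_integral_mono_AE)
  then show ?thesis unfolding ereal_integral_of_integrable[OF int] eq .
qed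

text \<open>The theorem for curves instead of classes. The finite grid sum of \<open>g\<close> is
  transported to a nearby curve by the reparametrization, where the same minorants still bound the
  integrand from below.\<close>

lemma lower_semicontinuity_step:
  fixes T :: real
    and f :: "real^'n \<Rightarrow> real^'n"
    and G :: "'k::finite \<Rightarrow> real^'n \<Rightarrow> real^'n"
    and g :: "real \<Rightarrow> real \<times> (real^'k)"
    and L :: "real^'n \<Rightarrow> real^'k \<Rightarrow> real"
  assumes T: "0 < T"
    and f: "local_lipschitz (UNIV :: real set) UNIV (\<lambda>_. f)"
    and G: "\<And>i. local_lipschitz (UNIV :: real set) UNIV (\<lambda>_. G i)"
    and cont: "continuous_on UNIV (\<lambda>(x, u). L x u)"
    and conv: "\<And>x. convex_on UNIV (L x)"
    and g: "control_curve T g" and dom: "{0..end_time T g} \<subseteq> trajectory_domain f G x0 (curve_deriv g)"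
    and c: "ereal c1 < curve_cost f G x0 L T g"
  shows "\<exists>\<delta>>0. \<forall>h. control_curve T h \<longrightarrow> {0..end_time T h} \<subseteq> trajectory_domain f G x0 (curve_deriv h) \<longrightarrow>
    truncated_length T h \<le> truncated_length T g + 1 \<longrightarrow>
    frechet_close (\<lambda>t. g (min t (end_time T g))) (\<lambda>t. h (min t (end_time T h))) (2 * \<delta>) \<longrightarrow>
    ereal c1 < curve_cost f G x0 L T h"
proof -
  \<comment> \<open>The gap between \<open>c1\<close> and \<open>c2\<close> is what the errors may
    consume.\<close>
  obtain c2 where c2: "c1 < c2" "ereal c2 < curve_cost f G x0 L T g" using ereal_dense2[OF c] by auto
  define e where "e = end_time T g"
  have e: "0 < e" unfolding e_def by (rule end_time_props(1)[OF g T])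
  have ac: "abs_cont_on {0..} g" using g by (simp add: control_curve_def)
  define \<Lambda> where "\<Lambda> = truncated_length T g + 1"
  define \<kappa> where "\<kappa> = c2 - c1"
  have len0: "0 \<le> truncated_length T h" for h :: "real \<Rightarrow> real \<times> (real^'k)"
    unfolding truncated_length_def curve_length_def set_lebesgue_integral_def by (intro integral_nonneg_AE) auto
  have \<Lambda>: "1 \<le> \<Lambda>" unfolding \<Lambda>_def using len0[of g] by simp
  have \<kappa>: "0 < \<kappa>" using c2(1) by (simp add: \<kappa>_def)
  \<comment> \<open>\<Lambda> bounds the lengths of all curves considered, so the error \<epsilon>
    times the length is at most \<kappa>/4.\<close>
  define \<epsilon> where "\<epsilon> = \<kappa> / (4 * \<Lambda>)"
  have \<epsilon>: "0 < \<epsilon>" "\<epsilon> * \<Lambda> = \<kappa> / 4" using \<Lambda> \<kappa> by (auto simp: \<epsilon>_def)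
  define y where "y = trajectory f G x0 (curve_deriv g)"
  have dom': "{0..e} \<subseteq> trajectory_domain f G x0 (curve_deriv g)" using dom by (simp add: e_def)
  note traj = trajectory_has_integral[OF dom' less_imp_le[OF e], folded y_def]
  obtain N where N: "negligible N" "\<And>t. 0 \<le> t \<Longrightarrow> t \<notin> N \<Longrightarrow>
      (g has_vector_derivative curve_deriv g t) (at t within {0..}) \<and> 0 \<le> fst (curve_deriv g t)"
    using control_curve_ae[OF g] by blast
  have "\<exists>m z \<rho>. 0 < m \<and> 0 < \<rho> \<and>
    (\<forall>i<m. \<forall>t. real i * (e / real m) \<le> t \<longrightarrow> t \<le> real (Suc i) * (e / real m) \<longrightarrow> (\<forall>x. norm (x - y t) \<le> \<rho> \<longrightarrow>
      (\<forall>v w. 0 \<le> v \<longrightarrow> ereal (z i \<bullet> (v, w) - \<epsilon> * norm (v, w)) \<le> ext_lagrangian L x v w))) \<and>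
    c2 < (\<Sum>i<m. z i \<bullet> (g (real (Suc i) * (e / real m)) - g (real i * (e / real m))))"
  proof (rule cost_approximation[OF e _ _ N(1) _ traj(1) cont conv \<epsilon>(1)])
    show ai: "curve_deriv g absolutely_integrable_on {0..e}" using e by (intro curve_deriv_has_integral(2)[OF ac]) auto
    show "norm (g t - g s) \<le> integral {s..t} (\<lambda>r. norm (curve_deriv g r))" if st: "0 \<le> s" "s \<le> t" "t \<le> e" for s t
    proof -
      have i: "(curve_deriv g has_integral (g t - g s)) {s..t}" "curve_deriv g absolutely_integrable_on {s..t}"
        using curve_deriv_has_integral[OF ac st(1,2)] by auto
      have "norm (integral {s..t} (curve_deriv g)) \<le> 1 * integral {s..t} (\<lambda>r. norm (curve_deriv g r))"
        by (rule norm_integral_le_weighted[OF _ i(2)]) (use i(1) in auto)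
      then show ?thesis using integral_unique[OF i(1)] by simp
    qed
    show "(g has_vector_derivative curve_deriv g t) (at t within {0..e}) \<and> 0 \<le> fst (curve_deriv g t)" if t: "t \<in> {0..e} - N" for t
    proof -
      have "0 \<le> t" "t \<notin> N" using t by auto
      note n = N(2)[OF this]
      have "(g has_vector_derivative curve_deriv g t) (at t within {0..e})"
        by (rule has_vector_derivative_within_subset[OF conjunct1[OF n]]) auto
      then show ?thesis using n by blast
    qed
    show "ereal c2 < ereal_integral (lebesgue_on {0..e}) (\<lambda>t. ext_lagrangian L (y t) (fst (curve_deriv g t)) (snd (curve_deriv g t)))"
      using c2(2) unfolding curve_cost_def e_def y_def .
  qed
  then obtain m z \<rho> where m: "0 < m" and \<rho>: "0 < \<rho>"
    and min0: "\<forall>i<m. \<forall>t. real i * (e / real m) \<le> t \<longrightarrow> t \<le> real (Suc i) * (e / real m) \<longrightarrow> (\<forall>x. norm (x - y t) \<le> \<rho> \<longrightarrow>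
      (\<forall>v w. 0 \<le> v \<longrightarrow> ereal (z i \<bullet> (v, w) - \<epsilon> * norm (v, w)) \<le> ext_lagrangian L x v w))"
    and sum: "c2 < (\<Sum>i<m. z i \<bullet> (g (real (Suc i) * (e / real m)) - g (real i * (e / real m))))"
    by (elim exE conjE) (rule that)
  note min = min0[rule_format]
  define \<tau> where "\<tau> = (\<lambda>i. real i * (e / real m))"
  have \<tau>: "\<tau> 0 = 0" "\<tau> m = e" "0 \<le> \<tau> i" for i
    using m e by (auto simp: \<tau>_def)
  have \<tau>mono: "\<tau> i \<le> \<tau> (Suc i)" for i
    unfolding \<tau>_def using e by (intro mult_right_mono) auto
  have \<tau>e: "\<tau> i \<le> e" if "i \<le> m" for i
  proof -
    have "real i * (e / real m) \<le> real m * (e / real m)" using that e by (intro mult_right_mono) auto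
    then show ?thesis using m by (simp add: \<tau>_def)
  qed
  note st = stopped_trajectory[OF g T dom]
  have "\<exists>\<delta>>0. \<forall>\<alpha> \<beta> \<eta> x. reparam \<alpha> \<beta> \<longrightarrow>
    (\<forall>t\<ge>0. \<eta> absolutely_integrable_on {0..t} \<and> integral {0..t} (\<lambda>r. norm (\<eta> r)) \<le> \<Lambda>) \<longrightarrow>
    continuous_on {0..} x \<longrightarrow> (\<forall>t\<ge>0. x t = x0 + integral {0..t} (\<lambda>r. control_field f G (x r) (\<eta> r))) \<longrightarrow>
    (\<forall>t\<ge>0. norm (integral {0..t} (\<lambda>r. if r \<in> {..end_time T g} then curve_deriv g r else 0) - integral {0..\<alpha> t} \<eta>) \<le> \<delta>) \<longrightarrow>
    (\<forall>t\<ge>0. norm (trajectory f G x0 (curve_deriv g) (min t (end_time T g)) - x (\<alpha> t)) \<le> \<rho>)"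
  proof (rule trajectory_stability[where e="end_time T g", OF linear_control_field control_field_Lipschitz[OF f G] st(1) _ st(4) st(5) _ _ \<rho>])
    show "integral {0..t} (\<lambda>r. norm (if r \<in> {..end_time T g} then curve_deriv g r else 0)) \<le> \<Lambda>" if "0 \<le> t" for t
      using st(3)[OF that] by (simp add: \<Lambda>_def)
    show "0 \<le> end_time T g" using e by (simp add: e_def)
  qed auto
  then obtain \<delta>1 where \<delta>1: "0 < \<delta>1" and stab0: "\<forall>\<alpha> \<beta> \<eta> x. reparam \<alpha> \<beta> \<longrightarrow>
    (\<forall>t\<ge>0. \<eta> absolutely_integrable_on {0..t} \<and> integral {0..t} (\<lambda>r. norm (\<eta> r)) \<le> \<Lambda>) \<longrightarrow>
    continuous_on {0..} x \<longrightarrow> (\<forall>t\<ge>0. x t = x0 + integral {0..t} (\<lambda>r. control_field f G (x r) (\<eta> r))) \<longrightarrow>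
    (\<forall>t\<ge>0. norm (integral {0..t} (\<lambda>r. if r \<in> {..end_time T g} then curve_deriv g r else 0) - integral {0..\<alpha> t} \<eta>) \<le> \<delta>1) \<longrightarrow>
    (\<forall>t\<ge>0. norm (trajectory f G x0 (curve_deriv g) (min t (end_time T g)) - x (\<alpha> t)) \<le> \<rho>)"
    by (elim exE conjE) (rule that)
  have stab: "norm (y (min t e) - x (\<alpha> t)) \<le> \<rho>"
    if "reparam \<alpha> \<beta>" "\<And>t. 0 \<le> t \<Longrightarrow> \<eta> absolutely_integrable_on {0..t} \<and> integral {0..t} (\<lambda>r. norm (\<eta> r)) \<le> \<Lambda>"
      "continuous_on {0..} x" "\<And>t. 0 \<le> t \<Longrightarrow> x t = x0 + integral {0..t} (\<lambda>r. control_field f G (x r) (\<eta> r))"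
      and cl: "\<And>t. 0 \<le> t \<Longrightarrow> norm (g (min t e) - integral {0..\<alpha> t} \<eta>) \<le> \<delta>1" and "0 \<le> t" for \<alpha> \<beta> \<eta> x t
  proof -
    have "norm (integral {0..t} (\<lambda>r. if r \<in> {..end_time T g} then curve_deriv g r else 0) - integral {0..\<alpha> t} \<eta>) \<le> \<delta>1"
      if "0 \<le> t" for t unfolding st(2)[OF that] using cl[OF that] by (simp add: e_def)
    then show ?thesis unfolding y_def e_def using that by (intro stab0[rule_format]) blast+
  qed
  define Z where "Z = (\<Sum>i<m. norm (z i))"
  have Z: "0 \<le> Z" unfolding Z_def by (intro sum_nonneg) auto
  \<comment> \<open>The first bound is for the stability of the trajectory. The second concerns the
    grid sums: each increment changes by at most 4 \<delta>, and weighted with the norms of the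
    minorants this stays below \<kappa>/4.\<close>
  define \<delta> where "\<delta> = min (\<delta>1 / 2) (\<kappa> / (16 * (Z + 1)))"
  have \<delta>: "0 < \<delta>" "2 * \<delta> \<le> \<delta>1" using \<delta>1 \<kappa> Z by (auto simp: \<delta>_def)
  have \<delta>Z: "4 * \<delta> * Z \<le> \<kappa> / 4"
  proof -
    have "4 * \<delta> * Z \<le> 4 * (\<kappa> / (16 * (Z + 1))) * (Z + 1)" using \<delta>(1) Z by (intro mult_mono) (auto simp: \<delta>_def)
    also have "\<dots> = \<kappa> / 4" using Z by (simp add: divide_simps)
    finally show ?thesis .
  qed
  have "ereal c1 < curve_cost f G x0 L T h"
    if h: "control_curve T h" and domh: "{0..end_time T h} \<subseteq> trajectory_domain f G x0 (curve_deriv h)"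
      and len: "truncated_length T h \<le> truncated_length T g + 1"
      and close: "frechet_close (\<lambda>t. g (min t (end_time T g))) (\<lambda>t. h (min t (end_time T h))) (2 * \<delta>)" for h
  proof -
    define e' where "e' = end_time T h"
    have e': "0 < e'" unfolding e'_def by (rule end_time_props(1)[OF h T])
    have ach: "abs_cont_on {0..} h" using h by (simp add: control_curve_def)
    obtain \<alpha> \<beta> where r: "reparam \<alpha> \<beta>" and cl: "\<And>t. 0 \<le> t \<Longrightarrow> norm (g (min t e) - h (min (\<alpha> t) e')) \<le> 2 * \<delta>"
      using close unfolding frechet_close_def e_def e'_def by blast
    note rD = reparamD[OF r]
    note sth = stopped_trajectory[OF h T domh, folded e'_def]
    define x where "x = trajectory f G x0 (curve_deriv h)"
    have near: "norm (y (min t e) - x (min (\<alpha> t) e')) \<le> \<rho>" if t: "0 \<le> t" for t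
    proof (rule stab[OF r _ sth(4) sth(5) _ t, folded x_def])
      fix t :: real assume t: "0 \<le> t"
      show "(\<lambda>r. if r \<in> {..e'} then curve_deriv h r else 0) absolutely_integrable_on {0..t} \<and>
         integral {0..t} (\<lambda>r. norm (if r \<in> {..e'} then curve_deriv h r else 0)) \<le> \<Lambda>"
        using sth(1)[OF t] sth(3)[OF t] len by (simp add: \<Lambda>_def)
      show "norm (g (min t e) - integral {0..\<alpha> t} (\<lambda>r. if r \<in> {..e'} then curve_deriv h r else 0)) \<le> \<delta>1"
        unfolding sth(2)[OF rD(1)[OF t]] using cl[OF t] \<delta>(2) by linarith
    qed
    \<comment> \<open>The grid carried over by \<alpha> and clamped at the end time of
      \<open>h\<close>. Its last point is set to \<open>e'\<close> outright, since \<alpha> may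
      carry \<open>e\<close> to an earlier time.\<close>
    define \<sigma> where "\<sigma> = (\<lambda>i. if i < m then min (\<alpha> (\<tau> i)) e' else e')"
    have \<sigma>cl: "norm (g (\<tau> i) - h (\<sigma> i)) \<le> 2 * \<delta>" if i: "i \<le> m" for i
    proof (cases "i < m")
      case True
      then show ?thesis using cl[OF \<tau>(3)[of i]] \<tau>e[OF i] by (simp add: \<sigma>_def min_absorb1)
    next
      case False
      \<comment> \<open>A time by which both stopped curves have come to rest.\<close>
      define t where "t = max e (\<beta> e')"
      have "0 \<le> t" "min t e = e" using e by (auto simp: t_def)
      moreover have "e' \<le> \<alpha> t" using reparam_mono[OF r rD(2)[of e'], of t] rD(3)[of e'] e' by (simp add: t_def)
      moreover have "i = m" using False i by simp
      ultimately show ?thesis using cl[of t] \<tau>(2) by (simp add: \<sigma>_def min_absorb2)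
    qed
    obtain N' where N': "negligible N'" "\<And>t. 0 \<le> t \<Longrightarrow> t \<notin> N' \<Longrightarrow> 0 \<le> fst (curve_deriv h t)"
      using control_curve_ae[OF h] by blast
    have "ereal ((\<Sum>i<m. z i \<bullet> (h (\<sigma> (Suc i)) - h (\<sigma> i))) - \<epsilon> * integral {0..e'} (\<lambda>r. norm (curve_deriv h r)))
      \<le> ereal_integral (lebesgue_on {0..e'}) (\<lambda>s. ext_lagrangian L (x s) (fst (curve_deriv h s)) (snd (curve_deriv h s)))"
    proof (rule cost_lower_bound[OF e' _ _ N'(1)])
      show "curve_deriv h absolutely_integrable_on {0..e'}" using e' by (intro curve_deriv_has_integral(2)[OF ach]) auto
      show "integral {s..t} (curve_deriv h) = h t - h s" if "0 \<le> s" "s \<le> t" "t \<le> e'" for s t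
        using that by (intro integral_unique curve_deriv_has_integral(1)[OF ach])
      show "0 \<le> fst (curve_deriv h t)" if "t \<in> {0..e'} - N'" for t using that by (intro N'(2)) auto
      show "\<sigma> 0 = 0" using m e' reparam_zero[OF r] \<tau>(1) by (simp add: \<sigma>_def)
      show "\<sigma> m = e'" by (simp add: \<sigma>_def)
      show "\<sigma> i \<le> \<sigma> (Suc i)" if "i < m" for i
        using reparam_mono[OF r \<tau>(3) \<tau>mono, of i] by (auto simp: \<sigma>_def)
      fix i s v w assume i: "i < m" and s: "\<sigma> i \<le> s" "s < \<sigma> (Suc i)" and v: "0 \<le> (v::real)"
      have se: "s < e'" using s(2) by (auto simp: \<sigma>_def split: if_splits)
      then have as: "\<alpha> (\<tau> i) \<le> s" using s(1) i by (simp add: \<sigma>_def min_def split: if_splits)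
      have s0: "0 \<le> s" using as rD(1)[OF \<tau>(3)[of i]] by linarith
      \<comment> \<open>The time of \<open>g\<close> that corresponds to the time \<open>s\<close>
        of \<open>h\<close>; the cut at \<open>e\<close> keeps it in the grid cell when
        \<open>h\<close> runs longer.\<close>
      define t where "t = min (\<beta> s) e"
      have "\<tau> i \<le> \<beta> s" using as reparam_le_iff[OF r \<tau>(3) s0] by simp
      then have t1: "\<tau> i \<le> t" using \<tau>e[of i] i by (simp add: t_def)
      have t2: "t \<le> \<tau> (Suc i)"
      proof (cases "Suc i < m")
        case True
        then have "s \<le> \<alpha> (\<tau> (Suc i))" using s(2) by (simp add: \<sigma>_def)
        then have "\<beta> s \<le> \<tau> (Suc i)" using reparam_le_iff[OF reparam_sym[OF r] s0 \<tau>(3)] by simp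
        then show ?thesis by (simp add: t_def)
      next
        case False
        then have "Suc i = m" using i by simp
        then show ?thesis using \<tau>(2) by (simp add: t_def)
      qed
      have "norm (y t - x (min s e')) \<le> \<rho>" using near[OF rD(2)[OF s0]] rD(3)[OF s0] by (simp add: t_def)
      then have "norm (x s - y t) \<le> \<rho>" using se by (simp add: norm_minus_commute min_def)
      then show "ereal (z i \<bullet> (v, w) - \<epsilon> * norm (v, w)) \<le> ext_lagrangian L (x s) v w"
        using t1 t2 unfolding \<tau>_def by (intro min[OF i _ _ _ v])
    qed
    also have "integral {0..e'} (\<lambda>r. norm (curve_deriv h r)) = truncated_length T h"
      unfolding truncated_length_def e'_def[symmetric] using e' by (intro curve_length_eq_integral[OF ach, symmetric]) simp
    also have "ereal_integral (lebesgue_on {0..e'}) (\<lambda>s. ext_lagrangian L (x s) (fst (curve_deriv h s)) (snd (curve_deriv h s))) = curve_cost f G x0 L T h"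
      unfolding curve_cost_def e'_def x_def ..
    finally have lb: "ereal ((\<Sum>i<m. z i \<bullet> (h (\<sigma> (Suc i)) - h (\<sigma> i))) - \<epsilon> * truncated_length T h) \<le> curve_cost f G x0 L T h" .
    have "(\<Sum>i<m. z i \<bullet> (g (\<tau> (Suc i)) - g (\<tau> i))) - (\<Sum>i<m. z i \<bullet> (h (\<sigma> (Suc i)) - h (\<sigma> i)))
        = (\<Sum>i<m. z i \<bullet> ((g (\<tau> (Suc i)) - h (\<sigma> (Suc i))) - (g (\<tau> i) - h (\<sigma> i))))"
      unfolding sum_subtractf[symmetric] by (intro sum.cong) (simp_all add: inner_diff_right)
    also have "\<dots> \<le> (\<Sum>i<m. norm (z i) * (4 * \<delta>))"
    proof (rule sum_mono)
      fix i assume i: "i \<in> {..<m}"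
      have "norm ((g (\<tau> (Suc i)) - h (\<sigma> (Suc i))) - (g (\<tau> i) - h (\<sigma> i))) \<le> 2 * \<delta> + 2 * \<delta>"
        using \<sigma>cl[of i] \<sigma>cl[of "Suc i"] i by (intro order_trans[OF norm_triangle_ineq4 add_mono]) auto
      then show "z i \<bullet> ((g (\<tau> (Suc i)) - h (\<sigma> (Suc i))) - (g (\<tau> i) - h (\<sigma> i))) \<le> norm (z i) * (4 * \<delta>)"
        by (intro order_trans[OF norm_cauchy_schwarz mult_left_mono]) auto
    qed
    also have "\<dots> = 4 * \<delta> * Z" by (simp add: Z_def sum_distrib_left mult.commute)
    finally have "(\<Sum>i<m. z i \<bullet> (g (\<tau> (Suc i)) - g (\<tau> i))) - \<kappa> / 4 \<le> (\<Sum>i<m. z i \<bullet> (h (\<sigma> (Suc i)) - h (\<sigma> i)))"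
      using \<delta>Z by linarith
    moreover have "\<epsilon> * truncated_length T h \<le> \<kappa> / 4"
      using mult_left_mono[OF len less_imp_le[OF \<epsilon>(1)]] \<epsilon>(2) by (simp add: \<Lambda>_def)
    moreover have "c2 < (\<Sum>i<m. z i \<bullet> (g (\<tau> (Suc i)) - g (\<tau> i)))" using sum by (simp add: \<tau>_def)
    moreover have "c2 = c1 + \<kappa>" by (simp add: \<kappa>_def)
    ultimately have "c1 < (\<Sum>i<m. z i \<bullet> (h (\<sigma> (Suc i)) - h (\<sigma> i))) - \<epsilon> * truncated_length T h"
      using \<kappa> by linarith
    then show ?thesis using lb by (meson less_ereal.simps(1) less_le_trans)
  qed
  then show ?thesis using \<delta>(1) by blast
qed

theorem proposition27:
  fixes T :: real
    and f :: "real^'n \<Rightarrow> real^'n"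
    and G :: "'k::finite \<Rightarrow> real^'n \<Rightarrow> real^'n"
    and x0 :: "real^'n"
    and L :: "real^'n \<Rightarrow> real^'k \<Rightarrow> real"
  assumes "0 < T"
    and "local_lipschitz (UNIV :: real set) UNIV (\<lambda>_. f)"
    and "\<And>i. local_lipschitz (UNIV :: real set) UNIV (\<lambda>_. G i)"
    and "continuous_on UNIV (\<lambda>(x, u). L x u)"
    and "\<And>x. convex_on UNIV (L x)"
  shows "lower_semicontinuous_wrt (dist_T_plus T) (admissible_controls f G x0 T) (cost f G x0 L T)"
  unfolding lower_semicontinuous_wrt_def
proof (intro ballI allI impI)
  fix p c assume p: "p \<in> admissible_controls f G x0 T" and c: "c < cost f G x0 L T p"
  have p': "p \<in> gen_controls T" "{0..end_time T (representative p)} \<subseteq> trajectory_domain f G x0 (curve_deriv (representative p))"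
    using p by (auto simp: admissible_controls_def)
  have split: "dist_T T p q < ereal \<delta>" "\<bar>truncated_length T (representative p) - truncated_length T (representative q)\<bar> < \<delta>"
    if "dist_T_plus T p q < ereal \<delta>" for q \<delta>
  proof -
    define l where "l = \<bar>truncated_length T (representative p) - truncated_length T (representative q)\<bar>"
    have less: "dist_T T p q + ereal l < ereal \<delta>" using that by (simp add: dist_T_plus_def l_def)
    have l: "0 \<le> l" by (simp add: l_def)
    have "dist_T T p q \<le> dist_T T p q + ereal l" "ereal l \<le> dist_T T p q + ereal l"
      using l dist_T_nonneg[of T p q] by (auto intro: add_increasing add_increasing2)
    then show "dist_T T p q < ereal \<delta>" "\<bar>truncated_length T (representative p) - truncated_length T (representative q)\<bar> < \<delta>"
      using less unfolding l_def[symmetric] by (auto dest: le_less_trans)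
  qed
  \<comment> \<open>\<open>c\<close> may be -\<infinity>, while the estimates for the curves use a
    real constant.\<close>
  obtain c1 where c1: "c < ereal c1" "ereal c1 < cost f G x0 L T p" using ereal_dense2[OF c] by blast
  show "\<exists>\<delta>>0. \<forall>q\<in>admissible_controls f G x0 T. dist_T_plus T p q < ereal \<delta> \<longrightarrow> c < cost f G x0 L T q"
  proof (cases "control_curve T (representative p)")
    case False
    \<comment> \<open>A control \<open>q\<close> at distance below 1 would force the excluded
      property of \<open>p\<close>, so in this case the claim is vacuous.\<close>
    have "\<not> dist_T_plus T p q < ereal 1" if q: "q \<in> admissible_controls f G x0 T" for q
      using dist_T_less_imp_frechet_close(1)[OF p'(1) _ assms(1) split(1), of q 1] q False
      by (auto simp: admissible_controls_def)
    then show ?thesis by (intro exI[of _ 1]) auto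
  next
    case True
    obtain \<delta> where \<delta>: "0 < \<delta>" "\<And>h. control_curve T h \<Longrightarrow> {0..end_time T h} \<subseteq> trajectory_domain f G x0 (curve_deriv h) \<Longrightarrow>
      truncated_length T h \<le> truncated_length T (representative p) + 1 \<Longrightarrow>
      frechet_close (\<lambda>t. representative p (min t (end_time T (representative p)))) (\<lambda>t. h (min t (end_time T h))) (2 * \<delta>) \<Longrightarrow>
      ereal c1 < curve_cost f G x0 L T h"
      using lower_semicontinuity_step[OF assms True p'(2), of c1] c1(2) unfolding cost_def by blast
    show ?thesis
    proof (intro exI[of _ "min 1 \<delta>"] conjI ballI impI)
      \<comment> \<open>The bound 1 limits the excess of length, the bound \<delta> the distance of
        the stopped curves.\<close>
      show "0 < min 1 \<delta>" using \<delta>(1) by simp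
      fix q assume q: "q \<in> admissible_controls f G x0 T" and less: "dist_T_plus T p q < ereal (min 1 \<delta>)"
      have q': "q \<in> gen_controls T" "{0..end_time T (representative q)} \<subseteq> trajectory_domain f G x0 (curve_deriv (representative q))"
        using q by (auto simp: admissible_controls_def)
      note s = split[OF less]
      have d: "dist_T T p q < ereal \<delta>" using s(1) by (rule less_le_trans) simp
      note fc = dist_T_less_imp_frechet_close[OF p'(1) q'(1) assms(1) d]
      have "truncated_length T (representative q) \<le> truncated_length T (representative p) + 1" using s(2) by linarith
      then have "ereal c1 < curve_cost f G x0 L T (representative q)" by (intro \<delta>(2) fc q'(2))
      then show "c < cost f G x0 L T q" unfolding cost_def using c1(1) by (rule less_trans[rotated])
    qed
  qed
qed

end
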